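(* The following model-checking problem for $\mathcal L_{\mathrm{CL\text{-}S}^*}(\mathit{Atm},\mathit{Agt})$ is decidable in deterministic polynomial time: given a formula $\varphi\in\mathcal L_{\mathrm{CL\text{-}S}^*}(\mathit{Atm},\mathit{Agt})$, a nonnegative integer $n$, an $n$-bounded spatial model $M$ and a position $(x,y)\in\mathbb Z\times\mathbb Z$, decide whether $M,(x,y)\models\varphi$.
   Context: $\mathit{Atm}$ is a countable set of atomic propositions and $\mathit{Agt}$ a finite set of agents. Formulas of $\mathcal L_{\mathrm{CL\text{-}S}^*}(\mathit{Atm},\mathit{Agt})$ (compass logic of space) are given by $\varphi ::= p \mid \mathsf h_i \mid \neg\varphi \mid \varphi\wedge\psi \mid [\alpha]\varphi$ with $p\in\mathit{Atm}$, $i\in\mathit{Agt}$ and $\alpha\in C=\{\Uparrow,\Downarrow,\Rightarrow,\Leftarrow,\Uparrow^*,\Downarrow^*,\Rightarrow^*,\Leftarrow^*\}$. A spatial model is a pair $M=(\mathcal P,\mathcal V)$ with $\mathcal P:\mathit{Agt}\to\mathbb Z\times\mathbb Z$ and $\mathcal V:\mathbb Z\times\mathbb Z\to 2^{\mathit{Atm}}$. Relations on $\mathbb Z\times\mathbb Z$: $(x,y)R_\Uparrow(x,y+1)$, $(x,y)R_\Downarrow(x,y-1)$, $(x,y)R_\Rightarrow(x+1,y)$, $(x,y)R_\Leftarrow(x-1,y)$ (and no other pairs), and $R_{\alpha^*}$ is the reflexive transitive closure of $R_\alpha$. Truth: $M,(x,y)\models p$ iff $p\in\mathcal V(x,y)$;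 $M,(x,y)\models \mathsf h_i$ iff $\mathcal P(i)=(x,y)$; Boolean connectives as usual; $M,(x,y)\models[\alpha]\varphi$ iff $M,(x',y')\models\varphi$ for all $(x',y')$ with $(x,y)R_\alpha(x',y')$. For $(x,y)\in\mathbb Z^2$ write $|(x,y)|\le n$ iff $|x|\le n$ and $|y|\le n$. A spatial model $M$ is $n$-bounded iff $|\mathcal P(i)|\le n$ for all $i\in\mathit{Agt}$ and $\mathcal V(x,y)=\emptyset$ whenever $|(x,y)|\not\le n$. (Formulas are still interpreted over all of $\mathbb Z\times\mathbb Z$.) The model $M$ is presented to the algorithm by listing explicitly the positions $\mathcal P(i)$ for $i\in\mathit{Agt}$ and, for each of the $(2n+1)^2$ positions $(u,v)$ with $|(u,v)|\le n$, the set of atomic propositions occurring in $\varphi$ that belong to $\mathcal V(u,v)$; running time is measured in the total size of the input. *)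

theory Defs
  imports "HOL-Library.Countable_Set" "HOL-Computational_Algebra.Polynomial"
begin

section \<open>Compass logic of space\<close>

datatype direction = Up | Down | Rightw | Leftw

datatype compass = Once direction | Star direction

datatype (atoms: 'p, agents: 'i) form =
    Atom 'p
  | Here 'i
  | Neg "('p, 'i) form"
  | Conj "('p, 'i) form" "('p, 'i) form"
  | Box compass "('p, 'i) form"

type_synonym point = "int \<times> int"

text \<open>
  A spatial model consists of the positions of the agents and the valuation. The countable set
  \<open>Atm\<close> of atoms and the finite set \<open>Agt\<close> of agents are arbitrary sets over the types
  \<open>'p\<close> and \<open>'i\<close>; the position of an element of \<open>'i\<close> outside \<open>Agt\<close> is irrelevant.
\<close>

type_synonym ('p, 'i) model = "('i \<Rightarrow> point) \<times> (point \<Rightarrow> 'p set)"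

definition formulas :: "'p set \<Rightarrow> 'i set \<Rightarrow> ('p, 'i) form set" where
  "formulas Atm Agt = {\<phi>. atoms \<phi> \<subseteq> Atm \<and> agents \<phi> \<subseteq> Agt}"

definition spatial_model :: "'p set \<Rightarrow> ('p, 'i) model \<Rightarrow> bool" where
  "spatial_model Atm M \<longleftrightarrow> (\<forall>z. snd M z \<subseteq> Atm)"

fun dir_rel :: "direction \<Rightarrow> point rel" where
  "dir_rel Up = {((x, y), (x, y + 1)) | x y. True}"
| "dir_rel Down = {((x, y), (x, y - 1)) | x y. True}"
| "dir_rel Rightw = {((x, y), (x + 1, y)) | x y. True}"
| "dir_rel Leftw = {((x, y), (x - 1, y)) | x y. True}"

fun compass_rel :: "compass \<Rightarrow> point rel" where
  "compass_rel (Once d) = dir_rel d"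
| "compass_rel (Star d) = (dir_rel d)\<^sup>*"

primrec sat :: "('p, 'i) model \<Rightarrow> point \<Rightarrow> ('p, 'i) form \<Rightarrow> bool" where
  "sat M z (Atom p) \<longleftrightarrow> p \<in> snd M z"
| "sat M z (Here i) \<longleftrightarrow> fst M i = z"
| "sat M z (Neg \<phi>) \<longleftrightarrow> \<not> sat M z \<phi>"
| "sat M z (Conj \<phi> \<psi>) \<longleftrightarrow> sat M z \<phi> \<and> sat M z \<psi>"
| "sat M z (Box \<alpha> \<phi>) \<longleftrightarrow> (\<forall>z'. (z, z') \<in> compass_rel \<alpha> \<longrightarrow> sat M z' \<phi>)"

definition in_box :: "nat \<Rightarrow> point \<Rightarrow> bool" where
  "in_box n z \<longleftrightarrow> \<bar>fst z\<bar> \<le> int n \<and> \<bar>snd z\<bar> \<le> int n"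

definition bounded_model :: "'i set \<Rightarrow> nat \<Rightarrow> ('p, 'i) model \<Rightarrow> bool" where
  "bounded_model Agt n M \<longleftrightarrow>
     (\<forall>i\<in>Agt. in_box n (fst M i)) \<and> (\<forall>z. \<not> in_box n z \<longrightarrow> snd M z = {})"


section \<open>Deterministic polynomial time\<close>

text \<open>
  Deterministic Turing machines with finitely many two-way infinite tapes. Tape symbols are the
  blank, the letters of the input alphabet, and finitely many auxiliary symbols.
\<close>

datatype 'a cell = Blank | Letter 'a | Aux nat

datatype move = MoveLeft | Stay | MoveRight

record 'a tm =
  num_tapes :: nat
  num_states :: nat
  tape_symbols :: "'a cell set"
  delta :: "nat \<Rightarrow> 'a cell list \<Rightarrow> nat \<times> ('a cell \<times> move) list"
  start_state :: nat
  accept_state :: nat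
  reject_state :: nat

definition wf_tm :: "'a tm \<Rightarrow> bool" where
  "wf_tm T \<longleftrightarrow>
     num_tapes T \<ge> 1 \<and> finite (tape_symbols T) \<and> insert Blank (range Letter) \<subseteq> tape_symbols T \<and>
     start_state T < num_states T \<and> accept_state T < num_states T \<and>
     reject_state T < num_states T \<and> accept_state T \<noteq> reject_state T \<and>
     (\<forall>q ss q' as. q < num_states T \<longrightarrow> length ss = num_tapes T \<longrightarrow> set ss \<subseteq> tape_symbols T \<longrightarrow>
        delta T q ss = (q', as) \<longrightarrow>
        q' < num_states T \<and> length as = num_tapes T \<and> fst ` set as \<subseteq> tape_symbols T)"

text \<open>A tape is given by its content and the position of the head.\<close>

type_synonym 'a tape = "(int \<Rightarrow> 'a cell) \<times> int"

type_synonym 'a config = "nat \<times> 'a tape list"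

fun read_tape :: "'a tape \<Rightarrow> 'a cell" where
  "read_tape (f, h) = f h"

fun move_head :: "move \<Rightarrow> int \<Rightarrow> int" where
  "move_head MoveLeft h = h - 1"
| "move_head Stay h = h"
| "move_head MoveRight h = h + 1"

fun act_tape :: "'a cell \<times> move \<Rightarrow> 'a tape \<Rightarrow> 'a tape" where
  "act_tape (s, m) (f, h) = (f(h := s), move_head m h)"

fun step :: "'a tm \<Rightarrow> 'a config \<Rightarrow> 'a config" where
  "step T (q, ts) =
     (if q = accept_state T \<or> q = reject_state T then (q, ts)
      else case delta T q (map read_tape ts) of (q', as) \<Rightarrow> (q', map2 act_tape as ts))"

definition input_tape :: "'a list \<Rightarrow> 'a tape" where
  "input_tape w = ((\<lambda>j. if 0 \<le> j \<and> j < int (length w) then Letter (w ! nat j) else Blank), 0)"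

definition init_config :: "'a tm \<Rightarrow> 'a list \<Rightarrow> 'a config" where
  "init_config T w =
     (start_state T, input_tape w # replicate (num_tapes T - 1) (input_tape []))"

definition decides_in_time :: "'a tm \<Rightarrow> 'a list set \<Rightarrow> (nat \<Rightarrow> nat) \<Rightarrow> bool" where
  "decides_in_time T L t \<longleftrightarrow>
     (\<forall>w. \<exists>k \<le> t (length w).
        fst ((step T ^^ k) (init_config T w)) = (if w \<in> L then accept_state T else reject_state T))"

definition polynomial_time :: "'a::finite list set set" where
  "polynomial_time = {L. \<exists>T (b :: nat poly). wf_tm T \<and> decides_in_time T L (poly b)}"


section \<open>The model-checking problem as a language\<close>

datatype symbol = Bit bool | End | SAtom | SHere | SNeg | SConj | SBox compass

instance symbol :: finite
proof
  have "d \<in> {Up, Down, Rightw, Leftw}" for d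
    by (cases d) simp_all
  then have d: "finite (UNIV :: direction set)"
    by (intro finite_subset[of UNIV "{Up, Down, Rightw, Leftw}"]) auto
  have "c \<in> Once ` UNIV \<union> Star ` UNIV" for c
    by (cases c) simp_all
  then have c: "finite (UNIV :: compass set)"
    by (intro finite_subset[of UNIV "Once ` UNIV \<union> Star ` UNIV"]) (auto simp: d)
  have "s \<in> Bit ` UNIV \<union> {End, SAtom, SHere, SNeg, SConj} \<union> SBox ` UNIV" for s
    by (cases s) simp_all
  then show "finite (UNIV :: symbol set)"
    by (intro finite_subset[of UNIV "Bit ` UNIV \<union> {End, SAtom, SHere, SNeg, SConj} \<union> SBox ` UNIV"])
      (auto simp: c)
qed

text \<open>Numbers are written in binary, least significant bit first and without leading zeros.\<close>

fun bits :: "nat \<Rightarrow> bool list" where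
  "bits n = (if n = 0 then [] else odd n # bits (n div 2))"

declare bits.simps [simp del]

definition enc_nat :: "nat \<Rightarrow> symbol list" where
  "enc_nat n = map Bit (bits n) @ [End]"

definition enc_int :: "int \<Rightarrow> symbol list" where
  "enc_int a = Bit (a < 0) # enc_nat (nat \<bar>a\<bar>)"

definition enc_point :: "point \<Rightarrow> symbol list" where
  "enc_point z = enc_int (fst z) @ enc_int (snd z)"

text \<open>
  Atoms and agents are named by their indices in the enumerations \<^const>\<open>to_nat_on\<close> of \<open>Atm\<close> and
  \<open>Agt\<close>, which are bijections onto an initial segment of the natural numbers, or onto all of them.
  Formulas are written in prefix notation.
\<close>

definition enc_atom :: "'p set \<Rightarrow> 'p \<Rightarrow> symbol list" where
  "enc_atom Atm p = SAtom # enc_nat (to_nat_on Atm p)"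

primrec enc_form :: "'p set \<Rightarrow> 'i set \<Rightarrow> ('p, 'i) form \<Rightarrow> symbol list" where
  "enc_form Atm Agt (Atom p) = enc_atom Atm p"
| "enc_form Atm Agt (Here i) = SHere # enc_nat (to_nat_on Agt i)"
| "enc_form Atm Agt (Neg \<phi>) = SNeg # enc_form Atm Agt \<phi>"
| "enc_form Atm Agt (Conj \<phi> \<psi>) = SConj # enc_form Atm Agt \<phi> @ enc_form Atm Agt \<psi>"
| "enc_form Atm Agt (Box \<alpha> \<phi>) = SBox \<alpha> # enc_form Atm Agt \<phi>"

definition enc_agents :: "'i set \<Rightarrow> ('i \<Rightarrow> point) \<Rightarrow> symbol list" where
  "enc_agents Agt P = concat (map (\<lambda>k. enc_point (P (from_nat_into Agt k))) [0..<card Agt])"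

definition enc_table :: "'p set \<Rightarrow> nat \<Rightarrow> (point \<Rightarrow> 'p list) \<Rightarrow> symbol list" where
  "enc_table Atm n l =
     concat (map (\<lambda>z. concat (map (enc_atom Atm) (l z)) @ [End])
       (List.product [- int n..int n] [- int n..int n]))"

text \<open>
  A table \<open>l\<close> lists, for each of the \<open>(2 * n + 1)\<^sup>2\<close> positions in the box, the atoms of the formula
  that are true there, in an arbitrary order and possibly with repetitions.
\<close>

definition lists_valuation ::
  "('p, 'i) form \<Rightarrow> nat \<Rightarrow> ('p, 'i) model \<Rightarrow> (point \<Rightarrow> 'p list) \<Rightarrow> bool" where
  "lists_valuation \<phi> n M l \<longleftrightarrow> (\<forall>z. in_box n z \<longrightarrow> set (l z) = atoms \<phi> \<inter> snd M z)"

definition enc_instance ::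
  "'p set \<Rightarrow> 'i set \<Rightarrow> ('p, 'i) form \<Rightarrow> nat \<Rightarrow> ('p, 'i) model \<Rightarrow> (point \<Rightarrow> 'p list) \<Rightarrow> point \<Rightarrow> symbol list"
where
  "enc_instance Atm Agt \<phi> n M l z =
     enc_form Atm Agt \<phi> @ enc_nat n @ enc_agents Agt (fst M) @ enc_table Atm n l @ enc_point z"

text \<open>
  Words that do not present any instance are not in the language, so a machine deciding it also
  recognises malformed inputs.
\<close>

definition model_checking :: "'p set \<Rightarrow> 'i set \<Rightarrow> symbol list set" where
  "model_checking Atm Agt =
     {enc_instance Atm Agt \<phi> n M l z | \<phi> n M l z.
        \<phi> \<in> formulas Atm Agt \<and> spatial_model Atm M \<and> bounded_model Agt n M \<and>
        lists_valuation \<phi> n M l \<and> sat M z \<phi>}"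

end

theory Submission
  imports Defs
begin

text \<open>
  Outside the box of radius \<open>n + depth \<phi>\<close> the truth value of \<open>\<phi>\<close> does not change any more when one
  moves further away along an axis. Hence, with \<open>K\<close> the length of the input, \<open>\<phi>\<close> may be evaluated in
  the grid of radius \<open>K\<close>, where a step across the border is replaced by staying put: the truth sets of
  all subformulas in this grid are computed bottom-up, and only the position asked for, which may be
  exponentially far away, has to be clipped to the grid first.

  To see that this takes polynomial time on a Turing machine, values are coded as binary trees in
  prefix notation on a single stack, where forming and taking apart pairs is trivial. The functions
  computable in polynomial time are then closed under composition, pairing, case distinction and
  iteration along lists, provided that each round increases the size of the accumulator by at most a
  polynomial in the size of the fixed data. The decision procedure is a list program of this kind.
\<close>

section \<open>Structured Turing machine programs\<close>

text \<open>The length of the word is a sufficient radius because it dominates both parameters: the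
  code of a formula is at least as long as its depth, and the table spends an \<open>End\<close> on
  each of the (2n+1)^2 positions although n itself is written in binary. The coordinates in the
  input may still be exponentially large, whereas numbers are handled in unary, so numerals are
  truncated at the radius while they are read; a truncated value below the radius is exact.

  The restriction on growth is forced by iteration: a polynomial-time round that doubles its
  accumulator leads to exponential size. The bound has to hold for every accumulator, including
  those that never occur.

  Since malformed words must be rejected, acceptance has to imply that the word presents an
  instance; for this a formula, a model and a table are rebuilt from the word. \<open>Atm\<close>
  and \<open>Agt\<close> are fixed, so the machine may depend on them. All it has to know is which
  indices are names, that is, whether \<open>Atm\<close> is infinite and the two
  cardinalities.\<close>

datatype 'a com =
    Act "'a cell list \<Rightarrow> ('a cell \<times> move) list"
  | Seq "'a com" "'a com"
  | Cond "'a cell list \<Rightarrow> bool" "'a com" "'a com"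
  | While "'a cell list \<Rightarrow> bool" "'a com"

inductive exec :: "'a com \<Rightarrow> 'a tape list \<Rightarrow> nat \<Rightarrow> 'a tape list \<Rightarrow> bool" where
  exec_Act: "exec (Act F) ts 1 (map2 act_tape (F (map read_tape ts)) ts)"
| exec_Seq: "exec c ts m ts' \<Longrightarrow> exec d ts' n ts'' \<Longrightarrow> exec (Seq c d) ts (m + n) ts''"
| exec_CondT: "B (map read_tape ts) \<Longrightarrow> exec c ts n ts' \<Longrightarrow> exec (Cond B c d) ts (Suc n) ts'"
| exec_CondF: "\<not> B (map read_tape ts) \<Longrightarrow> exec d ts n ts' \<Longrightarrow> exec (Cond B c d) ts (Suc n) ts'"
| exec_WhileT: "B (map read_tape ts) \<Longrightarrow> exec c ts m ts' \<Longrightarrow> exec (While B c) ts' n ts'' \<Longrightarrow>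
    exec (While B c) ts (Suc (m + n)) ts''"
| exec_WhileF: "\<not> B (map read_tape ts) \<Longrightarrow> exec (While B c) ts 1 ts"

definition stay :: "'a cell list \<Rightarrow> ('a cell \<times> move) list" where
  "stay ss = map (\<lambda>s. (s, Stay)) ss"

lemma act_stay: "map2 act_tape (stay (map read_tape ts)) ts = ts"
proof -
  have "act_tape (read_tape t, Stay) t = t" for t :: "'a tape"
    by (cases t) simp
  then show ?thesis
    by (induction ts) (simp_all add: stay_def)
qed

primrec len :: "'a com \<Rightarrow> nat" where
  "len (Act F) = 1"
| "len (Seq c d) = len c + len d"
| "len (Cond B c d) = 1 + len c + len d"
| "len (While B c) = 1 + len c"

text \<open>
  The code of a program occupies the states from \<open>s\<close> to \<open>s + len c - 1\<close>; it is entered at \<open>s\<close>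
  and left for the state \<open>e\<close>.
\<close>

primrec trans :: "'a com \<Rightarrow> nat \<Rightarrow> nat \<Rightarrow> nat \<Rightarrow> 'a cell list \<Rightarrow> nat \<times> ('a cell \<times> move) list" where
  "trans (Act F) s e q ss = (e, F ss)"
| "trans (Seq c d) s e q ss =
     (if q < s + len c then trans c s (s + len c) q ss else trans d (s + len c) e q ss)"
| "trans (Cond B c d) s e q ss =
     (if q = s then (if B ss then s + 1 else s + 1 + len c, stay ss)
      else if q < s + 1 + len c then trans c (s + 1) e q ss else trans d (s + 1 + len c) e q ss)"
| "trans (While B c) s e q ss =
     (if q = s then (if B ss then s + 1 else e, stay ss) else trans c (s + 1) s q ss)"

text \<open>Guarantees that the entry state of a block belongs to the block itself, so that a jump
  to it lands inside the code of the subprogram.\<close>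

lemma len_pos: "0 < len c"
  by (induction c) simp_all

text \<open>\<open>delta\<close> has to agree with \<open>trans\<close> only on the states of the
  block, and \<open>s\<close> and \<open>e\<close> are arbitrary. The statement therefore applies to
  every subprogram inside a larger machine, with the exit dictated by the context.\<close>

lemma exec_steps:
  assumes "exec c ts n ts'"
    and "\<And>q ss. s \<le> q \<Longrightarrow> q < s + len c \<Longrightarrow> delta T q ss = trans c s e q ss"
    and "\<And>q. s \<le> q \<Longrightarrow> q < s + len c \<Longrightarrow> q \<noteq> accept_state T \<and> q \<noteq> reject_state T"
  shows "(step T ^^ n) (s, ts) = (e, ts')"
  using assms
proof (induction arbitrary: s e rule: exec.induct)
  case (exec_Act F ts)
  from exec_Act(1)[of s] exec_Act(2)[of s] show ?case by simp
next
  case (exec_Seq c ts m ts' d n ts'')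
  have c: "(step T ^^ m) (s, ts) = (s + len c, ts')"
    using exec_Seq.prems by (intro exec_Seq.IH(1)) (simp_all add: len_pos)
  have d: "(step T ^^ n) (s + len c, ts') = (e, ts'')"
    using exec_Seq.prems by (intro exec_Seq.IH(2)) (simp_all add: len_pos)
  have "(step T ^^ (n + m)) (s, ts) = (e, ts'')"
    by (simp only: funpow_add o_apply c d)
  then show ?case by (simp only: add.commute)
next
  case (exec_CondT B ts c n ts' d)
  have 1: "step T (s, ts) = (s + 1, ts)"
    using exec_CondT.prems(1)[of s] exec_CondT.prems(2)[of s] exec_CondT.hyps by (simp add: act_stay)
  have "(step T ^^ n) (s + 1, ts) = (e, ts')"
    using exec_CondT.prems by (intro exec_CondT.IH) (simp_all add: len_pos)
  with 1 show ?case by (simp only: funpow_Suc_right o_apply)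
next
  case (exec_CondF B ts d n ts' c)
  have 1: "step T (s, ts) = (s + 1 + len c, ts)"
    using exec_CondF.prems(1)[of s] exec_CondF.prems(2)[of s] exec_CondF.hyps by (simp add: act_stay)
  have "(step T ^^ n) (s + 1 + len c, ts) = (e, ts')"
    using exec_CondF.prems by (intro exec_CondF.IH) (simp_all add: len_pos)
  with 1 show ?case by (simp only: funpow_Suc_right o_apply)
next
  case (exec_WhileT B ts c m ts' n ts'')
  have 1: "step T (s, ts) = (s + 1, ts)"
    using exec_WhileT.prems(1)[of s] exec_WhileT.prems(2)[of s] exec_WhileT.hyps
    by (simp add: act_stay)
  \<comment> \<open>The exit of the loop body is \<open>s\<close> itself, so that the test is
    repeated.\<close>
  have 2: "(step T ^^ m) (s + 1, ts) = (s, ts')"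
    using exec_WhileT.prems by (intro exec_WhileT.IH(1)) (simp_all add: len_pos)
  have 3: "(step T ^^ n) (s, ts') = (e, ts'')"
    using exec_WhileT.prems by (intro exec_WhileT.IH(2)) simp_all
  have "(step T ^^ (n + Suc m)) (s, ts) = (e, ts'')"
    by (simp only: funpow_add funpow_Suc_right o_apply 1 2 3)
  moreover have "n + Suc m = Suc (m + n)" by simp
  ultimately show ?case by metis
next
  case (exec_WhileF B ts c)
  then show ?case
    using exec_WhileF.prems(1)[of s] exec_WhileF.prems(2)[of s] by (simp add: act_stay)
qed

primrec acts :: "'a com \<Rightarrow> ('a cell list \<Rightarrow> ('a cell \<times> move) list) set" where
  "acts (Act F) = {F}"
| "acts (Seq c d) = acts c \<union> acts d"
| "acts (Cond B c d) = acts c \<union> acts d"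
| "acts (While B c) = acts c"

text \<open>Only the functions in \<open>Act\<close> have to be checked: every other transition is
  \<open>stay\<close>, which rewrites the symbols just read.\<close>

definition wf_com :: "nat \<Rightarrow> 'a cell set \<Rightarrow> 'a com \<Rightarrow> bool" where
  "wf_com k \<Sigma> c \<longleftrightarrow> (\<forall>F\<in>acts c. \<forall>ss. length ss = k \<longrightarrow> set ss \<subseteq> \<Sigma> \<longrightarrow>
     length (F ss) = k \<and> fst ` set (F ss) \<subseteq> \<Sigma>)"

lemma wf_com_simps:
  "wf_com k \<Sigma> (Seq c d) \<longleftrightarrow> wf_com k \<Sigma> c \<and> wf_com k \<Sigma> d"
  "wf_com k \<Sigma> (Cond B c d) \<longleftrightarrow> wf_com k \<Sigma> c \<and> wf_com k \<Sigma> d"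
  "wf_com k \<Sigma> (While B c) \<longleftrightarrow> wf_com k \<Sigma> c"
  unfolding wf_com_def acts.simps ball_Un by (rule refl)+

lemma wf_trans:
  assumes "wf_com k \<Sigma> c" "length ss = k" "set ss \<subseteq> \<Sigma>" "s \<le> q" "q < s + len c"
    and "trans c s e q ss = (q', as)"
  shows "(q' = e \<or> s \<le> q' \<and> q' < s + len c) \<and> length as = k \<and> fst ` set as \<subseteq> \<Sigma>"
proof -
  have st: "length (stay ss) = k \<and> fst ` set (stay ss) \<subseteq> \<Sigma>"
    using assms(2,3) by (auto simp: stay_def)
  show ?thesis
    using assms(1,4-6)
  proof (induction c arbitrary: s e)
    case (Act F)
    with assms(2,3) show ?case by (auto simp: wf_com_def)
  next
    case (Seq c d)
    show ?case
    proof (cases "q < s + len c")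
      case True
      then show ?thesis
        using Seq.IH(1)[of s "s + len c"] Seq.prems len_pos[of d] by (auto simp: wf_com_simps)
    next
      case False
      then show ?thesis
        using Seq.IH(2)[of "s + len c" e] Seq.prems by (auto simp: wf_com_simps)
    qed
  next
    case (Cond B c d)
    consider "q = s" | "q \<noteq> s" "q < s + 1 + len c" | "q \<noteq> s" "\<not> q < s + 1 + len c" by blast
    then show ?case
    proof cases
      case 1
      then show ?thesis using Cond.prems st len_pos[of d] by (auto split: if_splits)
    next
      case 2
      then show ?thesis
        using Cond.IH(1)[of "s + 1" e] Cond.prems by (auto simp: wf_com_simps)
    next
      case 3
      then show ?thesis
        using Cond.IH(2)[of "s + 1 + len c" e] Cond.prems by (auto simp: wf_com_simps)
    qed
  next
    case (While B c)
    show ?case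
    proof (cases "q = s")
      case True
      then show ?thesis using While.prems st len_pos[of c] by (auto split: if_splits)
    next
      case False
      then show ?thesis
        using While.IH[of "s + 1" s] While.prems by (auto simp: wf_com_simps)
    qed
  qed
qed

text \<open>\<open>len c\<close> is the exit state of the code. There \<open>A\<close> inspects the
  symbols under the heads and selects one of the two halting states that follow; this is one more
  step than the program takes.\<close>

definition machine :: "nat \<Rightarrow> 'a cell set \<Rightarrow> 'a com \<Rightarrow> ('a cell list \<Rightarrow> bool) \<Rightarrow> 'a tm" where
  "machine k \<Sigma> c A =
     \<lparr>num_tapes = k, num_states = len c + 3, tape_symbols = \<Sigma>,
      delta = (\<lambda>q ss. if q < len c then trans c 0 (len c) q ss
                      else (if A ss then len c + 1 else len c + 2, stay ss)),
      start_state = 0, accept_state = len c + 1, reject_state = len c + 2\<rparr>"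

lemma wf_machine:
  assumes "wf_com k \<Sigma> c" "k \<ge> 1" "finite \<Sigma>" "insert Blank (range Letter) \<subseteq> \<Sigma>"
  shows "wf_tm (machine k \<Sigma> c A)"
proof -
  have "q' < len c + 3 \<and> length as = k \<and> fst ` set as \<subseteq> \<Sigma>"
    if "length ss = k" "set ss \<subseteq> \<Sigma>" "delta (machine k \<Sigma> c A) q ss = (q', as)" for q ss q' as
  proof (cases "q < len c")
    case True
    then show ?thesis using wf_trans[OF assms(1) that(1,2), of 0 q "len c" q' as] that(3)
      by (auto simp: machine_def)
  next
    case False
    then show ?thesis using that by (auto simp: machine_def stay_def)
  qed
  then show ?thesis
    unfolding wf_tm_def using assms len_pos[of c] by (simp add: machine_def)
qed

lemma machine_decides:
  assumes wf: "wf_com k \<Sigma> c" "k \<ge> 1" "finite \<Sigma>" "insert Blank (range Letter) \<subseteq> \<Sigma>"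
    and run: "\<And>w. \<exists>m ts. m \<le> poly b (length w) \<and>
      exec c (input_tape w # replicate (k - 1) (input_tape [])) m ts \<and> (A (map read_tape ts) \<longleftrightarrow> w \<in> L)"
  shows "L \<in> polynomial_time"
proof -
  let ?T = "machine k \<Sigma> c A"
  have "decides_in_time ?T L (poly (b + 1))"
    unfolding decides_in_time_def
  proof
    fix w
    obtain m ts where m: "m \<le> poly b (length w)"
      and e: "exec c (input_tape w # replicate (k - 1) (input_tape [])) m ts"
      and A: "A (map read_tape ts) \<longleftrightarrow> w \<in> L"
      using run by blast
    have i: "init_config ?T w = (0, input_tape w # replicate (k - 1) (input_tape []))"
      by (simp add: init_config_def machine_def)
    have "(step ?T ^^ m) (init_config ?T w) = (len c, ts)"
      unfolding i by (rule exec_steps[OF e]) (simp_all add: machine_def)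
    moreover have "fst (step ?T (len c, ts)) = (if w \<in> L then accept_state ?T else reject_state ?T)"
      using A by (simp add: machine_def)
    ultimately have "fst ((step ?T ^^ Suc m) (init_config ?T w)) =
        (if w \<in> L then accept_state ?T else reject_state ?T)"
      by (simp del: step.simps)
    moreover have "Suc m \<le> poly (b + 1) (length w)" using m by simp
    ultimately show "\<exists>k \<le> poly (b + 1) (length w). fst ((step ?T ^^ k) (init_config ?T w)) =
        (if w \<in> L then accept_state ?T else reject_state ?T)"
      by blast
  qed
  with wf_machine[OF wf] show ?thesis
    unfolding polynomial_time_def by blast
qed

section \<open>Stacks on tapes\<close>

text \<open>A stack is written from the head to the right, with the top of the stack under the head.\<close>

definition stk :: "'a cell list \<Rightarrow> 'a tape \<Rightarrow> bool" where
  "stk xs t \<longleftrightarrow> (\<forall>j. fst t j = (if snd t \<le> j \<and> j < snd t + int (length xs)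
     then xs ! nat (j - snd t) else Blank))"

primrec topc :: "'a cell list \<Rightarrow> 'a cell" where
  "topc [] = Blank"
| "topc (x # xs) = x"

text \<open>Moving left pushes a blank that a later action has to fill, so a push costs two actions.
  Writing a blank on an empty stack leaves it empty; otherwise an idle stack would acquire a
  spurious entry.\<close>

fun act_stk :: "'a cell \<times> move \<Rightarrow> 'a cell list \<Rightarrow> 'a cell list" where
  "act_stk (s, Stay) xs = (if xs = [] \<and> s = Blank then [] else s # tl xs)"
| "act_stk (s, MoveLeft) xs = Blank # (if xs = [] \<and> s = Blank then [] else s # tl xs)"
| "act_stk (s, MoveRight) xs = tl xs"

lemma stk_input: "stk (map Letter w) (input_tape w)"
  by (auto simp: stk_def input_tape_def)

lemma stk_top: "stk xs t \<Longrightarrow> read_tape t = topc xs"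
  by (cases t; cases xs) (simp_all add: stk_def)

lemma stk_write:
  assumes "stk xs (f, h)"
  shows "stk (if xs = [] \<and> s = Blank then [] else s # tl xs) (f(h := s), h)"
proof (cases xs)
  case Nil
  with assms show ?thesis by (auto simp: stk_def)
next
  case (Cons x ys)
  have "(x # ys) ! nat (j - h) = ys ! nat (j - h - 1)" if "h < j" for j
    using that by (simp add: nth_Cons' nat_diff_distrib)
  moreover have "(s # ys) ! nat (j - h) = ys ! nat (j - h - 1)" if "h < j" for j
    using that by (simp add: nth_Cons' nat_diff_distrib)
  ultimately show ?thesis
    using assms unfolding Cons stk_def by (auto split: if_splits)
qed

text \<open>All cells to the left of the head must be blank, so a right move is a pop and has to
  erase the cell it leaves.\<close>

lemma stk_act:
  assumes "stk xs t" "snd a = MoveRight \<Longrightarrow> fst a = Blank"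
  shows "stk (act_stk a xs) (act_tape a t)"
proof -
  obtain s m f h where [simp]: "a = (s, m)" "t = (f, h)" by (cases a; cases t)
  let ?ys = "if xs = [] \<and> s = Blank then [] else s # tl xs"
  have w: "stk ?ys (f(h := s), h)"
    using assms(1) by (intro stk_write) simp
  show ?thesis
  proof (cases m)
    case Stay
    with w show ?thesis by simp
  next
    case MoveLeft
    have "(Blank # ys) ! nat (j - (h - 1)) = ys ! nat (j - h)" if "h \<le> j" for j and ys :: "'a cell list"
    proof -
      have "nat (j - (h - 1)) = Suc (nat (j - h))" using that by linarith
      then show ?thesis by simp
    qed
    with w have "stk (Blank # ?ys) (f(h := s), h - 1)"
      unfolding stk_def by (auto simp del: fun_upd_apply)
    with MoveLeft show ?thesis by simp
  next
    case MoveRight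
    with assms(2) have [simp]: "s = Blank" by simp
    have "ys ! nat (j - h) = tl ys ! nat (j - (h + 1))" if "h < j" "j < h + int (length ys)"
      for j and ys :: "'a cell list"
    proof -
      have "nat (j - h) = Suc (nat (j - (h + 1)))" using that by linarith
      then show ?thesis using that by (cases ys) simp_all
    qed
    with w have "stk (tl xs) (f(h := Blank), h + 1)"
      unfolding stk_def by (cases xs) (auto split: if_splits)
    with MoveRight show ?thesis by simp
  qed
qed

text \<open>Quantifying over all tapes that represent the stacks hides the head positions. As
  \<open>n\<close> is only an upper bound, running times may be rounded up.\<close>

definition run :: "'a com \<Rightarrow> 'a cell list list \<Rightarrow> nat \<Rightarrow> 'a cell list list \<Rightarrow> bool" where
  "run c S n S' \<longleftrightarrow>
     (\<forall>ts. list_all2 stk S ts \<longrightarrow> (\<exists>m\<le>n. \<exists>ts'. exec c ts m ts' \<and> list_all2 stk S' ts'))"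

lemma stks_top: "list_all2 stk S ts \<Longrightarrow> map read_tape ts = map topc S"
  by (induction rule: list_all2_induct) (simp_all add: stk_top)

lemma run_Act:
  assumes "length (F (map topc S)) = length S"
    and "\<And>s. (s, MoveRight) \<in> set (F (map topc S)) \<Longrightarrow> s = Blank"
  shows "run (Act F) S 1 (map2 act_stk (F (map topc S)) S)"
  unfolding run_def
proof (intro allI impI)
  fix ts assume ts: "list_all2 stk S ts"
  have "list_all2 stk (map2 act_stk as S) (map2 act_tape as ts)"
    if "length as = length S" "\<And>s. (s, MoveRight) \<in> set as \<Longrightarrow> s = Blank" for as :: "('a cell \<times> move) list"
    using ts that
  proof (induction arbitrary: as rule: list_all2_induct)
    case (Cons x xs y ys)
    then obtain a as' where [simp]: "as = a # as'" by (cases as) auto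
    have "stk (act_stk a x) (act_tape a y)"
      using Cons.hyps(1) Cons.prems(2) by (intro stk_act) (cases a; auto)+
    then show ?case using Cons.IH[of as'] Cons.prems by auto
  qed simp
  from this[OF assms] show "\<exists>m\<le>1. \<exists>ts'. exec (Act F) ts m ts' \<and>
      list_all2 stk (map2 act_stk (F (map topc S)) S) ts'"
    using exec_Act[of F ts] stks_top[OF ts] by auto
qed

lemma run_mono: "run c S m S' \<Longrightarrow> m \<le> n \<Longrightarrow> run c S n S'"
  unfolding run_def by (meson le_trans)

lemma run_Seq: "run c S m S' \<Longrightarrow> run d S' n S'' \<Longrightarrow> run (Seq c d) S (m + n) S''"
  unfolding run_def by (meson add_mono exec_Seq)

lemma run_CondT: "B (map topc S) \<Longrightarrow> run c S n S' \<Longrightarrow> run (Cond B c d) S (Suc n) S'"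
  unfolding run_def by (metis Suc_le_mono exec_CondT stks_top)

lemma run_CondF: "\<not> B (map topc S) \<Longrightarrow> run d S n S' \<Longrightarrow> run (Cond B c d) S (Suc n) S'"
  unfolding run_def by (metis Suc_le_mono exec_CondF stks_top)

lemma run_WhileT:
  assumes "B (map topc S)" "run c S m S'" "run (While B c) S' n S''"
  shows "run (While B c) S (Suc (m + n)) S''"
  unfolding run_def
proof (intro allI impI)
  fix ts assume ts: "list_all2 stk S ts"
  with assms(2) obtain k ts' where 1: "k \<le> m" "exec c ts k ts'" "list_all2 stk S' ts'"
    unfolding run_def by blast
  with assms(3) obtain l ts'' where 2: "l \<le> n" "exec (While B c) ts' l ts''" "list_all2 stk S'' ts''"
    unfolding run_def by blast
  have "exec (While B c) ts (Suc (k + l)) ts''"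
    using assms(1) 1(2) 2(2) stks_top[OF ts] by (intro exec_WhileT) simp_all
  with 1 2 show "\<exists>k\<le>Suc (m + n). \<exists>ts'. exec (While B c) ts k ts' \<and> list_all2 stk S'' ts'"
    by (intro exI[of _ "Suc (k + l)"]) auto
qed

lemma run_WhileF: "\<not> B (map topc S) \<Longrightarrow> run (While B c) S 1 S"
  unfolding run_def using exec_WhileF stks_top by (metis order_refl)

lemma act_stk_simps [simp]:
  "act_stk (s, Stay) (x # xs) = s # xs"
  "act_stk (topc ys, Stay) ys = ys"
  "act_stk (s, Stay) [] = (if s = Blank then [] else [s])"
  "act_stk (s, MoveLeft) (x # xs) = Blank # s # xs"
  "act_stk (topc ys, MoveLeft) ys = Blank # ys"
  "act_stk (s, MoveRight) ys = tl ys"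
  by (cases ys; simp)+

declare act_stk.simps [simp del]

lemma run_Act4:
  assumes "F [topc a, topc b, topc c, topc d] = [a', b', c', d']"
    and "\<forall>s. (s, MoveRight) \<in> {a', b', c', d'} \<longrightarrow> s = Blank"
    and "S = [act_stk a' a, act_stk b' b, act_stk c' c, act_stk d' d]" "n \<ge> 1"
  shows "run (Act F) [a, b, c, d] n S"
  using run_mono[OF run_Act[of F "[a, b, c, d]"] \<open>n \<ge> 1\<close>] assms by simp


section \<open>Serialised trees\<close>

datatype tree = Nil_tree | Leaf symbol | Node tree tree

primrec ser :: "tree \<Rightarrow> symbol cell list" where
  "ser Nil_tree = [Aux 0]"
| "ser (Leaf s) = [Letter s]"
| "ser (Node a b) = Aux 1 # ser a @ ser b"

abbreviation tsize :: "tree \<Rightarrow> nat" where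
  "tsize v \<equiv> length (ser v)"

lemma ser_no_Blank: "Blank \<notin> set (ser v)"
  by (induction v) auto

lemma ser_ne [simp]: "ser v \<noteq> []"
  by (cases v) auto

text \<open>Prefix notation is self-delimiting: no serialisation is a proper prefix of another one,
  so the topmost tree is determined without an end marker.\<close>

lemma ser_append_inject: "ser v @ R = ser v' @ R' \<longleftrightarrow> v = v' \<and> R = R'"
proof (induction v arbitrary: v' R R')
  case (Node a b)
  show ?case by (cases v') (auto simp: Node)
qed (case_tac v'; auto)+

lemma ser_inject: "ser v = ser v' \<longleftrightarrow> v = v'"
  using ser_append_inject[of v "[]" v' "[]"] by simp

definition alphabet :: "symbol cell set" where
  "alphabet = {Blank, Aux 0, Aux 1} \<union> range Letter"

abbreviation wfc :: "symbol com \<Rightarrow> bool" where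
  "wfc \<equiv> wf_com 4 alphabet"

lemma alphabet_simps [simp]: "Blank \<in> alphabet" "Aux 0 \<in> alphabet" "Aux (Suc 0) \<in> alphabet" "Letter s \<in> alphabet"
  by (simp_all add: alphabet_def)

lemma ser_alphabet: "set (ser v) \<subseteq> alphabet"
  by (induction v) auto

lemma length4E:
  assumes "length ss = 4"
  obtains a b c d where "ss = [a, b, c, d]"
  using assms by (auto simp: numeral_eq_Suc length_Suc_conv)

lemma wfc_Act:
  assumes "\<And>a b c d. {a, b, c, d} \<subseteq> alphabet \<Longrightarrow> length (F [a, b, c, d]) = 4 \<and> fst ` set (F [a, b, c, d]) \<subseteq> alphabet"
  shows "wfc (Act F)"
  unfolding wf_com_def
proof (intro ballI allI impI)
  fix G :: "symbol cell list \<Rightarrow> (symbol cell \<times> move) list" and ss :: "symbol cell list"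
  assume "G \<in> acts (Act F)" "length ss = 4" "set ss \<subseteq> alphabet"
  with assms show "length (G ss) = 4 \<and> fst ` set (G ss) \<subseteq> alphabet"
    by (elim length4E) simp
qed

text \<open>Copying a symbol takes two actions, because the receiving stacks must first expose a
  blank cell, which \<open>scanB\<close> fills. The flags select the receiving stacks. A node turns
  one pending subtree into two, so the counter grows; any other symbol completes a subtree.\<close>

definition scanA :: "bool \<Rightarrow> bool \<Rightarrow> symbol com" where
  "scanA p q = Act (\<lambda>ss. [(ss ! 0, Stay), (ss ! 1, if p then MoveLeft else Stay),
     (ss ! 2, if q then MoveLeft else Stay),
     if ss ! 0 = Aux 1 then (ss ! 3, MoveLeft) else (Blank, MoveRight)])"

definition scanB :: "bool \<Rightarrow> bool \<Rightarrow> symbol com" where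
  "scanB p q = Act (\<lambda>ss. [(Blank, MoveRight), (if p then ss ! 0 else ss ! 1, Stay),
     (if q then ss ! 0 else ss ! 2, Stay), (if ss ! 0 = Aux 1 then Aux 0 else ss ! 3, Stay)])"

text \<open>
  Stack 3 counts the subtrees that are still to be read; the stacks 1 and 2 receive the tree in reverse.
\<close>

definition scan :: "bool \<Rightarrow> bool \<Rightarrow> symbol com" where
  "scan p q = Seq (Act (\<lambda>ss. [(ss ! 0, Stay), (ss ! 1, Stay), (ss ! 2, Stay), (Aux 0, Stay)]))
     (While (\<lambda>ss. ss ! 3 \<noteq> Blank) (Seq (scanA p q) (scanB p q)))"

lemma wfc_scan: "wfc (scan p q)"
  unfolding scan_def scanA_def scanB_def wf_com_simps by (intro conjI wfc_Act) auto

lemma scan_char: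
  assumes "c = Aux 1 \<Longrightarrow> C' = Aux 0 # C" "c \<noteq> Aux 1 \<Longrightarrow> C' = tl C"
  shows "run (Seq (scanA p q) (scanB p q)) [c # R, X, Y, C] 2
     [R, if p then c # X else X, if q then c # Y else Y, C']"
proof -
  let ?S = "[c # R, if p then Blank # X else X, if q then Blank # Y else Y,
    if c = Aux 1 then Blank # C else tl C]"
  have "run (scanA p q) [c # R, X, Y, C] 1 ?S"
    unfolding scanA_def by (rule run_Act4) (auto split: if_splits)
  moreover have "run (scanB p q) ?S 1 [R, if p then c # X else X, if q then c # Y else Y, C']"
    unfolding scanB_def by (rule run_Act4) (use assms in \<open>auto split: if_splits\<close>)
  ultimately show ?thesis
    using run_Seq by (metis one_add_one)
qed

text \<open>Stated in continuation form: the assumption is a run of the same loop after the tree has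
  been consumed. This lets the induction chain the two subtrees of a node within a single loop. A
  symbol costs one test and two actions, whence the factor 3.\<close>

lemma scan_loop:
  assumes "run (While (\<lambda>ss. ss ! 3 \<noteq> Blank) (Seq (scanA p q) (scanB p q)))
     [R, if p then rev (ser v) @ X else X, if q then rev (ser v) @ Y else Y, C] n S"
  shows "run (While (\<lambda>ss. ss ! 3 \<noteq> Blank) (Seq (scanA p q) (scanB p q)))
     [ser v @ R, X, Y, Aux 0 # C] (n + 3 * tsize v) S"
  using assms
proof (induction v arbitrary: R X Y C n)
  case Nil_tree
  have "run (While (\<lambda>ss. ss ! 3 \<noteq> Blank) (Seq (scanA p q) (scanB p q)))
     [Aux 0 # R, X, Y, Aux 0 # C] (Suc (2 + n)) S"
    by (rule run_WhileT[OF _ scan_char]) (use Nil_tree in auto)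
  then show ?case by (simp, elim run_mono) simp
next
  case (Leaf s)
  have "run (While (\<lambda>ss. ss ! 3 \<noteq> Blank) (Seq (scanA p q) (scanB p q)))
     [Letter s # R, X, Y, Aux 0 # C] (Suc (2 + n)) S"
    by (rule run_WhileT[OF _ scan_char]) (use Leaf in auto)
  then show ?case by (simp, elim run_mono) simp
next
  case (Node a b)
  let ?X = "if p then Aux 1 # X else X" and ?Y = "if q then Aux 1 # Y else Y"
  have "run (While (\<lambda>ss. ss ! 3 \<noteq> Blank) (Seq (scanA p q) (scanB p q)))
     [ser a @ ser b @ R, ?X, ?Y, Aux 0 # Aux 0 # C] (n + 3 * tsize b + 3 * tsize a) S"
    by (rule Node.IH(1), rule Node.IH(2)) (use Node.prems in \<open>cases p; cases q; simp\<close>)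
  then have "run (While (\<lambda>ss. ss ! 3 \<noteq> Blank) (Seq (scanA p q) (scanB p q)))
     [Aux 1 # ser a @ ser b @ R, X, Y, Aux 0 # C] (Suc (2 + (n + 3 * tsize b + 3 * tsize a))) S"
    by (intro run_WhileT[OF _ scan_char]) auto
  then show ?case by (simp, elim run_mono) simp
qed

lemma run_scan:
  "run (scan p q) [ser v @ R, X, Y, []] (2 + 3 * tsize v)
     [R, if p then rev (ser v) @ X else X, if q then rev (ser v) @ Y else Y, []]"
proof -
  have "run (While (\<lambda>ss. ss ! 3 \<noteq> Blank) (Seq (scanA p q) (scanB p q)))
     [ser v @ R, X, Y, [Aux 0]] (1 + 3 * tsize v)
     [R, if p then rev (ser v) @ X else X, if q then rev (ser v) @ Y else Y, []]"
    by (rule scan_loop, rule run_WhileF) simp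
  then have "run (scan p q) [ser v @ R, X, Y, []] (1 + (1 + 3 * tsize v))
     [R, if p then rev (ser v) @ X else X, if q then rev (ser v) @ Y else Y, []]"
    unfolding scan_def by (intro run_Seq[OF run_Act4]) auto
  then show ?thesis by simp
qed

section \<open>Discarding, copying, exchanging and comparing the topmost trees\<close>

definition flush :: "bool \<Rightarrow> symbol com" where
  "flush p = While (\<lambda>ss. ss ! (if p then 1 else 2) \<noteq> Blank)
     (Seq (Act (\<lambda>ss. [(ss ! 0, MoveLeft), (ss ! 1, Stay), (ss ! 2, Stay), (ss ! 3, Stay)]))
          (Act (\<lambda>ss. [(ss ! (if p then 1 else 2), Stay), if p then (Blank, MoveRight) else (ss ! 1, Stay),
             if p then (ss ! 2, Stay) else (Blank, MoveRight), (ss ! 3, Stay)])))"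

lemma wfc_flush: "wfc (flush p)"
  unfolding flush_def wf_com_simps by (intro conjI wfc_Act) auto

text \<open>Moving symbol by symbol reverses the stack, which undoes the reversal made by
  \<open>scan\<close>. The end is recognised by reading a blank, so \<open>X\<close> must not
  contain one.\<close>

lemma run_flush1:
  "Blank \<notin> set X \<Longrightarrow> run (flush True) [R, X, Y, Z] (1 + 3 * length X) [rev X @ R, [], Y, Z]"
proof (induction X arbitrary: R)
  case Nil
  then show ?case unfolding flush_def by (auto intro!: run_mono[OF run_WhileF])
next
  case (Cons c X)
  have "run (flush True) [R, c # X, Y, Z] (Suc ((1 + 1) + (1 + 3 * length X))) [rev X @ (c # R), [], Y, Z]"
    unfolding flush_def
    by (rule run_WhileT[OF _ run_Seq[OF run_Act4 run_Act4]])
      (use Cons in \<open>auto simp: flush_def\<close>)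
  then show ?case by (simp, elim run_mono) simp
qed

lemma run_flush2:
  "Blank \<notin> set Y \<Longrightarrow> run (flush False) [R, X, Y, Z] (1 + 3 * length Y) [rev Y @ R, X, [], Z]"
proof (induction Y arbitrary: R)
  case Nil
  then show ?case unfolding flush_def by (auto intro!: run_mono[OF run_WhileF])
next
  case (Cons c Y)
  have "run (flush False) [R, X, c # Y, Z] (Suc ((1 + 1) + (1 + 3 * length Y))) [rev Y @ (c # R), X, [], Z]"
    unfolding flush_def
    by (rule run_WhileT[OF _ run_Seq[OF run_Act4 run_Act4]])
      (use Cons in \<open>auto simp: flush_def\<close>)
  then show ?case by (simp, elim run_mono) simp
qed

abbreviation stack0 :: "symbol cell list \<Rightarrow> symbol cell list list" where
  "stack0 X \<equiv> [X, [], [], []]"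

definition drop_com :: "symbol com" where
  "drop_com = scan False False"

lemma run_drop: "run drop_com (stack0 (ser v @ R)) (2 + 3 * tsize v) (stack0 R)"
  using run_scan[of False False v R "[]" "[]"] by (simp add: drop_com_def)

definition dup_com :: "symbol com" where
  "dup_com = Seq (scan True True) (Seq (flush True) (flush False))"

lemma run_dup: "run dup_com (stack0 (ser v @ R)) (4 + 9 * tsize v) (stack0 (ser v @ ser v @ R))"
proof -
  have 1: "run (scan True True) (stack0 (ser v @ R)) (2 + 3 * tsize v) [R, rev (ser v), rev (ser v), []]"
    using run_scan[of True True v R "[]" "[]"] by simp
  have 2: "run (flush True) [R, rev (ser v), rev (ser v), []] (1 + 3 * tsize v) [ser v @ R, [], rev (ser v), []]"
    using run_flush1[of "rev (ser v)" R "rev (ser v)" "[]"] ser_no_Blank by simp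
  have 3: "run (flush False) [ser v @ R, [], rev (ser v), []] (1 + 3 * tsize v) (stack0 (ser v @ ser v @ R))"
    using run_flush2[of "rev (ser v)" "ser v @ R" "[]" "[]"] ser_no_Blank by simp
  show ?thesis
    unfolding dup_com_def by (rule run_mono[OF run_Seq[OF 1 run_Seq[OF 2 3]]]) simp
qed

text \<open>The topmost tree is parked on stack 1 and the next one on stack 2; flushing stack 1
  first puts the former top underneath.\<close>

definition swap_com :: "symbol com" where
  "swap_com = Seq (Seq (scan True False) (scan False True)) (Seq (flush True) (flush False))"

lemma run_scan2:
  "run (Seq (scan True False) (scan False True)) (stack0 (ser v @ ser u @ R)) (4 + 3 * tsize v + 3 * tsize u)
     [R, rev (ser v), rev (ser u), []]"
proof -
  have 1: "run (scan True False) (stack0 (ser v @ ser u @ R)) (2 + 3 * tsize v) [ser u @ R, rev (ser v), [], []]"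
    using run_scan[of True False v "ser u @ R" "[]" "[]"] by simp
  have 2: "run (scan False True) [ser u @ R, rev (ser v), [], []] (2 + 3 * tsize u) [R, rev (ser v), rev (ser u), []]"
    using run_scan[of False True u R "rev (ser v)" "[]"] by simp
  show ?thesis by (rule run_mono[OF run_Seq[OF 1 2]]) simp
qed

lemma run_swap:
  "run swap_com (stack0 (ser v @ ser u @ R)) (6 + 6 * tsize v + 6 * tsize u) (stack0 (ser u @ ser v @ R))"
proof -
  have 2: "run (flush True) [R, rev (ser v), rev (ser u), []] (1 + 3 * tsize v) [ser v @ R, [], rev (ser u), []]"
    using run_flush1[of "rev (ser v)" R "rev (ser u)" "[]"] ser_no_Blank by simp
  have 3: "run (flush False) [ser v @ R, [], rev (ser u), []] (1 + 3 * tsize u) (stack0 (ser u @ ser v @ R))"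
    using run_flush2[of "rev (ser u)" "ser v @ R" "[]" "[]"] ser_no_Blank by simp
  show ?thesis
    unfolding swap_com_def by (rule run_mono[OF run_Seq[OF run_scan2 run_Seq[OF 2 3]]]) simp
qed

definition push_com :: "symbol cell \<Rightarrow> symbol com" where
  "push_com c = Seq (Act (\<lambda>ss. [(ss ! 0, MoveLeft), (ss ! 1, Stay), (ss ! 2, Stay), (ss ! 3, Stay)]))
     (Act (\<lambda>ss. [(c, Stay), (ss ! 1, Stay), (ss ! 2, Stay), (ss ! 3, Stay)]))"

lemma wfc_push: "c \<in> alphabet \<Longrightarrow> wfc (push_com c)"
  unfolding push_com_def wf_com_simps by (intro conjI wfc_Act) auto

lemma run_push: "run (push_com c) [R, X, Y, Z] 2 [c # R, X, Y, Z]"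
proof -
  have "run (push_com c) [R, X, Y, Z] (1 + 1) [c # R, X, Y, Z]"
    unfolding push_com_def by (rule run_Seq[OF run_Act4 run_Act4]) auto
  then show ?thesis by (simp add: numeral_2_eq_2)
qed

definition pop_com :: "symbol com" where
  "pop_com = Act (\<lambda>ss. [(Blank, MoveRight), (ss ! 1, Stay), (ss ! 2, Stay), (ss ! 3, Stay)])"

lemma wfc_pop: "wfc pop_com"
  unfolding pop_com_def by (intro wfc_Act) auto

lemma run_pop: "run pop_com [c # R, X, Y, Z] 1 [R, X, Y, Z]"
  unfolding pop_com_def by (rule run_Act4) auto

definition skip_com :: "symbol com" where
  "skip_com = Act stay"

lemma wfc_skip: "wfc skip_com"
  unfolding skip_com_def by (intro wfc_Act) (auto simp: stay_def)

lemma run_skip: "run skip_com [R, X, Y, Z] 1 [R, X, Y, Z]"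
  unfolding skip_com_def by (rule run_Act4) (auto simp: stay_def)

primrec pushs_com :: "symbol cell list \<Rightarrow> symbol com" where
  "pushs_com [] = skip_com"
| "pushs_com (c # cs) = Seq (pushs_com cs) (push_com c)"

lemma wfc_pushs: "set cs \<subseteq> alphabet \<Longrightarrow> wfc (pushs_com cs)"
  by (induction cs) (simp_all add: wf_com_simps wfc_push wfc_skip)

lemma run_pushs: "run (pushs_com cs) [R, X, Y, Z] (1 + 2 * length cs) [cs @ R, X, Y, Z]"
proof (induction cs)
  case (Cons c cs)
  from run_Seq[OF this run_push] show ?case by simp
qed (simp add: run_skip del: One_nat_def)

text \<open>The two codes differ in their first symbol, \<open>Aux 1\<close> against
  \<open>Aux 0\<close>, so a branch only has to look at the top of the stack.\<close>

definition bool_tree :: "bool \<Rightarrow> tree" where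
  "bool_tree b = (if b then Node Nil_tree Nil_tree else Nil_tree)"

definition pop12_com :: "bool \<Rightarrow> bool \<Rightarrow> symbol com" where
  "pop12_com p q = Act (\<lambda>ss. [(ss ! 0, Stay), if p then (Blank, MoveRight) else (ss ! 1, Stay),
     if q then (Blank, MoveRight) else (ss ! 2, Stay), (ss ! 3, Stay)])"

lemma wfc_pop12: "wfc (pop12_com p q)"
  unfolding pop12_com_def by (intro wfc_Act) auto

lemma run_pop12:
  "run (pop12_com p q) [R, X, Y, Z] 1 [R, if p then tl X else X, if q then tl Y else Y, Z]"
  unfolding pop12_com_def by (rule run_Act4) (auto split: if_splits)

text \<open>
  Equality test of the two topmost trees: their reversed serialisations are compared character by
  character; they agree iff both stacks become empty simultaneously.
\<close>

definition eq_com :: "symbol com" where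
  "eq_com = Seq (Seq (scan True False) (scan False True))
     (Seq (While (\<lambda>ss. ss ! 1 = ss ! 2 \<and> ss ! 1 \<noteq> Blank) (pop12_com True True))
       (Cond (\<lambda>ss. ss ! 1 = ss ! 2) (pushs_com (ser (bool_tree True)))
         (Seq (While (\<lambda>ss. ss ! 1 \<noteq> Blank) (pop12_com True False))
           (Seq (While (\<lambda>ss. ss ! 2 \<noteq> Blank) (pop12_com False True))
             (pushs_com (ser (bool_tree False)))))))"

lemma run_clear1:
  "Blank \<notin> set X \<Longrightarrow> run (While (\<lambda>ss. ss ! 1 \<noteq> Blank) (pop12_com True False)) [R, X, Y, Z] (1 + 2 * length X) [R, [], Y, Z]"
proof (induction X)
  case Nil
  then show ?case by (auto intro!: run_mono[OF run_WhileF])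
next
  case (Cons c X)
  have "run (While (\<lambda>ss. ss ! 1 \<noteq> Blank) (pop12_com True False)) [R, c # X, Y, Z] (Suc (1 + (1 + 2 * length X))) [R, [], Y, Z]"
    by (rule run_WhileT[OF _ run_pop12]) (use Cons in auto)
  then show ?case by simp
qed

lemma run_clear2:
  "Blank \<notin> set Y \<Longrightarrow> run (While (\<lambda>ss. ss ! 2 \<noteq> Blank) (pop12_com False True)) [R, X, Y, Z] (1 + 2 * length Y) [R, X, [], Z]"
proof (induction Y)
  case Nil
  then show ?case by (auto intro!: run_mono[OF run_WhileF])
next
  case (Cons c Y)
  have "run (While (\<lambda>ss. ss ! 2 \<noteq> Blank) (pop12_com False True)) [R, X, c # Y, Z] (Suc (1 + (1 + 2 * length Y))) [R, X, [], Z]"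
    by (rule run_WhileT[OF _ run_pop12]) (use Cons in auto)
  then show ?case by simp
qed

text \<open>The loop stops either with both stacks empty or at the first difference, where the two
  tops are distinct. The remainders stay abstract: clearing them needs only their length and the
  absence of blanks.\<close>

lemma run_compare:
  assumes "Blank \<notin> set X" "Blank \<notin> set Y"
  shows "\<exists>X' Y'. run (While (\<lambda>ss. ss ! 1 = ss ! 2 \<and> ss ! 1 \<noteq> Blank) (pop12_com True True)) [R, X, Y, Z] (1 + 2 * length X) [R, X', Y', Z]
     \<and> length X' \<le> length X \<and> length Y' \<le> length Y \<and> Blank \<notin> set X' \<and> Blank \<notin> set Y' \<and>
     (topc X' = topc Y' \<longleftrightarrow> X = Y) \<and> (X = Y \<longrightarrow> X' = [] \<and> Y' = [])"
    (is "\<exists>X' Y'. run ?W _ _ _ \<and> _")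
  using assms
proof (induction X arbitrary: Y)
  case Nil
  then have "run ?W [R, [], Y, Z] 1 [R, [], Y, Z]"
    by (intro run_WhileF) simp
  with Nil show ?case
    by (intro exI[of _ "[]"] exI[of _ Y]) (cases Y; auto)
next
  case (Cons c X)
  show ?case
  proof (cases "\<exists>Y1. Y = c # Y1")
    case True
    then obtain Y1 where [simp]: "Y = c # Y1" by blast
    obtain X' Y' where IH: "run ?W [R, X, Y1, Z] (1 + 2 * length X) [R, X', Y', Z]"
      "length X' \<le> length X" "length Y' \<le> length Y1" "Blank \<notin> set X'" "Blank \<notin> set Y'"
      "topc X' = topc Y' \<longleftrightarrow> X = Y1" "X = Y1 \<longrightarrow> X' = [] \<and> Y' = []"
      using Cons.IH[of Y1] Cons.prems by auto
    have "run ?W [R, c # X, Y, Z] (Suc (1 + (1 + 2 * length X))) [R, X', Y', Z]"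
      by (rule run_WhileT[OF _ run_pop12]) (use Cons.prems IH in auto)
    with IH show ?thesis by (intro exI[of _ X'] exI[of _ Y']) auto
  next
    case False
    with Cons.prems have ne: "topc (c # X) \<noteq> topc Y"
      by (cases Y) auto
    then have "run ?W [R, c # X, Y, Z] 1 [R, c # X, Y, Z]"
      by (intro run_WhileF) simp
    then have "run ?W [R, c # X, Y, Z] (1 + 2 * length (c # X)) [R, c # X, Y, Z]"
      by (rule run_mono) simp
    with Cons.prems ne show ?thesis by (intro exI[of _ "c # X"] exI[of _ Y]) auto
  qed
qed

lemma run_eq:
  "run eq_com (stack0 (ser u @ ser v @ R)) (20 + 10 * tsize u + 10 * tsize v) (stack0 (ser (bool_tree (u = v)) @ R))"
proof -
  have "Blank \<notin> set (rev (ser u))" "Blank \<notin> set (rev (ser v))" by (simp_all add: ser_no_Blank)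
  from run_compare[OF this, of R "[]"] obtain X Y where
    1: "run (While (\<lambda>ss. ss ! 1 = ss ! 2 \<and> ss ! 1 \<noteq> Blank) (pop12_com True True))
      [R, rev (ser u), rev (ser v), []] (1 + 2 * tsize u) [R, X, Y, []]"
    and l: "length X \<le> tsize u" "length Y \<le> tsize v" "Blank \<notin> set X" "Blank \<notin> set Y"
    and e: "topc X = topc Y \<longleftrightarrow> u = v" "u = v \<longrightarrow> X = [] \<and> Y = []"
    by (auto simp: ser_inject)
  have "run (Cond (\<lambda>ss. ss ! 1 = ss ! 2) (pushs_com (ser (bool_tree True)))
         (Seq (While (\<lambda>ss. ss ! 1 \<noteq> Blank) (pop12_com True False))
           (Seq (While (\<lambda>ss. ss ! 2 \<noteq> Blank) (pop12_com False True))
             (pushs_com (ser (bool_tree False)))))) [R, X, Y, []]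
        (10 + 2 * tsize u + 2 * tsize v) (stack0 (ser (bool_tree (u = v)) @ R))"
  proof (cases "u = v")
    case True
    with e have [simp]: "X = []" "Y = []" by auto
    have "run (pushs_com (ser (bool_tree True))) (stack0 R) 7 (stack0 (ser (bool_tree (u = v)) @ R))"
      using run_pushs[of "ser (bool_tree True)" R "[]" "[]" "[]"] True by (simp add: bool_tree_def)
    then show ?thesis
      by (intro run_mono[OF run_CondT]) auto
  next
    case False
    have p: "run (pushs_com (ser (bool_tree False))) (stack0 R) 3 (stack0 (ser (bool_tree (u = v)) @ R))"
      using run_pushs[of "ser (bool_tree False)" R "[]" "[]" "[]"] False by (simp add: bool_tree_def numeral_3_eq_3)
    show ?thesis
      by (rule run_mono[OF run_CondF[OF _ run_Seq[OF run_clear1 run_Seq[OF run_clear2 p]]]])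
        (use False e l in auto)
  qed
  from run_Seq[OF run_scan2 run_Seq[OF 1 this]]
  show ?thesis unfolding eq_com_def by (rule run_mono) simp
qed

lemma wfc_simps: "wfc drop_com" "wfc dup_com" "wfc swap_com" "wfc eq_com"
  by (simp_all add: drop_com_def dup_com_def swap_com_def eq_com_def wf_com_simps wfc_scan wfc_flush
      wfc_pop12 wfc_pushs[OF ser_alphabet])

section \<open>Polynomial-time functions on typed data\<close>

text \<open>Injectivity makes the comparison of serialised trees a test for equality of
  values.\<close>

class data =
  fixes to_tree :: "'a \<Rightarrow> tree"
  assumes to_tree_inject: "to_tree x = to_tree y \<Longrightarrow> x = y"

lemma to_tree_eq_iff: "to_tree x = to_tree y \<longleftrightarrow> x = y"
  using to_tree_inject by blast

definition sz :: "'a::data \<Rightarrow> nat" where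
  "sz x = tsize (to_tree x)"

instantiation bool :: data
begin
definition to_tree_bool :: "bool \<Rightarrow> tree" where "to_tree_bool = bool_tree"
instance by standard (auto simp: to_tree_bool_def bool_tree_def split: if_splits)
end

instantiation unit :: data
begin
definition to_tree_unit :: "unit \<Rightarrow> tree" where "to_tree_unit x = Nil_tree"
instance by standard simp
end

instantiation symbol :: data
begin
definition to_tree_symbol :: "symbol \<Rightarrow> tree" where "to_tree_symbol = Leaf"
instance by standard (simp add: to_tree_symbol_def)
end

instantiation prod :: (data, data) data
begin
definition to_tree_prod :: "'a \<times> 'b \<Rightarrow> tree" where "to_tree_prod p = Node (to_tree (fst p)) (to_tree (snd p))"
instance by standard (auto simp: to_tree_prod_def to_tree_eq_iff prod_eq_iff)
end

instantiation list :: (data) data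
begin
primrec to_tree_list :: "'a list \<Rightarrow> tree" where
  "to_tree_list [] = Nil_tree"
| "to_tree_list (x # xs) = Node (to_tree x) (to_tree_list xs)"
instance
proof
  fix xs ys :: "'a list"
  show "to_tree xs = to_tree ys \<Longrightarrow> xs = ys"
  proof (induction xs arbitrary: ys)
    case Nil
    then show ?case by (cases ys) auto
  next
    case (Cons x xs)
    then show ?case by (cases ys) (auto simp: to_tree_eq_iff)
  qed
qed
end

text \<open>Unary coding: a number has the same tree as a list of that many units, so arithmetic
  becomes list processing. The price is that only polynomially bounded numbers may be
  represented.\<close>

instantiation nat :: data
begin
primrec to_tree_nat :: "nat \<Rightarrow> tree" where
  "to_tree_nat 0 = Nil_tree"
| "to_tree_nat (Suc n) = Node Nil_tree (to_tree_nat n)"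
instance
proof
  fix m n :: nat
  show "to_tree m = to_tree n \<Longrightarrow> m = n"
  proof (induction m arbitrary: n)
    case 0
    then show ?case by (cases n) auto
  next
    case (Suc m)
    then show ?case by (cases n) auto
  qed
qed
end

instantiation int :: data
begin
definition to_tree_int :: "int \<Rightarrow> tree" where
  "to_tree_int a = Node (bool_tree (a < 0)) (to_tree (nat \<bar>a\<bar>))"
instance by standard (auto simp: to_tree_int_def bool_tree_def to_tree_eq_iff split: if_splits)
end

lemma sz_pos: "0 < sz x"
  by (simp add: sz_def)

lemma sz_simps [simp]:
  "sz (a, b) = Suc (sz a + sz b)" "sz ([] :: 'a::data list) = 1"
  "sz (x # xs) = Suc (sz x + sz xs)" "sz () = 1" "sz s = (1 :: nat)" for s :: symbol
  by (simp_all add: sz_def to_tree_prod_def to_tree_unit_def to_tree_symbol_def)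

lemma sz_bool: "sz (b :: bool) \<le> 3"
  by (simp add: sz_def to_tree_bool_def bool_tree_def)

lemma sz_nat: "sz (n :: nat) = 2 * n + 1"
  by (induction n) (simp_all add: sz_def)

lemma sz_fst: "sz (fst p) \<le> sz p" and sz_snd: "sz (snd p) \<le> sz p"
  by (cases p; simp)+

lemma sz_append: "sz (xs @ ys) + 1 = sz xs + sz ys"
  by (induction xs) simp_all

lemma sz_mem: "x \<in> set xs \<Longrightarrow> sz x \<le> sz xs"
  by (induction xs) auto

lemma length_le_sz: "length xs \<le> sz xs"
  by (induction xs) auto

lemma sz_drop: "sz (drop n xs) \<le> sz xs"
proof (induction n arbitrary: xs)
  case (Suc n)
  show ?case using Suc[of "tl xs"] by (cases xs) auto
qed simp

lemma sz_tl: "sz (tl xs) \<le> sz xs"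
  by (cases xs) auto

lemma sz_filter: "sz (filter P xs) \<le> sz xs"
  by (induction xs) auto

lemma poly_nat_mono: "x \<le> y \<Longrightarrow> poly p x \<le> poly p y" for x y :: nat
  by (induction p) (auto intro!: add_mono mult_mono)

text \<open>The rest \<open>R\<close> of the stack is left untouched, which lets programs work above
  saved values. The output size has its own bound because the time of a subsequent program is a
  polynomial in that size.\<close>

definition polyf :: "('a::data \<Rightarrow> 'b::data) \<Rightarrow> bool" where
  "polyf F \<longleftrightarrow> (\<exists>c p. wfc c \<and>
     (\<forall>x R. run c (stack0 (ser (to_tree x) @ R)) (poly p (sz x)) (stack0 (ser (to_tree (F x)) @ R))) \<and>
     (\<forall>x. sz (F x) \<le> poly p (sz x)))"

lemma polyfI:
  assumes "wfc c"
    and "\<And>x R. run c (stack0 (ser (to_tree x) @ R)) (t x) (stack0 (ser (to_tree (F x)) @ R))"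
    and "\<And>x. t x \<le> poly p (sz x)" and "\<And>x. sz (F x) \<le> poly q (sz x)"
  shows "polyf F"
  unfolding polyf_def
proof (intro exI conjI allI)
  show "run c (stack0 (ser (to_tree x) @ R)) (poly (p + q) (sz x)) (stack0 (ser (to_tree (F x)) @ R))" for x R
    using assms(3)[of x] by (intro run_mono[OF assms(2)]) simp
  show "sz (F x) \<le> poly (p + q) (sz x)" for x
    using assms(4)[of x] by simp
qed (rule assms(1))

lemma polyfE:
  assumes "polyf F"
  obtains c p where "wfc c"
    "\<And>x R. run c (stack0 (ser (to_tree x) @ R)) (poly p (sz x)) (stack0 (ser (to_tree (F x)) @ R))"
    "\<And>x. sz (F x) \<le> poly p (sz x)"
  using assms unfolding polyf_def by blast

lemma polyf_sz: "polyf F \<Longrightarrow> \<exists>p. \<forall>x. sz (F x) \<le> poly p (sz x)"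
  unfolding polyf_def by blast

text \<open>Functions that agree on the level of encodings are computed by the same program.\<close>

lemma polyf_coerce:
  fixes F :: "'a::data \<Rightarrow> 'b::data" and G :: "'c::data \<Rightarrow> 'd::data"
  assumes "polyf F" and "\<And>x. \<exists>y. to_tree x = to_tree y \<and> to_tree (G x) = to_tree (F y)"
  shows "polyf G"
proof -
  from assms(1) obtain c p where c: "wfc c"
    "\<And>x R. run c (stack0 (ser (to_tree x) @ R)) (poly p (sz x)) (stack0 (ser (to_tree (F x)) @ R))"
    "\<And>x. sz (F x) \<le> poly p (sz x)" by (rule polyfE) blast
  show ?thesis
  proof (rule polyfI[OF c(1), where t = "\<lambda>x. poly p (sz x)" and p = p and q = p])
    fix x R
    obtain y where y: "to_tree x = to_tree y" "to_tree (G x) = to_tree (F y)" using assms(2) by blast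
    then have s: "sz x = sz y" "sz (G x) = sz (F y)" by (simp_all add: sz_def)
    show "run c (stack0 (ser (to_tree x) @ R)) (poly p (sz x)) (stack0 (ser (to_tree (G x)) @ R))"
      using c(2)[of y R] by (simp only: s y)
    show "sz (G x) \<le> poly p (sz x)"
      using c(3)[of y] by (simp only: s y)
  qed simp
qed

lemma polyf_id: "polyf (\<lambda>x. x)"
  by (rule polyfI[where c = skip_com and t = "\<lambda>_. 1" and p = "[:1:]" and q = "[:0, 1:]"])
    (simp_all add: wfc_skip run_skip del: One_nat_def)

lemma polyf_const:
  fixes a :: "'b::data"
  shows "polyf (\<lambda>x::'a::data. a)"
proof (rule polyfI)
  show "wfc (Seq drop_com (pushs_com (ser (to_tree a))))"
    by (simp add: wf_com_simps wfc_simps wfc_pushs ser_alphabet)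
  show "run (Seq drop_com (pushs_com (ser (to_tree a)))) (stack0 (ser (to_tree x) @ R))
     ((2 + 3 * sz x) + (1 + 2 * sz a)) (stack0 (ser (to_tree a) @ R))" for x :: 'a and R
    unfolding sz_def by (rule run_Seq[OF run_drop run_pushs])
  show "(2 + 3 * sz x) + (1 + 2 * sz a) \<le> poly [:3 + 2 * sz a, 3:] (sz x)" for x :: 'a by simp
  show "sz a \<le> poly [:sz a:] (sz x)" for x :: 'a by simp
qed

lemma polyf_comp:
  assumes "polyf F" "polyf G"
  shows "polyf (\<lambda>x. F (G x))"
proof -
  from assms(1) obtain c p where c: "wfc c"
    "\<And>x R. run c (stack0 (ser (to_tree x) @ R)) (poly p (sz x)) (stack0 (ser (to_tree (F x)) @ R))"
    "\<And>x. sz (F x) \<le> poly p (sz x)" by (rule polyfE) blast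
  from assms(2) obtain d q where d: "wfc d"
    "\<And>x R. run d (stack0 (ser (to_tree x) @ R)) (poly q (sz x)) (stack0 (ser (to_tree (G x)) @ R))"
    "\<And>x. sz (G x) \<le> poly q (sz x)" by (rule polyfE) blast
  show ?thesis
  proof (rule polyfI)
    show "wfc (Seq d c)" using c d by (simp add: wf_com_simps)
    show "run (Seq d c) (stack0 (ser (to_tree x) @ R)) (poly q (sz x) + poly p (sz (G x))) (stack0 (ser (to_tree (F (G x))) @ R))" for x R
      by (rule run_Seq[OF d(2) c(2)])
    show "poly q (sz x) + poly p (sz (G x)) \<le> poly (q + pcompose p q) (sz x)" for x
      using poly_nat_mono[OF d(3), of p x] by (simp add: poly_pcompose)
    show "sz (F (G x)) \<le> poly (pcompose p q) (sz x)" for x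
      using c(3)[of "G x"] poly_nat_mono[OF d(3), of p x] by (simp add: poly_pcompose)
  qed
qed

lemma polyf_Pair:
  assumes "polyf F" "polyf G"
  shows "polyf (\<lambda>x. (F x, G x))"
proof -
  from assms(1) obtain c p where c: "wfc c"
    "\<And>x R. run c (stack0 (ser (to_tree x) @ R)) (poly p (sz x)) (stack0 (ser (to_tree (F x)) @ R))"
    "\<And>x. sz (F x) \<le> poly p (sz x)" by (rule polyfE) blast
  from assms(2) obtain d q where d: "wfc d"
    "\<And>x R. run d (stack0 (ser (to_tree x) @ R)) (poly q (sz x)) (stack0 (ser (to_tree (G x)) @ R))"
    "\<And>x. sz (G x) \<le> poly q (sz x)" by (rule polyfE) blast
  show ?thesis
  proof (rule polyfI)
    \<comment> \<open>The second component is computed first, on a copy of the argument. After the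
      swap the first component ends up above it, as prefix notation demands, and
      \<open>Aux 1\<close> completes the pair.\<close>
    show "wfc (Seq dup_com (Seq d (Seq swap_com (Seq c (push_com (Aux 1))))))"
      using c d by (simp add: wf_com_simps wfc_simps wfc_push)
    fix x and R :: "symbol cell list"
    have "run (push_com (Aux 1)) (stack0 (ser (to_tree (F x)) @ ser (to_tree (G x)) @ R)) 2
        (stack0 (ser (to_tree (F x, G x)) @ R))"
      using run_push[of "Aux 1" "ser (to_tree (F x)) @ ser (to_tree (G x)) @ R" "[]" "[]" "[]"] by (simp add: to_tree_prod_def)
    from run_Seq[OF run_dup run_Seq[OF d(2) run_Seq[OF run_swap run_Seq[OF c(2) this]]]]
    show "run (Seq dup_com (Seq d (Seq swap_com (Seq c (push_com (Aux 1))))))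
      (stack0 (ser (to_tree x) @ R)) (4 + 9 * sz x + (poly q (sz x) + (6 + 6 * sz (G x) + 6 * sz x + (poly p (sz x) + 2))))
      (stack0 (ser (to_tree (F x, G x)) @ R))"
      by (simp only: sz_def)
    show "4 + 9 * sz x + (poly q (sz x) + (6 + 6 * sz (G x) + 6 * sz x + (poly p (sz x) + 2)))
      \<le> poly ([:12, 15:] + smult 7 q + p) (sz x)"
      using d(3)[of x] by simp
    show "sz (F x, G x) \<le> poly ([:1:] + p + q) (sz x)"
      using c(3)[of x] d(3)[of x] by simp
  qed
qed

lemma polyf_fst': "polyf fst"
proof (rule polyfI)
  show "wfc (Seq pop_com (Seq swap_com drop_com))"
    by (simp add: wf_com_simps wfc_simps wfc_pop)
  fix x :: "'a \<times> 'b" and R :: "symbol cell list"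
  obtain a b where [simp]: "x = (a, b)" by (cases x)
  have "run pop_com (stack0 (ser (to_tree x) @ R)) 1 (stack0 (ser (to_tree a) @ ser (to_tree b) @ R))"
    using run_pop by (simp add: to_tree_prod_def)
  from run_Seq[OF this run_Seq[OF run_swap run_drop]]
  show "run (Seq pop_com (Seq swap_com drop_com)) (stack0 (ser (to_tree x) @ R)) (20 + 20 * sz x) (stack0 (ser (to_tree (fst x)) @ R))"
    by (simp, elim run_mono) (simp add: sz_def)
  show "20 + 20 * sz x \<le> poly [:20, 20:] (sz x)" by simp
  show "sz (fst x) \<le> poly [:0, 1:] (sz x)" by simp
qed

lemma polyf_snd': "polyf snd"
proof (rule polyfI)
  show "wfc (Seq pop_com drop_com)"
    by (simp add: wf_com_simps wfc_simps wfc_pop)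
  fix x :: "'a \<times> 'b" and R :: "symbol cell list"
  obtain a b where [simp]: "x = (a, b)" by (cases x)
  have "run pop_com (stack0 (ser (to_tree x) @ R)) 1 (stack0 (ser (to_tree a) @ ser (to_tree b) @ R))"
    using run_pop by (simp add: to_tree_prod_def)
  from run_Seq[OF this run_drop]
  show "run (Seq pop_com drop_com) (stack0 (ser (to_tree x) @ R)) (20 + 20 * sz x) (stack0 (ser (to_tree (snd x)) @ R))"
    by (simp, elim run_mono) (simp add: sz_def)
  show "20 + 20 * sz x \<le> poly [:20, 20:] (sz x)" by simp
  show "sz (snd x) \<le> poly [:0, 1:] (sz x)" by simp
qed

lemma polyf_eq':
  "polyf (\<lambda>p :: 'a::data \<times> 'a. fst p = snd p)"
proof (rule polyfI)
  show "wfc (Seq pop_com eq_com)"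
    by (simp add: wf_com_simps wfc_simps wfc_pop)
  fix x :: "'a \<times> 'a" and R :: "symbol cell list"
  obtain a b where [simp]: "x = (a, b)" by (cases x)
  have "run pop_com (stack0 (ser (to_tree x) @ R)) 1 (stack0 (ser (to_tree a) @ ser (to_tree b) @ R))"
    using run_pop by (simp add: to_tree_prod_def)
  from run_Seq[OF this run_eq]
  show "run (Seq pop_com eq_com) (stack0 (ser (to_tree x) @ R)) (30 + 20 * sz x) (stack0 (ser (to_tree (fst x = snd x)) @ R))"
    by (simp add: to_tree_bool_def to_tree_eq_iff, elim run_mono) (simp add: sz_def)
  show "30 + 20 * sz x \<le> poly [:30, 20:] (sz x)" by simp
  show "sz (fst x = snd x) \<le> poly [:3:] (sz x)" using sz_bool by simp
qed

lemma tsize_bool: "tsize (bool_tree b) \<le> 3"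
  by (simp add: bool_tree_def)

lemma polyf_If:
  assumes "polyf B" "polyf F" "polyf G"
  shows "polyf (\<lambda>x. if B x then F x else G x)"
proof -
  from assms(1) obtain b r where b: "wfc b"
    "\<And>x R. run b (stack0 (ser (to_tree x) @ R)) (poly r (sz x)) (stack0 (ser (to_tree (B x)) @ R))"
    "\<And>x. sz (B x) \<le> poly r (sz x)" by (rule polyfE) blast
  from assms(2) obtain c p where c: "wfc c"
    "\<And>x R. run c (stack0 (ser (to_tree x) @ R)) (poly p (sz x)) (stack0 (ser (to_tree (F x)) @ R))"
    "\<And>x. sz (F x) \<le> poly p (sz x)" by (rule polyfE) blast
  from assms(3) obtain d q where d: "wfc d"
    "\<And>x R. run d (stack0 (ser (to_tree x) @ R)) (poly q (sz x)) (stack0 (ser (to_tree (G x)) @ R))"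
    "\<And>x. sz (G x) \<le> poly q (sz x)" by (rule polyfE) blast
  let ?cond = "Cond (\<lambda>ss. ss ! 0 = Aux 1) (Seq drop_com c) (Seq drop_com d)"
  let ?c = "Seq dup_com (Seq b ?cond)"
  show ?thesis
  proof (rule polyfI)
    show "wfc ?c"
      using b c d by (simp add: wf_com_simps wfc_simps)
    fix x and R :: "symbol cell list"
    \<comment> \<open>A truth value occupies at most three cells, and 11 = 2 + 3 * 3.\<close>
    have drop: "run drop_com (stack0 (ser (to_tree (B x)) @ ser (to_tree x) @ R)) 11 (stack0 (ser (to_tree x) @ R))"
      by (rule run_mono[OF run_drop]) (use tsize_bool[of "B x"] in \<open>simp add: to_tree_bool_def\<close>)
    have "run ?cond (stack0 (ser (to_tree (B x)) @ ser (to_tree x) @ R)) (12 + poly p (sz x) + poly q (sz x))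
       (stack0 (ser (to_tree (if B x then F x else G x)) @ R))"
    proof (cases "B x")
      case True
      have "run ?cond (stack0 (ser (to_tree (B x)) @ ser (to_tree x) @ R)) (Suc (11 + poly p (sz x)))
        (stack0 (ser (to_tree (F x)) @ R))"
        by (rule run_CondT[OF _ run_Seq[OF drop c(2)]]) (use True in \<open>simp add: to_tree_bool_def bool_tree_def\<close>)
      with True show ?thesis by (simp, elim run_mono) simp
    next
      case False
      have "run ?cond (stack0 (ser (to_tree (B x)) @ ser (to_tree x) @ R)) (Suc (11 + poly q (sz x)))
        (stack0 (ser (to_tree (G x)) @ R))"
        by (rule run_CondF[OF _ run_Seq[OF drop d(2)]]) (use False in \<open>simp add: to_tree_bool_def bool_tree_def\<close>)
      with False show ?thesis by (simp, elim run_mono) simp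
    qed
    from run_Seq[OF run_dup run_Seq[OF b(2) this]]
    show "run ?c (stack0 (ser (to_tree x) @ R)) (4 + 9 * sz x + (poly r (sz x) + (12 + poly p (sz x) + poly q (sz x))))
      (stack0 (ser (to_tree (if B x then F x else G x)) @ R))" by (simp only: sz_def)
    show "4 + 9 * sz x + (poly r (sz x) + (12 + poly p (sz x) + poly q (sz x)))
      \<le> poly ([:16, 9:] + r + p + q) (sz x)" by simp
    show "sz (if B x then F x else G x) \<le> poly (p + q) (sz x)"
      using c(3)[of x] d(3)[of x] by simp
  qed
qed

text \<open>Iterating a polynomial-time function may take exponentially many rounds or produce
  exponentially large values. Hence both the number of rounds and the size of every intermediate
  value must be bounded in the size of the initial value.\<close>

lemma polyf_while:
  fixes f :: "'a::data \<Rightarrow> 'a"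
  assumes "polyf B" "polyf f"
    and "\<And>x. \<exists>N \<le> poly q (sz x). (\<forall>i<N. B ((f ^^ i) x)) \<and> \<not> B ((f ^^ N) x) \<and>
      (\<forall>i\<le>N. sz ((f ^^ i) x) \<le> poly q (sz x)) \<and> g x = (f ^^ N) x"
  shows "polyf g"
proof -
  from assms(1) obtain b r where b: "wfc b"
    "\<And>x R. run b (stack0 (ser (to_tree x) @ R)) (poly r (sz x)) (stack0 (ser (to_tree (B x)) @ R))"
    "\<And>x. sz (B x) \<le> poly r (sz x)" by (rule polyfE) blast
  from assms(2) obtain c p where c: "wfc c"
    "\<And>x R. run c (stack0 (ser (to_tree x) @ R)) (poly p (sz x)) (stack0 (ser (to_tree (f x)) @ R))"
    "\<And>x. sz (f x) \<le> poly p (sz x)" by (rule polyfE) blast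
  let ?W = "While (\<lambda>ss. ss ! 0 = Aux 1) (Seq drop_com (Seq c (Seq dup_com b)))"
  let ?c = "Seq dup_com (Seq b (Seq ?W drop_com))"
  \<comment> \<open>Cost of one round of the loop body as long as all sizes are at most
    \<open>Q\<close>.\<close>
  define T where "T Q = 11 + (poly p Q + (4 + 9 * Q + poly r Q))" for Q
  have drop: "run drop_com (stack0 (ser (to_tree (B x)) @ R)) 11 (stack0 R)" for x R
    by (rule run_mono[OF run_drop]) (use tsize_bool[of "B x"] in \<open>simp add: to_tree_bool_def\<close>)
  have loop: "run ?W (stack0 (ser (to_tree (B x)) @ ser (to_tree x) @ R)) (N * Suc (T Q) + 1)
     (stack0 (ser (to_tree (B ((f ^^ N) x))) @ ser (to_tree ((f ^^ N) x)) @ R))"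
    if "\<forall>i<N. B ((f ^^ i) x)" "\<not> B ((f ^^ N) x)" "\<forall>i\<le>N. sz ((f ^^ i) x) \<le> Q" for N x R Q
    using that
  proof (induction N arbitrary: x)
    case 0
    have "run ?W (stack0 (ser (to_tree (B x)) @ ser (to_tree x) @ R)) 1 (stack0 (ser (to_tree (B x)) @ ser (to_tree x) @ R))"
      by (rule run_WhileF) (use 0 in \<open>simp add: to_tree_bool_def bool_tree_def\<close>)
    then show ?case by simp
  next
    case (Suc N)
    have x: "B x" "sz x \<le> Q" "sz (f x) \<le> Q"
      using Suc.prems(1)[rule_format, of 0] Suc.prems(3)[rule_format, of 0] Suc.prems(3)[rule_format, of 1] by simp_all
    have body: "run (Seq drop_com (Seq c (Seq dup_com b))) (stack0 (ser (to_tree (B x)) @ ser (to_tree x) @ R)) (T Q)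
       (stack0 (ser (to_tree (B (f x))) @ ser (to_tree (f x)) @ R))"
    proof (rule run_mono[OF run_Seq[OF drop run_Seq[OF c(2) run_Seq[OF run_dup b(2)]]]])
      have "poly p (sz x) \<le> poly p Q" "poly r (sz (f x)) \<le> poly r Q"
        using x by (simp_all add: poly_nat_mono)
      with x show "11 + (poly p (sz x) + (4 + 9 * tsize (to_tree (f x)) + poly r (sz (f x)))) \<le> T Q"
        by (simp add: T_def sz_def)
    qed
    have "run ?W (stack0 (ser (to_tree (B (f x))) @ ser (to_tree (f x)) @ R)) (N * Suc (T Q) + 1)
       (stack0 (ser (to_tree (B ((f ^^ N) (f x)))) @ ser (to_tree ((f ^^ N) (f x))) @ R))"
    proof (rule Suc.IH)
      show "\<forall>i<N. B ((f ^^ i) (f x))"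
        using Suc.prems(1) by (metis Suc_mono funpow_Suc_right o_apply)
      show "\<not> B ((f ^^ N) (f x))"
        using Suc.prems(2) by (simp only: funpow_Suc_right o_apply) simp
      show "\<forall>i\<le>N. sz ((f ^^ i) (f x)) \<le> Q"
        using Suc.prems(3) by (metis Suc_le_mono funpow_Suc_right o_apply)
    qed
    then have "run ?W (stack0 (ser (to_tree (B x)) @ ser (to_tree x) @ R)) (Suc (T Q + (N * Suc (T Q) + 1)))
       (stack0 (ser (to_tree (B ((f ^^ N) (f x)))) @ ser (to_tree ((f ^^ N) (f x))) @ R))"
      by (intro run_WhileT[OF _ body]) (use x in \<open>simp_all add: to_tree_bool_def bool_tree_def\<close>)
    then show ?case
      by (simp only: funpow_Suc_right o_apply, elim run_mono) simp
  qed
  show ?thesis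
  proof (rule polyfI)
    show "wfc ?c"
      using b c by (simp add: wf_com_simps wfc_simps)
    fix x :: 'a and R :: "symbol cell list"
    let ?Q = "poly q (sz x)"
    obtain N where N: "N \<le> ?Q" "\<forall>i<N. B ((f ^^ i) x)" "\<not> B ((f ^^ N) x)"
      "\<forall>i\<le>N. sz ((f ^^ i) x) \<le> ?Q" and g: "g x = (f ^^ N) x"
      using assms(3)[of x] by blast
    have W: "run ?W (stack0 (ser (to_tree (B x)) @ ser (to_tree x) @ R)) (?Q * Suc (T ?Q) + 1)
     (stack0 (ser (to_tree (B (g x))) @ ser (to_tree (g x)) @ R))"
      unfolding g
      by (rule run_mono[OF loop[of N x ?Q]]) (use N mult_le_mono1[OF N(1), of "Suc (T ?Q)"] in simp_all)
    from run_Seq[OF run_dup run_Seq[OF b(2) run_Seq[OF this drop]]]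
    show "run ?c (stack0 (ser (to_tree x) @ R)) (4 + 9 * sz x + (poly r (sz x) + ((?Q * Suc (T ?Q) + 1) + 11)))
       (stack0 (ser (to_tree (g x)) @ R))" by (simp only: sz_def)
    show "4 + 9 * sz x + (poly r (sz x) + ((?Q * Suc (T ?Q) + 1) + 11)) \<le>
      poly ([:16, 9:] + r + q * ([:16:] + pcompose p q + smult 9 q + pcompose r q)) (sz x)"
      by (simp add: T_def poly_pcompose algebra_simps)
    show "sz (g x) \<le> poly q (sz x)"
      using N g by simp
  qed
qed

lemma polyf_fst: "polyf f \<Longrightarrow> polyf (\<lambda>x. fst (f x))"
  using polyf_comp[OF polyf_fst'] .

lemma polyf_snd: "polyf f \<Longrightarrow> polyf (\<lambda>x. snd (f x))"
  using polyf_comp[OF polyf_snd'] .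

lemma polyf_lift2:
  assumes "polyf (\<lambda>p. F (fst p) (snd p))" "polyf f" "polyf g"
  shows "polyf (\<lambda>x. F (f x) (g x))"
  using polyf_comp[OF assms(1) polyf_Pair[OF assms(2,3)]] by simp

lemma polyf_eq: "polyf f \<Longrightarrow> polyf g \<Longrightarrow> polyf (\<lambda>x. f x = g x)"
  using polyf_lift2[OF polyf_eq'] .

text \<open>Functions are total, so the program must also produce the unspecified value
  \<open>hd []\<close>. This is a fixed element whose code can be built into the program.\<close>

lemma polyf_hd: assumes "polyf f" shows "polyf (\<lambda>x. hd (f x))"
proof (rule polyf_comp[OF _ assms], rule polyfI)
  let ?a = "hd [] :: 'b"
  let ?c = "Cond (\<lambda>ss. ss ! 0 = Aux 0) (Seq drop_com (pushs_com (ser (to_tree ?a))))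
    (Seq pop_com (Seq swap_com drop_com))"
  show "wfc ?c"
    by (simp add: wf_com_simps wfc_simps wfc_pop wfc_pushs ser_alphabet)
  fix xs :: "'b list" and R :: "symbol cell list"
  show "run ?c (stack0 (ser (to_tree xs) @ R)) (20 + 20 * sz xs + 2 * sz ?a) (stack0 (ser (to_tree (hd xs)) @ R))"
  proof (cases xs)
    case Nil
    have "run ?c (stack0 (ser (to_tree xs) @ R)) (Suc ((2 + 3 * tsize (to_tree xs)) + (1 + 2 * tsize (to_tree ?a))))
      (stack0 (ser (to_tree ?a) @ R))"
      by (rule run_CondT[OF _ run_Seq[OF run_drop run_pushs]]) (simp add: Nil)
    with Nil show ?thesis by (simp, elim run_mono) (simp add: sz_def)
  next
    case (Cons a as)
    have "run pop_com (stack0 (ser (to_tree xs) @ R)) 1 (stack0 (ser (to_tree a) @ ser (to_tree as) @ R))"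
      using run_pop Cons by simp
    from run_Seq[OF this run_Seq[OF run_swap run_drop]]
    have "run ?c (stack0 (ser (to_tree xs) @ R))
      (Suc (1 + ((6 + 6 * tsize (to_tree a) + 6 * tsize (to_tree as)) + (2 + 3 * tsize (to_tree as))))) (stack0 (ser (to_tree a) @ R))"
      by (intro run_CondF) (simp_all add: Cons)
    with Cons show ?thesis by (simp, elim run_mono) (simp add: sz_def)
  qed
  show "20 + 20 * sz xs + 2 * sz ?a \<le> poly [:20 + 2 * sz ?a, 20:] (sz xs)" by simp
  show "sz (hd xs) \<le> poly [:sz ?a, 1:] (sz xs)" by (cases xs) simp_all
qed

lemma polyf_tl: assumes "polyf f" shows "polyf (\<lambda>x. tl (f x))"
proof (rule polyf_comp[OF _ assms], rule polyfI)
  let ?c = "Cond (\<lambda>ss. ss ! 0 = Aux 0) skip_com (Seq pop_com drop_com)"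
  show "wfc ?c"
    by (simp add: wf_com_simps wfc_simps wfc_pop wfc_skip)
  fix xs :: "'b list" and R :: "symbol cell list"
  show "run ?c (stack0 (ser (to_tree xs) @ R)) (20 + 20 * sz xs) (stack0 (ser (to_tree (tl xs)) @ R))"
  proof (cases xs)
    case Nil
    have "run ?c (stack0 (ser (to_tree xs) @ R)) (Suc 1) (stack0 (ser (to_tree xs) @ R))"
      by (rule run_CondT[OF _ run_skip]) (simp add: Nil)
    with Nil show ?thesis by (simp, elim run_mono) simp
  next
    case (Cons a as)
    have "run pop_com (stack0 (ser (to_tree xs) @ R)) 1 (stack0 (ser (to_tree a) @ ser (to_tree as) @ R))"
      using run_pop Cons by simp
    from run_Seq[OF this run_drop]
    have "run ?c (stack0 (ser (to_tree xs) @ R)) (Suc (1 + (2 + 3 * tsize (to_tree a)))) (stack0 (ser (to_tree as) @ R))"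
      by (intro run_CondF) (simp_all add: Cons)
    with Cons show ?thesis by (simp, elim run_mono) (simp add: sz_def)
  qed
  show "20 + 20 * sz xs \<le> poly [:20, 20:] (sz xs)" by simp
  show "sz (tl xs) \<le> poly [:0, 1:] (sz xs)" by (simp add: sz_tl)
qed

lemma polyf_Cons:
  assumes "polyf f" "polyf g"
  shows "polyf (\<lambda>x. f x # g x)"
  by (rule polyf_coerce[OF polyf_Pair[OF assms]]) (auto simp: to_tree_prod_def)

text \<open>A fold as a loop over the triple of remaining list, accumulator and constant
  parameter.\<close>

lemma funpow_foldl:
  assumes "i \<le> length ys"
  shows "((\<lambda>\<sigma>. (tl (fst \<sigma>), h (snd (snd \<sigma>)) (fst (snd \<sigma>)) (hd (fst \<sigma>)), snd (snd \<sigma>))) ^^ i) (ys, s, x) =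
    (drop i ys, foldl (h x) s (take i ys), x)"
  using assms
proof (induction i)
  case (Suc i)
  then show ?case
    by (simp add: tl_drop drop_Suc hd_drop_conv_nth take_Suc_conv_app_nth)
qed simp

text \<open>The increment in \<open>growth\<close> does not depend on the accumulator, so after all
  rounds the size has grown by at most the length of the list times a fixed polynomial
  value.\<close>

lemma polyf_foldl:
  fixes h :: "'x::data \<Rightarrow> 's::data \<Rightarrow> 'y::data \<Rightarrow> 's"
  assumes h: "polyf (\<lambda>p. h (fst p) (fst (snd p)) (snd (snd p)))" and i: "polyf i" and l: "polyf l"
    and growth: "\<And>x s y. sz (h x s y) \<le> sz s + poly q (sz x + sz y)"
  shows "polyf (\<lambda>x. foldl (h x) (i x) (l x))"
proof -
  let ?f = "\<lambda>\<sigma> :: 'y list \<times> 's \<times> 'x. (tl (fst \<sigma>), h (snd (snd \<sigma>)) (fst (snd \<sigma>)) (hd (fst \<sigma>)), snd (snd \<sigma>))"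
  have fold_sz: "sz (foldl (h x) s ys) \<le> sz s + length ys * poly q (sz x + sz zs)"
    if "set ys \<subseteq> set zs" for x s ys zs
    using that
  proof (induction ys rule: rev_induct)
    case (snoc y ys)
    have "poly q (sz x + sz y) \<le> poly q (sz x + sz zs)"
      using snoc.prems by (intro poly_nat_mono) (simp add: sz_mem)
    with snoc growth[of x "foldl (h x) s ys" y] show ?case by simp
  qed simp
  \<comment> \<open>The loop delivers its whole final state, with the list used up; the accumulator
    is projected out afterwards. The bound S + S * q(S) comes from at most S rounds with increments
    of at most q(S), where S is the size of the initial state.\<close>
  have "polyf (\<lambda>\<sigma> :: 'y list \<times> 's \<times> 'x. ([] :: 'y list, foldl (h (snd (snd \<sigma>))) (fst (snd \<sigma>)) (fst \<sigma>), snd (snd \<sigma>)))"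
  proof (rule polyf_while[where B = "\<lambda>\<sigma>. if fst \<sigma> = [] then False else True" and f = ?f
        and q = "[:0, 1:] + [:0, 1:] * q"])
    show "polyf (\<lambda>\<sigma> :: 'y list \<times> 's \<times> 'x. if fst \<sigma> = [] then False else True)"
      by (intro polyf_If polyf_eq polyf_fst polyf_id polyf_const)
    have "polyf (\<lambda>\<sigma> :: 'y list \<times> 's \<times> 'x. h (snd (snd \<sigma>)) (fst (snd \<sigma>)) (hd (fst \<sigma>)))"
      using polyf_comp[OF h, of "\<lambda>\<sigma>. (snd (snd \<sigma>), fst (snd \<sigma>), hd (fst \<sigma>))"]
      by (simp add: polyf_Pair polyf_fst polyf_snd polyf_hd polyf_id)
    then show "polyf ?f"
      by (intro polyf_Pair polyf_tl polyf_fst polyf_snd polyf_id)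
    fix \<sigma> :: "'y list \<times> 's \<times> 'x"
    obtain ys s x where [simp]: "\<sigma> = (ys, s, x)" by (cases \<sigma>)
    let ?S = "sz \<sigma>"
    have bound: "sz ((?f ^^ j) \<sigma>) \<le> poly ([:0, 1:] + [:0, 1:] * q) ?S" if "j \<le> length ys" for j
    proof -
      have 1: "sz (foldl (h x) s (take j ys)) \<le> sz s + length (take j ys) * poly q (sz x + sz ys)"
        using set_take_subset by (rule fold_sz)
      have 2: "length (take j ys) * poly q (sz x + sz ys) \<le> ?S * poly q ?S"
        using length_le_sz[of ys] by (intro mult_mono poly_nat_mono) simp_all
      have "sz ((?f ^^ j) \<sigma>) = sz (drop j ys, foldl (h x) s (take j ys), x)"
        using funpow_foldl[OF that, of h s x] by simp
      with 1 2 sz_drop[of j ys] show ?thesis by simp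
    qed
    show "\<exists>N\<le>poly ([:0, 1:] + [:0, 1:] * q) ?S.
        (\<forall>i<N. if fst ((?f ^^ i) \<sigma>) = [] then False else True) \<and>
        \<not> (if fst ((?f ^^ N) \<sigma>) = [] then False else True) \<and>
        (\<forall>i\<le>N. sz ((?f ^^ i) \<sigma>) \<le> poly ([:0, 1:] + [:0, 1:] * q) ?S) \<and>
        ([], foldl (h (snd (snd \<sigma>))) (fst (snd \<sigma>)) (fst \<sigma>), snd (snd \<sigma>)) = (?f ^^ N) \<sigma>"
    proof (intro exI[of _ "length ys"] conjI allI impI)
      show "length ys \<le> poly ([:0, 1:] + [:0, 1:] * q) ?S"
        using length_le_sz[of ys] by simp
      show "if fst ((?f ^^ i) \<sigma>) = [] then False else True" if "i < length ys" for i
        using funpow_foldl[of i ys h s x] that by simp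
      show "\<not> (if fst ((?f ^^ length ys) \<sigma>) = [] then False else True)"
        using funpow_foldl[of "length ys" ys h s x] by simp
      show "([], foldl (h (snd (snd \<sigma>))) (fst (snd \<sigma>)) (fst \<sigma>), snd (snd \<sigma>)) = (?f ^^ length ys) \<sigma>"
        using funpow_foldl[of "length ys" ys h s x] by simp
    qed (rule bound)
  qed
  from polyf_comp[OF polyf_fst[OF polyf_snd[OF this]] polyf_Pair[OF l polyf_Pair[OF i polyf_id]]]
  show ?thesis by simp
qed

section \<open>From polynomial-time predicates on words to the class of languages\<close>

definition decide_com :: "symbol com \<Rightarrow> symbol com" where
  "decide_com c = Seq
     (Seq (While (\<lambda>ss. ss ! 0 \<noteq> Blank)
        (Seq (Act (\<lambda>ss. [(ss ! 0, Stay), (ss ! 1, MoveLeft), (ss ! 2, Stay), (ss ! 3, Stay)]))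
          (Act (\<lambda>ss. [(Blank, MoveRight), (ss ! 0, Stay), (ss ! 2, Stay), (ss ! 3, Stay)]))))
       (push_com (Aux 0)))
     (Seq (While (\<lambda>ss. ss ! 1 \<noteq> Blank)
        (Seq (Seq (Act (\<lambda>ss. [(ss ! 0, MoveLeft), (ss ! 1, Stay), (ss ! 2, Stay), (ss ! 3, Stay)]))
          (Act (\<lambda>ss. [(ss ! 1, Stay), (Blank, MoveRight), (ss ! 2, Stay), (ss ! 3, Stay)])))
          (push_com (Aux 1)))) c)"

lemma run_reverse_input:
  "run (While (\<lambda>ss. ss ! 0 \<noteq> Blank)
        (Seq (Act (\<lambda>ss. [(ss ! 0, Stay), (ss ! 1, MoveLeft), (ss ! 2, Stay), (ss ! 3, Stay)]))
          (Act (\<lambda>ss. [(Blank, MoveRight), (ss ! 0, Stay), (ss ! 2, Stay), (ss ! 3, Stay)]))))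
     [map Letter w, X, [], []] (1 + 3 * length w) [[], rev (map Letter w) @ X, [], []]"
    (is "run ?W _ _ _")
proof (induction w arbitrary: X)
  case Nil
  then show ?case by (auto intro!: run_mono[OF run_WhileF])
next
  case (Cons s w)
  have "run ?W [map Letter (s # w), X, [], []] (Suc ((1 + 1) + (1 + 3 * length w)))
     [[], rev (map Letter w) @ Letter s # X, [], []]"
    by (rule run_WhileT[OF _ run_Seq[OF run_Act4 run_Act4] Cons.IH]) auto
  then show ?case by (simp, elim run_mono) simp
qed

text \<open>The serialised list has an \<open>Aux 1\<close> in front of each element and ends in
  \<open>Aux 0\<close>. It is built from its end, which is why the input word is reversed onto stack
  1 beforehand.\<close>

lemma run_encode_input:
  "run (While (\<lambda>ss. ss ! 1 \<noteq> Blank)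
        (Seq (Seq (Act (\<lambda>ss. [(ss ! 0, MoveLeft), (ss ! 1, Stay), (ss ! 2, Stay), (ss ! 3, Stay)]))
          (Act (\<lambda>ss. [(ss ! 1, Stay), (Blank, MoveRight), (ss ! 2, Stay), (ss ! 3, Stay)])))
          (push_com (Aux 1))))
     [ser (to_tree u), map Letter w, [], []] (1 + 5 * length w) (stack0 (ser (to_tree (rev w @ u))))"
    (is "run ?W _ _ _")
proof (induction w arbitrary: u)
  case Nil
  then show ?case by (auto intro!: run_mono[OF run_WhileF])
next
  case (Cons s w)
  have "run (Seq (Act (\<lambda>ss. [(ss ! 0, MoveLeft), (ss ! 1, Stay), (ss ! 2, Stay), (ss ! 3, Stay)]))
          (Act (\<lambda>ss. [(ss ! 1, Stay), (Blank, MoveRight), (ss ! 2, Stay), (ss ! 3, Stay)])))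
     [ser (to_tree u), map Letter (s # w), [], []] (1 + 1) [Letter s # ser (to_tree u), map Letter w, [], []]"
    by (rule run_Seq[OF run_Act4 run_Act4]) auto
  from run_WhileT[OF _ run_Seq[OF this run_push], of "\<lambda>ss. ss ! 1 \<noteq> Blank" "Aux 1"] Cons.IH[of "s # u"]
  have "run ?W [ser (to_tree u), map Letter (s # w), [], []] (Suc ((1 + 1) + 2 + (1 + 5 * length w)))
     (stack0 (ser (to_tree (rev w @ s # u))))"
    by (simp add: to_tree_symbol_def)
  then show ?case by (simp, elim run_mono) simp
qed

theorem polynomial_time_polyf:
  fixes L :: "symbol list set"
  assumes "polyf (\<lambda>w. w \<in> L)"
  shows "L \<in> polynomial_time"
proof -
  from assms obtain c p where c: "wfc c"
    "\<And>x R. run c (stack0 (ser (to_tree x) @ R)) (poly p (sz x)) (stack0 (ser (to_tree (x \<in> L)) @ R))"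
    by (rule polyfE) blast
  \<comment> \<open>The linear part pays for re-encoding the input; \<open>[:1, 2:]\<close> is the
    size of the serialised word in terms of its length.\<close>
  let ?b = "[:20, 8:] + pcompose p [:1, 2:]"
  show ?thesis
  proof (rule machine_decides[where k = 4 and \<Sigma> = alphabet and c = "decide_com c" and b = ?b
        and A = "\<lambda>ss. ss ! 0 = Aux 1"])
    show "wfc (decide_com c)"
      unfolding decide_com_def wf_com_simps using c(1)
      by (intro conjI wfc_Act wfc_push) auto
    show "finite alphabet" "insert Blank (range Letter) \<subseteq> alphabet"
      by (auto simp: alphabet_def)
    fix w :: "symbol list"
    have sz: "sz w = 2 * length w + 1"
      by (induction w) simp_all
    have push: "run (push_com (Aux 0)) [[], rev (map Letter w), [], []] 2
        [ser (to_tree ([] :: symbol list)), map Letter (rev w), [], []]"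
      using run_push[of "Aux 0" "[]" "rev (map Letter w)" "[]" "[]"] by (simp add: rev_map)
    have "run (decide_com c) (stack0 (map Letter w)) (poly ?b (length w)) (stack0 (ser (to_tree (w \<in> L))))"
      unfolding decide_com_def
    proof (rule run_mono[OF run_Seq[OF run_Seq[OF _ push] run_Seq]])
      show "run (While (\<lambda>ss. ss ! 0 \<noteq> Blank)
        (Seq (Act (\<lambda>ss. [(ss ! 0, Stay), (ss ! 1, MoveLeft), (ss ! 2, Stay), (ss ! 3, Stay)]))
          (Act (\<lambda>ss. [(Blank, MoveRight), (ss ! 0, Stay), (ss ! 2, Stay), (ss ! 3, Stay)]))))
        (stack0 (map Letter w)) (1 + 3 * length w) [[], rev (map Letter w), [], []]"
        using run_reverse_input[of w "[]"] by simp
      show "run (While (\<lambda>ss. ss ! 1 \<noteq> Blank)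
        (Seq (Seq (Act (\<lambda>ss. [(ss ! 0, MoveLeft), (ss ! 1, Stay), (ss ! 2, Stay), (ss ! 3, Stay)]))
          (Act (\<lambda>ss. [(ss ! 1, Stay), (Blank, MoveRight), (ss ! 2, Stay), (ss ! 3, Stay)])))
          (push_com (Aux 1))))
        [ser (to_tree ([] :: symbol list)), map Letter (rev w), [], []] (1 + 5 * length w) (stack0 (ser (to_tree w)))"
        using run_encode_input[of "[]" "rev w"] by simp
      show "run c (stack0 (ser (to_tree w))) (poly p (sz w)) (stack0 (ser (to_tree (w \<in> L))))"
        using c(2)[of w "[]"] by simp
      have "poly ?b (length w) = 20 + 8 * length w + poly p (sz w)"
        by (simp add: poly_pcompose sz mult.commute)
      then show "(1 + 3 * length w) + 2 + ((1 + 5 * length w) + poly p (sz w)) \<le> poly ?b (length w)"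
        by simp
    qed
    moreover have "list_all2 stk (stack0 (map Letter w)) (input_tape w # replicate (4 - 1) (input_tape []))"
      using stk_input[of w] stk_input[of "[]"] by (simp add: numeral_3_eq_3)
    ultimately obtain m ts where m: "m \<le> poly ?b (length w)"
      "exec (decide_com c) (input_tape w # replicate (4 - 1) (input_tape [])) m ts"
      "list_all2 stk (stack0 (ser (to_tree (w \<in> L)))) ts"
      unfolding run_def by blast
    have "map read_tape ts ! 0 = Aux 1 \<longleftrightarrow> w \<in> L"
      using stks_top[OF m(3)] by (simp add: to_tree_bool_def bool_tree_def)
    with m show "\<exists>m ts. m \<le> poly ?b (length w) \<and>
        exec (decide_com c) (input_tape w # replicate (4 - 1) (input_tape [])) m ts \<and>
        (map read_tape ts ! 0 = Aux 1 \<longleftrightarrow> w \<in> L)"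
      by blast
  qed simp
qed

section \<open>Closure under logical, list and arithmetic operations\<close>

named_theorems polyf_intros

lemmas [polyf_intros] = polyf_id polyf_const polyf_Pair polyf_fst polyf_snd polyf_If polyf_eq
  polyf_hd polyf_tl polyf_Cons

lemma polyf_Let [polyf_intros]:
  "polyf (\<lambda>p. g (fst p) (snd p)) \<Longrightarrow> polyf f \<Longrightarrow> polyf (\<lambda>x. let a = f x in g x a)"
  unfolding Let_def by (rule polyf_lift2[OF _ polyf_id])

lemma polyf_Not [polyf_intros]:
  assumes "polyf f" shows "polyf (\<lambda>x. \<not> f x)"
proof -
  have "(\<lambda>x. \<not> f x) = (\<lambda>x. if f x then False else True)" by auto
  then show ?thesis by (simp only:) (intro polyf_intros assms)
qed

lemma polyf_conj [polyf_intros]: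
  assumes "polyf f" "polyf g" shows "polyf (\<lambda>x. f x \<and> g x)"
proof -
  have "(\<lambda>x. f x \<and> g x) = (\<lambda>x. if f x then g x else False)" by auto
  then show ?thesis by (simp only:) (intro polyf_intros assms)
qed

lemma polyf_disj [polyf_intros]:
  assumes "polyf f" "polyf g" shows "polyf (\<lambda>x. f x \<or> g x)"
proof -
  have "(\<lambda>x. f x \<or> g x) = (\<lambda>x. if f x then True else g x)" by auto
  then show ?thesis by (simp only:) (intro polyf_intros assms)
qed

lemma polyf_imp [polyf_intros]:
  assumes "polyf f" "polyf g" shows "polyf (\<lambda>x. f x \<longrightarrow> g x)"
proof -
  have "(\<lambda>x. f x \<longrightarrow> g x) = (\<lambda>x. if f x then g x else True)" by auto
  then show ?thesis by (simp only:) (intro polyf_intros assms)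
qed

text \<open>The alphabet is finite, so a chain of equality tests may select a separate program for
  each symbol. The induction adds symbols one at a time; the default \<open>End\<close> disappears
  once all of them are covered.\<close>

lemma polyf_symbol:
  fixes s :: "'a::data \<Rightarrow> symbol"
  assumes "\<And>c. polyf (\<lambda>x. F c x)" "polyf s"
  shows "polyf (\<lambda>x. F (s x) x)"
proof -
  have "polyf (\<lambda>x. if s x \<in> A then F (s x) x else F End x)" if "finite A" for A
    using that
  proof induction
    case (insert a A)
    have "(\<lambda>x. if s x \<in> insert a A then F (s x) x else F End x) =
        (\<lambda>x. if s x = a then F a x else if s x \<in> A then F (s x) x else F End x)"
      by auto
    then show ?case
      by (simp only:) (rule polyf_If[OF polyf_eq[OF assms(2) polyf_const] assms(1) insert.IH])
  qed (simp add: assms)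
  from this[OF finite_UNIV] show ?thesis by simp
qed

lemma polyf_rev [polyf_intros]:
  assumes "polyf l" shows "polyf (\<lambda>x. rev (l x))"
proof -
  have "polyf (\<lambda>x. foldl (\<lambda>s y. y # s) [] (l x))"
    using assms by (intro polyf_foldl[where q = "[:1, 1:]"] polyf_intros) simp_all
  then show ?thesis
    by (simp add: foldl_conv_fold rev_conv_fold cong: fold_cong)
qed

lemma polyf_foldr:
  fixes h :: "'x::data \<Rightarrow> 'y::data \<Rightarrow> 's::data \<Rightarrow> 's"
  assumes h: "polyf (\<lambda>p. h (fst p) (snd (snd p)) (fst (snd p)))" and i: "polyf i" and l: "polyf l"
    and growth: "\<And>x s y. sz (h x y s) \<le> sz s + poly q (sz x + sz y)"
  shows "polyf (\<lambda>x. foldr (h x) (l x) (i x))"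
proof -
  from polyf_foldl[where h = "\<lambda>x s y. h x y s", OF h i polyf_rev[OF l] growth]
  show ?thesis by (simp add: foldr_conv_foldl)
qed

lemma polyf_append [polyf_intros]:
  assumes "polyf f" "polyf g" shows "polyf (\<lambda>x. f x @ g x)"
proof -
  have "polyf (\<lambda>x. foldr (#) (f x) (g x))"
    by (intro polyf_foldr[where h = "\<lambda>_. (#)" and q = "[:1, 1:]"] polyf_intros assms) simp
  moreover have "foldr (#) xs ys = xs @ ys" for xs ys :: "'b list"
    by (induction xs) simp_all
  ultimately show ?thesis by simp
qed

text \<open>Converts a bound in the size of a pair, which counts one extra node, into the form of
  the growth condition for folds.\<close>

lemma polyf_sz2:
  assumes "polyf (\<lambda>p. g (fst p) (snd p))"
  obtains q where "\<And>x y. sz (g x y) \<le> poly q (sz x + sz y)"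
proof -
  obtain q where q: "\<forall>p. sz (g (fst p) (snd p)) \<le> poly q (sz p)"
    using polyf_sz[OF assms] by blast
  have "sz (g x y) \<le> poly (pcompose q [:1, 1:]) (sz x + sz y)" for x y
    using q[rule_format, of "(x, y)"] by (simp add: poly_pcompose)
  with that show ?thesis by blast
qed

lemma polyf_map [polyf_intros]:
  assumes "polyf (\<lambda>p. g (fst p) (snd p))" "polyf l"
  shows "polyf (\<lambda>x. map (g x) (l x))"
proof -
  from assms(1) obtain q where q: "\<And>x y. sz (g x y) \<le> poly q (sz x + sz y)"
    by (rule polyf_sz2) blast
  have g: "polyf (\<lambda>p. g (fst p) (snd (snd p)))"
    by (rule polyf_lift2[OF assms(1)]) (intro polyf_intros)+
  have "polyf (\<lambda>x. foldr (\<lambda>y s. g x y # s) (l x) [])"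
  proof (intro polyf_foldr[where h = "\<lambda>x y s. g x y # s" and q = "[:1:] + q"] polyf_intros assms(2) g)
    show "sz (g x y # s) \<le> sz s + poly ([:1:] + q) (sz x + sz y)" for x y s
      using q[of x y] by simp
  qed
  moreover have "foldr (\<lambda>y s. f y # s) ys [] = map f ys" for f :: "'b \<Rightarrow> 'c" and ys
    by (induction ys) simp_all
  ultimately show ?thesis by simp
qed

lemma polyf_filter [polyf_intros]:
  assumes "polyf (\<lambda>p. P (fst p) (snd p))" "polyf l"
  shows "polyf (\<lambda>x. filter (P x) (l x))"
proof -
  have P: "polyf (\<lambda>p. P (fst p) (snd (snd p)))"
    by (rule polyf_lift2[OF assms(1)]) (intro polyf_intros)+
  have "polyf (\<lambda>x. foldr (\<lambda>y s. if P x y then y # s else s) (l x) [])"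
    by (intro polyf_foldr[where q = "[:1, 1:]"] polyf_intros assms(2) P) simp
  moreover have "foldr (\<lambda>y s. if Q y then y # s else s) ys [] = filter Q ys" for Q and ys :: "'b list"
    by (induction ys) simp_all
  ultimately show ?thesis by simp
qed

lemma polyf_Bex [polyf_intros]:
  assumes "polyf (\<lambda>p. P (fst p) (snd p))" "polyf l"
  shows "polyf (\<lambda>x. \<exists>y\<in>set (l x). P x y)"
proof -
  have P: "polyf (\<lambda>p. P (fst p) (snd (snd p)))"
    by (rule polyf_lift2[OF assms(1)]) (intro polyf_intros)+
  have "polyf (\<lambda>x. foldr (\<lambda>y s. P x y \<or> s) (l x) False)"
    by (intro polyf_foldr[where q = "[:3:]"] polyf_intros assms(2) P) (simp add: trans_le_add2[OF sz_bool])
  moreover have "foldr (\<lambda>y s. Q y \<or> s) ys False \<longleftrightarrow> (\<exists>y\<in>set ys. Q y)" for Q and ys :: "'b list"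
    by (induction ys) simp_all
  ultimately show ?thesis by simp
qed

lemma polyf_Ball [polyf_intros]:
  assumes "polyf (\<lambda>p. P (fst p) (snd p))" "polyf l"
  shows "polyf (\<lambda>x. \<forall>y\<in>set (l x). P x y)"
proof -
  have "polyf (\<lambda>x. \<not> (\<exists>y\<in>set (l x). \<not> P x y))"
    by (intro polyf_Not polyf_Bex assms)
  then show ?thesis by simp
qed

lemma polyf_member [polyf_intros]:
  assumes "polyf f" "polyf l"
  shows "polyf (\<lambda>x. f x \<in> set (l x))"
proof -
  have "polyf (\<lambda>x. \<exists>y\<in>set (l x). f x = y)"
    by (intro polyf_Bex polyf_eq polyf_comp[OF assms(1)] polyf_fst polyf_snd polyf_id assms(2))
  then show ?thesis by simp
qed

lemma polyf_concat [polyf_intros]: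
  assumes "polyf l" shows "polyf (\<lambda>x. concat (l x))"
proof -
  have "polyf (\<lambda>x. foldr (@) (l x) [])"
  proof (intro polyf_foldr[where h = "\<lambda>_. (@)" and q = "[:0, 1:]"] polyf_intros assms)
    show "sz (y @ s) \<le> sz s + poly [:0, 1:] (sz x + sz y)" for x :: 'a and s y :: "'b list"
      using sz_append[of y s] by simp
  qed
  then show ?thesis by (simp add: concat_conv_foldr)
qed

lemma polyf_Suc [polyf_intros]:
  assumes "polyf f" shows "polyf (\<lambda>x. Suc (f x))"
  by (rule polyf_coerce[OF polyf_Pair[OF polyf_const[of "()"] assms]])
    (auto simp: to_tree_prod_def to_tree_unit_def)

lemma polyf_length [polyf_intros]:
  assumes "polyf l" shows "polyf (\<lambda>x. length (l x))"
proof -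
  have "polyf (\<lambda>x. foldr (\<lambda>_. Suc) (l x) 0)"
    by (intro polyf_foldr[where h = "\<lambda>_ _. Suc" and q = "[:2:]"] polyf_intros assms) (simp add: sz_nat)
  moreover have "foldr (\<lambda>_. Suc) ys 0 = length ys" for ys :: "'b list"
    by (induction ys) simp_all
  ultimately show ?thesis by simp
qed

lemma to_tree_replicate: "to_tree (replicate n ()) = to_tree n"
  by (induction n) (simp_all add: to_tree_unit_def)

text \<open>The identity on codes; it turns a number into a list that can drive a fold.\<close>

lemma polyf_units [polyf_intros]:
  assumes "polyf f" shows "polyf (\<lambda>x. replicate (f x) ())"
  by (rule polyf_coerce[OF assms]) (auto simp: to_tree_replicate)

lemma polyf_pred:
  assumes "polyf f" shows "polyf (\<lambda>x. f x - (1::nat))"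
proof -
  have "polyf (\<lambda>x. tl (replicate (f x) ()))"
    by (intro polyf_intros assms)
  then show ?thesis
    by (rule polyf_coerce) (simp add: to_tree_replicate, blast)
qed

lemma polyf_drop [polyf_intros]:
  assumes "polyf n" "polyf l" shows "polyf (\<lambda>x. drop (n x) (l x))"
proof -
  have "polyf (\<lambda>x. foldl (\<lambda>s _. tl s) (l x) (replicate (n x) ()))"
    by (intro polyf_foldl[where h = "\<lambda>_ s _. tl s" and q = 0] polyf_intros assms) (simp add: sz_tl)
  moreover have "foldl (\<lambda>s _. tl s) ys (replicate k ()) = drop k ys" for k and ys :: "'b list"
    by (induction k arbitrary: ys) (simp_all add: drop_Suc)
  ultimately show ?thesis by simp
qed

lemma polyf_diff_nat [polyf_intros]:
  assumes "polyf f" "polyf g" shows "polyf (\<lambda>x. f x - g x :: nat)"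
proof -
  have "polyf (\<lambda>x. foldl (\<lambda>s _. s - 1) (f x) (replicate (g x) ()))"
    by (intro polyf_foldl[where h = "\<lambda>_ s _. s - 1" and q = 0] polyf_pred polyf_intros assms) (simp add: sz_nat)
  moreover have "foldl (\<lambda>s _. s - 1) n (replicate k ()) = n - k" for n k :: nat
    by (induction k arbitrary: n) simp_all
  ultimately show ?thesis by simp
qed

lemma polyf_plus_nat [polyf_intros]:
  assumes "polyf f" "polyf g" shows "polyf (\<lambda>x. f x + g x :: nat)"
proof -
  have "polyf (\<lambda>x. length (replicate (f x) () @ replicate (g x) ()))"
    by (intro polyf_intros assms)
  then show ?thesis by simp
qed

lemma polyf_min_nat [polyf_intros]:
  assumes "polyf f" "polyf g" shows "polyf (\<lambda>x. min (f x) (g x) :: nat)"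
proof -
  have "polyf (\<lambda>x. f x - (f x - g x))"
    by (intro polyf_intros assms)
  moreover have "a - (a - b) = min a b" for a b :: nat by simp
  ultimately show ?thesis by simp
qed

lemma polyf_le_nat [polyf_intros]:
  fixes f g :: "'a::data \<Rightarrow> nat"
  assumes "polyf f" "polyf g" shows "polyf (\<lambda>x. f x \<le> g x)"
proof -
  have "polyf (\<lambda>x. f x - g x = 0)"
    by (intro polyf_intros assms)
  then show ?thesis by simp
qed

lemma polyf_less_nat [polyf_intros]:
  fixes f g :: "'a::data \<Rightarrow> nat"
  assumes "polyf f" "polyf g" shows "polyf (\<lambda>x. f x < g x)"
proof -
  have "polyf (\<lambda>x. Suc (f x) \<le> g x)"
    by (intro polyf_intros assms)
  then show ?thesis by (simp add: Suc_le_eq)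
qed

text \<open>The minimum bounds the growth of the accumulator in terms of the argument.\<close>

lemma polyf_upt [polyf_intros]:
  assumes "polyf f" shows "polyf (\<lambda>x. [0..<f x])"
proof -
  have "polyf (\<lambda>n. foldl (\<lambda>s _. s @ [min (length s) n]) [] (replicate n ()))"
  proof (intro polyf_foldl[where h = "\<lambda>n s _. s @ [min (length s) n]" and q = "[:2, 1:]"] polyf_intros)
    fix n :: nat and s :: "nat list" and y :: unit
    show "sz (s @ [min (length s) n]) \<le> sz s + poly [:2, 1:] (sz n + sz y)"
      using sz_append[of s "[min (length s) n]"] by (simp add: sz_nat)
  qed
  moreover have "foldl (\<lambda>s _. s @ [min (length s) n]) [] (replicate k ()) = [0..<k]" if "k \<le> n" for k n
    using that
  proof (induction k)
    case (Suc k)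
    have "replicate (Suc k) () = replicate k () @ [()]"
      by (simp add: replicate_append_same)
    with Suc show ?case by (simp del: replicate.simps)
  qed simp
  ultimately have "polyf (\<lambda>n. [0..<n])" by simp
  from polyf_comp[OF this assms] show ?thesis .
qed

lemma polyf_take [polyf_intros]:
  assumes "polyf n" "polyf l" shows "polyf (\<lambda>x. take (n x) (l x))"
proof -
  have "polyf (\<lambda>x. rev (drop (length (l x) - n x) (rev (l x))))"
    by (intro polyf_intros assms)
  moreover have "rev (drop (length ys - k) (rev ys)) = take k ys" for k and ys :: "'b list"
    by (cases "k \<le> length ys") (simp_all add: rev_drop)
  ultimately show ?thesis by simp
qed

lemma polyf_zip [polyf_intros]:
  fixes f :: "'a::data \<Rightarrow> 'b::data list" and g :: "'a \<Rightarrow> 'c::data list"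
  assumes "polyf f" "polyf g" shows "polyf (\<lambda>x. zip (f x) (g x))"
proof -
  have "polyf (\<lambda>p :: 'b list \<times> 'c list. map (\<lambda>k. (hd (drop k (fst p)), hd (drop k (snd p)))) [0..<min (length (fst p)) (length (snd p))])"
    by (intro polyf_intros)
  moreover have "map (\<lambda>k. (hd (drop k xs), hd (drop k ys))) [0..<min (length xs) (length ys)] = zip xs ys"
    for xs :: "'b list" and ys :: "'c list"
    by (rule nth_equalityI) (simp_all add: hd_drop_conv_nth)
  ultimately have "polyf (\<lambda>p. zip (fst p) (snd p) :: ('b \<times> 'c) list)" by simp
  from polyf_lift2[OF this assms] show ?thesis .
qed

lemma polyf_product [polyf_intros]:
  fixes f :: "'a::data \<Rightarrow> 'b::data list" and g :: "'a \<Rightarrow> 'c::data list"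
  assumes "polyf f" "polyf g" shows "polyf (\<lambda>x. List.product (f x) (g x))"
proof -
  have "polyf (\<lambda>p :: 'b list \<times> 'c list. concat (map (\<lambda>a. map (\<lambda>b. (a, b)) (snd p)) (fst p)))"
    by (intro polyf_intros)
  moreover have "concat (map (\<lambda>a. map (\<lambda>b. (a, b)) ys) xs) = List.product xs ys"
    for xs :: "'b list" and ys :: "'c list"
    by (induction xs) simp_all
  ultimately have "polyf (\<lambda>p. List.product (fst p) (snd p) :: ('b \<times> 'c) list)" by simp
  from polyf_lift2[OF this assms] show ?thesis .
qed

text \<open>Guessing where a word divides is replaced by trying all of its linearly many
  cuts.\<close>

definition splits :: "'a list \<Rightarrow> ('a list \<times> 'a list) list" where
  "splits xs = map (\<lambda>k. (take k xs, drop k xs)) [0..<Suc (length xs)]"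

lemma set_splits: "(ys, zs) \<in> set (splits xs) \<longleftrightarrow> xs = ys @ zs"
proof
  assume "xs = ys @ zs"
  then have "(ys, zs) = (take (length ys) xs, drop (length ys) xs)" "length ys < Suc (length xs)"
    by simp_all
  then show "(ys, zs) \<in> set (splits xs)"
    unfolding splits_def set_map set_upt by (intro image_eqI[of _ _ "length ys"]) auto
qed (auto simp: splits_def)

lemma polyf_splits [polyf_intros]:
  assumes "polyf f" shows "polyf (\<lambda>x. splits (f x))"
proof -
  have "polyf (\<lambda>xs. splits xs :: ('b list \<times> 'b list) list)"
    unfolding splits_def by (intro polyf_intros)
  from polyf_comp[OF this assms] show ?thesis .
qed

text \<open>Here \<open>e\<close> terminates chunks rather than separating them. A remainder without
  \<open>e\<close> would be glued to \<open>hd []\<close>, so the result is meaningful only for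
  lists ending in \<open>e\<close>; the decision procedure checks this.\<close>

definition split_at :: "'a \<Rightarrow> 'a list \<Rightarrow> 'a list list" where
  "split_at e xs = foldr (\<lambda>x acc. if x = e then [] # acc else (x # hd acc) # tl acc) xs []"

lemma polyf_split_at [polyf_intros]:
  assumes "polyf f" shows "polyf (\<lambda>x. split_at e (f x))"
  unfolding split_at_def
proof (rule polyf_foldr[where h = "\<lambda>_ x acc. if x = e then [] # acc else (x # hd acc) # tl acc"
      and q = "[:2 + sz (hd [] :: 'b list), 1:]"])
  fix x :: 'a and s :: "'b list list" and y :: 'b
  show "sz (if y = e then [] # s else (y # hd s) # tl s) \<le> sz s + poly [:2 + sz (hd [] :: 'b list), 1:] (sz x + sz y)"
    by (cases s) simp_all
qed (intro polyf_intros assms)+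

lemma polyf_int [polyf_intros]:
  assumes "polyf f" shows "polyf (\<lambda>x. int (f x))"
  by (rule polyf_coerce[OF polyf_Pair[OF polyf_const[of False] assms]])
    (auto simp: to_tree_prod_def to_tree_int_def to_tree_bool_def)

lemma polyf_minus_int:
  assumes "polyf f" shows "polyf (\<lambda>x. - int (f x))"
proof -
  \<comment> \<open>The code of an integer is a sign and a modulus, and zero carries the positive
    sign.\<close>
  have "polyf (\<lambda>x. (f x \<noteq> 0, f x))" by (intro polyf_intros assms)
  then show ?thesis
    by (rule polyf_coerce) (auto simp: to_tree_prod_def to_tree_int_def to_tree_bool_def)
qed

lemma polyf_nat_abs [polyf_intros]:
  assumes "polyf f" shows "polyf (\<lambda>x. nat \<bar>f x\<bar>)"
proof -
  have "polyf (\<lambda>a. nat \<bar>a\<bar>)"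
  proof (rule polyf_coerce[OF polyf_snd'])
    show "\<exists>y :: bool \<times> nat. to_tree a = to_tree y \<and> to_tree (nat \<bar>a\<bar>) = to_tree (snd y)" for a :: int
      by (intro exI[of _ "(a < 0, nat \<bar>a\<bar>)"]) (simp add: to_tree_prod_def to_tree_int_def to_tree_bool_def)
  qed
  from polyf_comp[OF this assms] show ?thesis .
qed

lemma polyf_neg_int [polyf_intros]:
  assumes "polyf f" shows "polyf (\<lambda>x. f x < (0 :: int))"
proof -
  have "polyf (\<lambda>a. a < (0 :: int))"
  proof (rule polyf_coerce[OF polyf_fst'])
    show "\<exists>y :: bool \<times> nat. to_tree a = to_tree y \<and> to_tree (a < 0) = to_tree (fst y)" for a :: int
      by (intro exI[of _ "(a < 0, nat \<bar>a\<bar>)"]) (simp add: to_tree_prod_def to_tree_int_def to_tree_bool_def)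
  qed
  from polyf_comp[OF this assms] show ?thesis .
qed

lemma polyf_uminus_int [polyf_intros]:
  assumes "polyf f" shows "polyf (\<lambda>x. - f x :: int)"
proof -
  have "polyf (\<lambda>x. if f x < 0 then int (nat \<bar>f x\<bar>) else - int (nat \<bar>f x\<bar>))"
    by (intro polyf_intros polyf_minus_int assms)
  moreover have "(if a < 0 then int (nat \<bar>a\<bar>) else - int (nat \<bar>a\<bar>)) = - a" for a by simp
  ultimately show ?thesis by simp
qed

lemma polyf_succ_int [polyf_intros]:
  assumes "polyf f" shows "polyf (\<lambda>x. f x + 1 :: int)"
proof -
  have "polyf (\<lambda>x. if f x < 0 then - int (nat \<bar>f x\<bar> - 1) else int (Suc (nat \<bar>f x\<bar>)))"
    by (intro polyf_intros polyf_minus_int assms)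
  moreover have "(if a < 0 then - int (nat \<bar>a\<bar> - 1) else int (Suc (nat \<bar>a\<bar>))) = a + 1" for a
    by (simp add: nat_diff_distrib of_nat_diff)
  ultimately show ?thesis by simp
qed

lemma polyf_pred_int [polyf_intros]:
  assumes "polyf f" shows "polyf (\<lambda>x. f x - 1 :: int)"
proof -
  have "polyf (\<lambda>x. - (- f x + 1))" by (intro polyf_intros assms)
  then show ?thesis by simp
qed

lemma polyf_le_int [polyf_intros]:
  fixes f g :: "'a::data \<Rightarrow> int"
  assumes "polyf f" "polyf g" shows "polyf (\<lambda>x. f x \<le> g x)"
proof -
  have "polyf (\<lambda>x. if f x < 0 then if g x < 0 then nat \<bar>g x\<bar> \<le> nat \<bar>f x\<bar> else True
    else if g x < 0 then False else nat \<bar>f x\<bar> \<le> nat \<bar>g x\<bar>)"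
    by (intro polyf_intros assms)
  moreover have "(if a < 0 then if b < 0 then nat \<bar>b\<bar> \<le> nat \<bar>a\<bar> else True
    else if b < 0 then False else nat \<bar>a\<bar> \<le> nat \<bar>b\<bar>) = (a \<le> b)" for a b :: int by auto
  ultimately show ?thesis by simp
qed

lemma polyf_min_int [polyf_intros]:
  fixes f g :: "'a::data \<Rightarrow> int"
  assumes "polyf f" "polyf g" shows "polyf (\<lambda>x. min (f x) (g x))"
  unfolding min_def by (intro polyf_intros assms)

lemma polyf_max_int [polyf_intros]:
  fixes f g :: "'a::data \<Rightarrow> int"
  assumes "polyf f" "polyf g" shows "polyf (\<lambda>x. max (f x) (g x))"
  unfolding max_def by (intro polyf_intros assms)

lemma polyf_interval [polyf_intros]:
  assumes "polyf f" shows "polyf (\<lambda>x. [- int (f x)..int (f x)])"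
proof -
  have "polyf (\<lambda>n. map (\<lambda>k. if n \<le> k then int (k - n) else - int (n - k)) [0..<Suc (n + n)])"
    by (intro polyf_intros)
  moreover have "map (\<lambda>k. if n \<le> k then int (k - n) else - int (n - k)) [0..<Suc (n + n)] = [- int n..int n]" for n
    by (rule nth_equalityI) (auto simp: nth_upto nth_append simp del: upt_Suc)
  ultimately have "polyf (\<lambda>n. [- int n..int n])" by simp
  from polyf_comp[OF this assms] show ?thesis .
qed

section \<open>The decision procedure\<close>

text \<open>As the least significant bit comes first, the absence of leading zeros concerns the last
  digit; zero is the empty word.\<close>

definition canon :: "symbol list \<Rightarrow> bool" where
  "canon bs \<longleftrightarrow> (\<forall>c\<in>set bs. c = Bit True \<or> c = Bit False) \<and> (bs = [] \<or> hd (rev bs) = Bit True)"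

text \<open>A numeral may denote an exponentially large number. Cutting off at \<open>K\<close>
  after every digit keeps the unary accumulator small, as folds require.\<close>

definition nval :: "nat \<Rightarrow> symbol list \<Rightarrow> nat" where
  "nval K bs = foldr (\<lambda>c v. min K (v + v + (if c = Bit True then 1 else 0))) bs 0"

text \<open>The last condition excludes a negative zero, which \<open>enc_int\<close> never
  produces.\<close>

definition int_chunk :: "symbol list \<Rightarrow> bool" where
  "int_chunk c \<longleftrightarrow> c \<noteq> [] \<and> (hd c = Bit True \<or> hd c = Bit False) \<and> canon (tl c) \<and>
     (hd c = Bit True \<longrightarrow> tl c \<noteq> [])"

definition ival :: "nat \<Rightarrow> symbol list \<Rightarrow> int" where
  "ival K c = (if hd c = Bit True then - int (nval K (tl c)) else int (nval K (tl c)))"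

definition grid :: "nat \<Rightarrow> point list" where
  "grid K = List.product [- int K..int K] [- int K..int K]"

definition clip :: "nat \<Rightarrow> int \<Rightarrow> int" where
  "clip K a = max (- int K) (min (int K) a)"

fun shift :: "direction \<Rightarrow> point \<Rightarrow> point" where
  "shift Up z = (fst z, snd z + 1)"
| "shift Down z = (fst z, snd z - 1)"
| "shift Rightw z = (fst z + 1, snd z)"
| "shift Leftw z = (fst z - 1, snd z)"

text \<open>Closed form of the reflexive transitive closure of a direction, testable without
  iteration.\<close>

fun ahead :: "direction \<Rightarrow> point \<Rightarrow> point \<Rightarrow> bool" where
  "ahead Up z z' \<longleftrightarrow> fst z' = fst z \<and> snd z \<le> snd z'"
| "ahead Down z z' \<longleftrightarrow> fst z' = fst z \<and> snd z' \<le> snd z"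
| "ahead Rightw z z' \<longleftrightarrow> fst z \<le> fst z' \<and> snd z' = snd z"
| "ahead Leftw z z' \<longleftrightarrow> fst z' \<le> fst z \<and> snd z' = snd z"

fun reach :: "nat \<Rightarrow> compass \<Rightarrow> point \<Rightarrow> point \<Rightarrow> bool" where
  "reach K (Once d) z z' \<longleftrightarrow> z' = (clip K (fst (shift d z)), clip K (snd (shift d z)))"
| "reach K (Star d) z z' \<longleftrightarrow> ahead d z z'"

text \<open>
  An environment consists of the size of the grid, the valuation and the positions of the agents.
  The truth set of a formula in the grid is represented by a list of points.
\<close>

type_synonym env = "nat \<times> (point \<times> symbol list list) list \<times> point list"

definition atom_table :: "env \<Rightarrow> symbol list \<Rightarrow> point list" where
  "atom_table E c = filter (\<lambda>z. \<exists>p\<in>set (fst (snd E)). fst p = z \<and> c \<in> set (snd p)) (grid (fst E))"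

definition here_table :: "env \<Rightarrow> nat \<Rightarrow> point list" where
  "here_table E k = filter (\<lambda>z. hd (drop k (snd (snd E))) = z) (grid (fst E))"

definition neg_table :: "env \<Rightarrow> point list \<Rightarrow> point list" where
  "neg_table E A = filter (\<lambda>z. \<not> z \<in> set A) (grid (fst E))"

definition conj_table :: "env \<Rightarrow> point list \<Rightarrow> point list \<Rightarrow> point list" where
  "conj_table E A B = filter (\<lambda>z. z \<in> set A \<and> z \<in> set B) (grid (fst E))"

definition box_table :: "compass \<Rightarrow> env \<Rightarrow> point list \<Rightarrow> point list" where
  "box_table \<alpha> E A =
     filter (\<lambda>z. \<forall>z'\<in>set (grid (fst E)). reach (fst E) \<alpha> z z' \<longrightarrow> z' \<in> set A) (grid (fst E))"

text \<open>
  Formulas are read from right to left. The state records whether the word read is well-formed so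
  far, whether a number is being read, its digits, the stack of truth sets, and the atoms read.
  The parameters \<open>i\<close> and \<open>a\<close> say whether there are infinitely many atoms, and otherwise how many;
  \<open>m\<close> is the number of agents.
\<close>

type_synonym eval_state = "bool \<times> bool \<times> symbol list \<times> point list list \<times> symbol list list"

text \<open>Read backwards, prefix notation delivers the operands before their operator, so a stack
  suffices. \<open>End\<close> opens a number, whose digits arrive most significant first and are
  put in order by consing; \<open>SAtom\<close> or \<open>SHere\<close> closes it.\<close>

fun eval_step :: "bool \<Rightarrow> nat \<Rightarrow> nat \<Rightarrow> env \<Rightarrow> symbol \<Rightarrow> eval_state \<Rightarrow> eval_state" where
  "eval_step i a m E (Bit b) s = (case s of (ok, num, bs, st, as) \<Rightarrow>
     (ok \<and> num, True, Bit b # bs, st, as))"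
| "eval_step i a m E End s = (case s of (ok, num, bs, st, as) \<Rightarrow>
     (ok \<and> \<not> num, True, [], st, as))"
| "eval_step i a m E SAtom s = (case s of (ok, num, bs, st, as) \<Rightarrow>
     (ok \<and> num \<and> canon bs \<and> (i \<or> nval a bs < a), False, [],
      atom_table E (SAtom # bs) # st, (SAtom # bs) # as))"
| "eval_step i a m E SHere s = (case s of (ok, num, bs, st, as) \<Rightarrow>
     (ok \<and> num \<and> canon bs \<and> nval m bs < m, False, [], here_table E (nval m bs) # st, as))"
| "eval_step i a m E SNeg s = (case s of (ok, num, bs, st, as) \<Rightarrow>
     (ok \<and> \<not> num \<and> st \<noteq> [], False, [], neg_table E (hd st) # tl st, as))"
| "eval_step i a m E SConj s = (case s of (ok, num, bs, st, as) \<Rightarrow>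
     (ok \<and> \<not> num \<and> st \<noteq> [] \<and> tl st \<noteq> [], False, [],
      conj_table E (hd st) (hd (tl st)) # tl (tl st), as))"
| "eval_step i a m E (SBox \<alpha>) s = (case s of (ok, num, bs, st, as) \<Rightarrow>
     (ok \<and> \<not> num \<and> st \<noteq> [], False, [], box_table \<alpha> E (hd st) # tl st, as))"

definition eval_word :: "bool \<Rightarrow> nat \<Rightarrow> nat \<Rightarrow> env \<Rightarrow> symbol list \<Rightarrow> eval_state" where
  "eval_word i a m E f = foldr (eval_step i a m E) f (True, False, [], [], [])"

definition positions :: "nat \<Rightarrow> nat \<Rightarrow> symbol list list \<Rightarrow> point list" where
  "positions m K ag =
     map (\<lambda>k. (ival K (hd (drop (k + k) ag)), ival K (hd (drop (Suc (k + k)) ag)))) [0..<m]"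

text \<open>
  The words \<open>f\<close>, \<open>cn\<close>, \<open>ag\<close>, \<open>t\<close> and \<open>e\<close> are the parts of the input that present the formula, the
  bound, the agents, the table and the position; all but the first are split into chunks at \<open>End\<close>.
\<close>

definition accepts_parts ::
  "bool \<Rightarrow> nat \<Rightarrow> nat \<Rightarrow> nat \<Rightarrow> symbol list \<Rightarrow> symbol list \<Rightarrow> symbol list list \<Rightarrow> symbol list list \<Rightarrow> symbol list list \<Rightarrow> bool"
where
  "accepts_parts i a m K f cn ag t e \<longleftrightarrow>
     canon cn \<and> length ag = m + m \<and> (\<forall>c\<in>set ag. int_chunk c) \<and> t \<noteq> [] \<and> hd (rev t) = [] \<and>
     length e = 2 \<and> (\<forall>c\<in>set e. int_chunk c) \<and>
     (let G = grid (nval K cn) in let cells = split_at [] t in let ps = positions m K ag in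
      let S = eval_word i a m (K, zip G cells, ps) f in
      length cells = length G \<and> (\<forall>z\<in>set ps. z \<in> set G) \<and>
      fst S \<and> \<not> fst (snd S) \<and> length (fst (snd (snd (snd S)))) = 1 \<and>
      (ival K (hd e), ival K (hd (tl e))) \<in> set (hd (fst (snd (snd (snd S))))) \<and>
      (\<forall>cell\<in>set cells. \<forall>c\<in>set cell. c \<in> set (snd (snd (snd (snd S))))))"

text \<open>All cuts are tried: \<open>p\<close> separates the formula from the chunks, while
  \<open>q\<close> and \<open>r\<close> separate agents, table and position. The radius is the
  length of the whole word.\<close>

definition accepts :: "bool \<Rightarrow> nat \<Rightarrow> nat \<Rightarrow> symbol list \<Rightarrow> bool" where
  "accepts i a m w \<longleftrightarrow>
     (\<exists>p\<in>set (splits w). snd p \<noteq> [] \<and> hd (rev (snd p)) = End \<and>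
       (\<exists>q\<in>set (splits (tl (split_at End (snd p)))). \<exists>r\<in>set (splits (snd q)).
          accepts_parts i a m (length w) (fst p) (hd (split_at End (snd p))) (fst q) (fst r) (snd r)))"

section \<open>Polynomial running time of the decision procedure\<close>

lemma polyf_canon [polyf_intros]: assumes "polyf f" shows "polyf (\<lambda>x. canon (f x))"
  by (rule polyf_comp[OF _ assms]) (unfold canon_def, intro polyf_intros)

lemma polyf_nval [polyf_intros]: assumes "polyf f" "polyf g" shows "polyf (\<lambda>x. nval (f x) (g x))"
proof (rule polyf_lift2[OF _ assms])
  show "polyf (\<lambda>p. nval (fst p) (snd p))"
    unfolding nval_def
  proof (rule polyf_foldr[where h = "\<lambda>p c v. min (fst p) (v + v + (if c = Bit True then 1 else 0))"
        and q = "[:0, 1:]"])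
    show "sz (min (fst p) (v + v + (if c = Bit True then 1 else 0))) \<le> sz v + poly [:0, 1:] (sz p + sz c)"
      for p :: "nat \<times> symbol list" and c v
      using sz_fst[of p] by (auto simp: sz_nat min_def)
  qed (intro polyf_intros)+
qed

lemma polyf_int_chunk [polyf_intros]: assumes "polyf f" shows "polyf (\<lambda>x. int_chunk (f x))"
  by (rule polyf_comp[OF _ assms]) (unfold int_chunk_def, intro polyf_intros)

lemma polyf_ival [polyf_intros]: assumes "polyf f" "polyf g" shows "polyf (\<lambda>x. ival (f x) (g x))"
  by (rule polyf_lift2[OF _ assms]) (unfold ival_def, intro polyf_intros)

lemma polyf_grid [polyf_intros]: assumes "polyf f" shows "polyf (\<lambda>x. grid (f x))"
  by (rule polyf_comp[OF _ assms]) (unfold grid_def, intro polyf_intros)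

lemma polyf_clip [polyf_intros]: assumes "polyf f" "polyf g" shows "polyf (\<lambda>x. clip (f x) (g x))"
  by (rule polyf_lift2[OF _ assms]) (unfold clip_def, intro polyf_intros)

lemma polyf_shift [polyf_intros]: assumes "polyf f" shows "polyf (\<lambda>x. shift d (f x))"
  by (rule polyf_comp[OF _ assms]) (cases d; simp only: shift.simps; intro polyf_intros)

lemma polyf_ahead [polyf_intros]:
  assumes "polyf f" "polyf g" shows "polyf (\<lambda>x. ahead d (f x) (g x))"
  by (rule polyf_lift2[OF _ assms]) (cases d; simp only: ahead.simps; intro polyf_intros)

lemma polyf_reach [polyf_intros]:
  assumes "polyf k" "polyf f" "polyf g" shows "polyf (\<lambda>x. reach (k x) \<alpha> (f x) (g x))"
  by (cases \<alpha>; simp only: reach.simps; intro polyf_intros assms)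

lemma polyf_atom_table [polyf_intros]:
  assumes "polyf f" "polyf g" shows "polyf (\<lambda>x. atom_table (f x) (g x))"
  by (rule polyf_lift2[OF _ assms]) (unfold atom_table_def, intro polyf_intros)

lemma polyf_here_table [polyf_intros]:
  assumes "polyf f" "polyf g" shows "polyf (\<lambda>x. here_table (f x) (g x))"
  by (rule polyf_lift2[OF _ assms]) (unfold here_table_def, intro polyf_intros)

lemma polyf_neg_table [polyf_intros]:
  assumes "polyf f" "polyf g" shows "polyf (\<lambda>x. neg_table (f x) (g x))"
  by (rule polyf_lift2[OF _ assms]) (unfold neg_table_def, intro polyf_intros)

lemma polyf_conj_table [polyf_intros]:
  assumes "polyf f" "polyf g" "polyf h" shows "polyf (\<lambda>x. conj_table (f x) (g x) (h x))"
proof -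
  have "polyf (\<lambda>p. conj_table (fst p) (fst (snd p)) (snd (snd p)))"
    unfolding conj_table_def by (intro polyf_intros)
  from polyf_comp[OF this polyf_Pair[OF assms(1) polyf_Pair[OF assms(2,3)]]] show ?thesis by simp
qed

lemma polyf_box_table [polyf_intros]:
  assumes "polyf f" "polyf g" shows "polyf (\<lambda>x. box_table \<alpha> (f x) (g x))"
  by (rule polyf_lift2[OF _ assms]) (unfold box_table_def, intro polyf_intros)

lemma polyf_positions [polyf_intros]:
  assumes "polyf f" "polyf g" shows "polyf (\<lambda>x. positions m (f x) (g x))"
  by (rule polyf_lift2[OF _ assms]) (unfold positions_def, intro polyf_intros)

text \<open>A symbol adds at most one truth set, and every truth set is a sublist of the grid
  whatever the stack holds. The increase thus depends only on the environment; 20 leaves room for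
  flags and constructors.\<close>

lemma eval_step_growth:
  assumes "\<And>K. sz (grid K) \<le> poly g (sz K)"
  shows "sz (eval_step i a m E c s) \<le> sz s + poly ([:20:] + g) (sz E + sz c)"
proof -
  obtain ok num bs st as where [simp]: "s = (ok, num, bs, st, as)" by (cases s)
  have "sz (grid (fst E)) \<le> poly g (sz E + sz c)"
    using assms[of "fst E"] poly_nat_mono[of "sz (fst E)" "sz E + sz c" g] sz_fst[of E] by simp
  moreover have "sz (atom_table E d) \<le> sz (grid (fst E))" "sz (here_table E k) \<le> sz (grid (fst E))"
    "sz (neg_table E A) \<le> sz (grid (fst E))" "sz (conj_table E A B) \<le> sz (grid (fst E))"
    "sz (box_table \<alpha> E A) \<le> sz (grid (fst E))" for d k A B \<alpha>
    unfolding atom_table_def here_table_def neg_table_def conj_table_def box_table_def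
    by (rule sz_filter)+
  ultimately have T: "sz (atom_table E d) \<le> poly g (sz E + sz c)" "sz (here_table E k) \<le> poly g (sz E + sz c)"
    "sz (neg_table E A) \<le> poly g (sz E + sz c)" "sz (conj_table E A B) \<le> poly g (sz E + sz c)"
    "sz (box_table \<alpha> E A) \<le> poly g (sz E + sz c)" for d k A B \<alpha>
    by (meson le_trans)+
  have b: "sz p \<le> 3 + sz q" for p q :: bool using sz_bool[of p] by simp
  have tl: "sz (tl st) \<le> sz st" "sz (tl (tl st)) \<le> sz st"
    using sz_tl[of st] sz_tl[of "tl st"] by simp_all
  have pos: "0 < sz bs" by (rule sz_pos)
  show ?thesis
  proof (cases c)
    case (Bit d)
    then show ?thesis using b[of "ok \<and> num" ok] b[of True num] by simp
  next
    case End
    then show ?thesis using b[of "ok \<and> \<not> num" ok] b[of True num] pos by simp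
  next
    case SAtom
    then show ?thesis
      using b[of "ok \<and> num \<and> canon bs \<and> (i \<or> nval a bs < a)" ok] b[of False num] T(1)[of "SAtom # bs"] by simp
  next
    case SHere
    then show ?thesis
      using b[of "ok \<and> num \<and> canon bs \<and> nval m bs < m" ok] b[of False num] T(2)[of "nval m bs"] pos by simp
  next
    case SNeg
    then show ?thesis
      using b[of "ok \<and> \<not> num \<and> st \<noteq> []" ok] b[of False num] T(3)[of "hd st"] tl pos by simp
  next
    case SConj
    then show ?thesis
      using b[of "ok \<and> \<not> num \<and> st \<noteq> [] \<and> tl st \<noteq> []" ok] b[of False num] T(4)[of "hd st" "hd (tl st)"] tl pos
      by simp
  next
    case (SBox \<alpha>)
    then show ?thesis
      using b[of "ok \<and> \<not> num \<and> st \<noteq> []" ok] b[of False num] T(5)[of \<alpha> "hd st"] tl pos by simp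
  qed
qed

lemma polyf_eval [polyf_intros]:
  assumes "polyf f" "polyf g" shows "polyf (\<lambda>x. eval_word i a m (f x) (g x))"
proof (rule polyf_lift2[OF _ assms])
  obtain g where g: "\<forall>K. sz (grid K) \<le> poly g (sz K)"
    using polyf_sz[OF polyf_grid[OF polyf_id]] by blast
  have "polyf (\<lambda>x :: (env \<times> symbol list) \<times> eval_state \<times> symbol.
      eval_step i a m (fst (fst x)) (snd (snd x)) (fst (snd x)))"
  \<comment> \<open>\<open>eval_step\<close> is defined by cases on the symbol, so each symbol is
    treated as a constant.\<close>
  proof (rule polyf_symbol[where F = "\<lambda>c x. eval_step i a m (fst (fst x)) c (fst (snd x))"])
    show "polyf (\<lambda>x :: (env \<times> symbol list) \<times> eval_state \<times> symbol. eval_step i a m (fst (fst x)) c (fst (snd x)))" for c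
      by (cases c; simp only: eval_step.simps split_def; intro polyf_intros)
  qed (intro polyf_intros)
  then show "polyf (\<lambda>p. eval_word i a m (fst p) (snd p))"
    unfolding eval_word_def
  proof (rule polyf_foldr[where h = "\<lambda>p. eval_step i a m (fst p)" and q = "[:20:] + g"])
    show "sz (eval_step i a m (fst p) c s) \<le> sz s + poly ([:20:] + g) (sz p + sz c)"
      for p :: "env \<times> symbol list" and c s
      using eval_step_growth[OF g[rule_format], of i a m "fst p" c s]
        poly_nat_mono[of "sz (fst p) + sz c" "sz p + sz c" g] sz_fst[of p] by simp
  qed (intro polyf_intros)+
qed

lemma polyf_accepts: "polyf (accepts i a m)"
  unfolding accepts_def accepts_parts_def by (intro polyf_intros)

section \<open>Words as sequences of chunks\<close>

definition chunk_of_nat :: "nat \<Rightarrow> symbol list" where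
  "chunk_of_nat n = map Bit (bits n)"

definition chunk_of_int :: "int \<Rightarrow> symbol list" where
  "chunk_of_int x = Bit (x < 0) # chunk_of_nat (nat \<bar>x\<bar>)"

definition chunk_of_atom :: "'p set \<Rightarrow> 'p \<Rightarrow> symbol list" where
  "chunk_of_atom Atm p = SAtom # chunk_of_nat (to_nat_on Atm p)"

text \<open>Used on two levels: \<open>End\<close> terminates the chunks of a word, and the empty
  chunk terminates the cells of the table. The latter is unambiguous because the name of an atom is
  never empty.\<close>

definition join :: "'a \<Rightarrow> 'a list list \<Rightarrow> 'a list" where
  "join e cs = concat (map (\<lambda>c. c @ [e]) cs)"

lemma join_simps [simp]:
  "join e [] = []" "join e (c # cs) = c @ e # join e cs" "join e (cs @ ds) = join e cs @ join e ds"
  by (simp_all add: join_def)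

lemma join_concat: "join e (concat css) = concat (map (join e) css)"
  by (induction css) simp_all

lemma length_join: "length cs \<le> length (join e cs)"
  by (induction cs) simp_all

lemma hd_rev_join: "cs \<noteq> [] \<Longrightarrow> hd (rev (join e cs)) = e"
  by (cases cs rule: rev_cases) simp_all

lemma split_at_Nil [simp]: "split_at e [] = []"
  by (simp add: split_at_def)

lemma split_at_Cons [simp]:
  "split_at e (x # xs) =
     (if x = e then [] # split_at e xs else (x # hd (split_at e xs)) # tl (split_at e xs))"
  by (simp add: split_at_def)

lemma split_at_join:
  assumes "\<forall>c\<in>set cs. e \<notin> set c"
  shows "split_at e (join e cs) = cs"
  using assms
proof (induction cs)
  case (Cons c cs)
  have "split_at e (c @ e # join e cs) = c # split_at e (join e cs)"
    using Cons.prems by (induction c) auto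
  with Cons show ?case by simp
qed simp

lemma split_at:
  assumes "xs \<noteq> []" "hd (rev xs) = e"
  shows "join e (split_at e xs) = xs \<and> (\<forall>c\<in>set (split_at e xs). e \<notin> set c) \<and> split_at e xs \<noteq> []"
  using assms
proof (induction xs)
  case (Cons x xs)
  show ?case
  proof (cases "xs = []")
    case False
    with Cons have "hd (rev xs) = e" by simp
    with Cons.IH False have IH: "join e (split_at e xs) = xs" "\<forall>c\<in>set (split_at e xs). e \<notin> set c"
      "split_at e xs \<noteq> []" by simp_all
    then obtain c cs where "split_at e xs = c # cs" by (cases "split_at e xs") auto
    with IH show ?thesis by auto
  qed (use Cons.prems in simp)
qed simp

section \<open>Canonical binary numerals\<close>

definition val :: "symbol list \<Rightarrow> nat" where
  "val bs = foldr (\<lambda>c v. v + v + (if c = Bit True then 1 else 0)) bs 0"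

text \<open>Truncating early is harmless: doubling and adding a digit are monotone and never
  decrease a value, so whatever has reached \<open>K\<close> stays there.\<close>

lemma nval_val: "nval K bs = min K (val bs)"
proof (induction bs)
  case (Cons c bs)
  then have "nval K (c # bs) = min K (min K (val bs) + min K (val bs) + (if c = Bit True then 1 else 0))"
    by (simp add: nval_def)
  moreover have "val (c # bs) = val bs + val bs + (if c = Bit True then 1 else 0)"
    by (simp add: val_def)
  ultimately show ?case by (simp add: min_def)
qed (simp add: nval_def val_def)

lemma bits_0 [simp]: "bits 0 = []"
  by (simp add: bits.simps)

text \<open>The premise excludes the digit 0 on top of the value 0, which would be a leading
  zero.\<close>

lemma bits_double: "0 < v \<or> b \<Longrightarrow> bits (v + v + (if b then 1 else 0)) = b # bits v"
  by (subst bits.simps) (auto simp: mult_2[symmetric])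

lemma val_chunk [simp]: "val (chunk_of_nat n) = n"
proof (induction n rule: bits.induct)
  case (1 n)
  show ?case
  proof (cases "n = 0")
    case False
    then have "chunk_of_nat n = Bit (odd n) # chunk_of_nat (n div 2)"
      by (simp add: chunk_of_nat_def bits.simps[of n])
    then have "val (chunk_of_nat n) = n div 2 + n div 2 + (if odd n then 1 else 0)"
      using 1 False by (simp add: val_def)
    also have "\<dots> = n" by presburger
    finally show ?thesis .
  qed (simp add: chunk_of_nat_def val_def)
qed

lemma canon_chunk: "canon (chunk_of_nat n)"
proof (induction n rule: bits.induct)
  case (1 n)
  show ?case
  proof (cases "n = 0")
    case False
    then have c: "chunk_of_nat n = Bit (odd n) # chunk_of_nat (n div 2)"
      by (simp add: chunk_of_nat_def bits.simps[of n])
    show ?thesis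
    proof (cases "n = 1")
      case True
      with c show ?thesis by (simp add: canon_def chunk_of_nat_def)
    next
      case ne: False
      with False have "0 < n div 2" by presburger
      then have "chunk_of_nat (n div 2) \<noteq> []"
        using val_chunk[of "n div 2"] by (metis bits_0 chunk_of_nat_def list.map_disc_iff list.simps(8) not_gr0 val_chunk)
      with c 1 False show ?thesis by (auto simp: canon_def)
    qed
  qed (simp add: chunk_of_nat_def canon_def)
qed

lemma canon_val: "canon bs \<Longrightarrow> bs = chunk_of_nat (val bs)"
proof (induction bs)
  case (Cons c bs)
  from Cons.prems have c: "c = Bit (c = Bit True)" by (auto simp: canon_def)
  have v: "val (c # bs) = val bs + val bs + (if c = Bit True then 1 else 0)"
    by (simp add: val_def)
  show ?case
  proof (cases "bs = []")
    case True
    with Cons.prems show ?thesis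
      using bits_double[of 0 True] by (simp add: canon_def val_def chunk_of_nat_def)
  next
    case False
    with Cons.prems have "canon bs" by (auto simp: canon_def)
    with Cons.IH have IH: "bs = chunk_of_nat (val bs)" by simp
    with False have "0 < val bs" by (metis bits_0 chunk_of_nat_def list.simps(8) not_gr0)
    then have "bits (val (c # bs)) = (c = Bit True) # bits (val bs)"
      unfolding v by (intro bits_double) simp
    with c IH show ?thesis by (simp add: chunk_of_nat_def)
  qed
qed (simp add: val_def chunk_of_nat_def)

lemma nval_chunk [simp]: "nval K (chunk_of_nat n) = min K n"
  by (simp add: nval_val)

lemma chunk_of_nat_inject: "chunk_of_nat m = chunk_of_nat n \<longleftrightarrow> m = n"
  by (metis val_chunk)

lemma chunk_of_nat_eq_Nil: "chunk_of_nat n = [] \<longleftrightarrow> n = 0"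
  using chunk_of_nat_inject[of n 0] by (simp add: chunk_of_nat_def)

lemma int_chunk_of_int: "int_chunk (chunk_of_int x)"
  by (simp add: int_chunk_def chunk_of_int_def canon_chunk chunk_of_nat_eq_Nil)

lemma ival_chunk: "ival K (chunk_of_int x) = clip K x"
  by (auto simp: ival_def chunk_of_int_def clip_def min_def max_def)

lemma int_chunkD: "int_chunk c \<Longrightarrow> \<exists>x. c = chunk_of_int x"
proof -
  assume c: "int_chunk c"
  then obtain b bs where [simp]: "c = Bit b # bs" by (cases c) (auto simp: int_chunk_def)
  from c have bs: "bs = chunk_of_nat (val bs)" and "b \<Longrightarrow> bs \<noteq> []"
    by (auto simp: int_chunk_def intro: canon_val)
  then have "b \<Longrightarrow> 0 < val bs" by (metis chunk_of_nat_eq_Nil not_gr0)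
  with bs have "c = chunk_of_int (if b then - int (val bs) else int (val bs))"
    by (simp add: chunk_of_int_def)
  then show ?thesis by blast
qed

lemma End_notin_chunk:
  "End \<notin> set (chunk_of_nat n)" "End \<notin> set (chunk_of_int x)" "End \<notin> set (chunk_of_atom Atm p)"
  by (auto simp: chunk_of_nat_def chunk_of_int_def chunk_of_atom_def)

lemma enc_chunk:
  "enc_nat n = chunk_of_nat n @ [End]" "enc_int x = chunk_of_int x @ [End]"
  "enc_atom Atm p = chunk_of_atom Atm p @ [End]"
  by (simp_all add: enc_nat_def enc_int_def enc_atom_def chunk_of_nat_def chunk_of_int_def chunk_of_atom_def)

lemma enc_point_join: "enc_point z = join End [chunk_of_int (fst z), chunk_of_int (snd z)]"
  by (simp add: enc_point_def enc_chunk)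

lemma enc_agents_join:
  "enc_agents Agt P = join End (concat (map (\<lambda>k. [chunk_of_int (fst (P (from_nat_into Agt k))),
     chunk_of_int (snd (P (from_nat_into Agt k)))]) [0..<card Agt]))"
  by (simp add: enc_agents_def join_concat enc_point_join comp_def)

lemma enc_table_join:
  "enc_table Atm n l = join End (join [] (map (\<lambda>z. map (chunk_of_atom Atm) (l z)) (grid n)))"
proof -
  have "concat (map (enc_atom Atm) ps) @ [End] = join End (map (chunk_of_atom Atm) ps @ [[]])" for ps
    by (induction ps) (simp_all add: enc_chunk)
  then show ?thesis
    by (simp add: enc_table_def grid_def join_def[of "[]"] join_concat comp_def)
qed

lemma set_grid: "z \<in> set (grid K) \<longleftrightarrow> in_box K z"
  by (cases z) (auto simp: grid_def in_box_def)

lemma distinct_grid: "distinct (grid K)"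
  by (simp add: grid_def distinct_product)

lemma length_grid: "length (grid K) = (2 * K + 1) * (2 * K + 1)"
proof -
  have "nat (2 * int K + 1) = 2 * K + 1" by simp
  then show ?thesis by (simp add: grid_def)
qed


section \<open>Evaluation of encoded formulas\<close>

text \<open>Truth sets by recursion on the formula instead of on its code. This separates the
  correctness of parsing from the comparison with \<open>sat\<close>.\<close>

fun table :: "'p set \<Rightarrow> 'i set \<Rightarrow> env \<Rightarrow> ('p, 'i) form \<Rightarrow> point list" where
  "table Atm Agt E (Atom p) = atom_table E (chunk_of_atom Atm p)"
| "table Atm Agt E (Here i) = here_table E (to_nat_on Agt i)"
| "table Atm Agt E (Neg \<phi>) = neg_table E (table Atm Agt E \<phi>)"
| "table Atm Agt E (Conj \<phi> \<psi>) = conj_table E (table Atm Agt E \<phi>) (table Atm Agt E \<psi>)"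
| "table Atm Agt E (Box \<alpha> \<phi>) = box_table \<alpha> E (table Atm Agt E \<phi>)"

fun atom_chunks :: "'p set \<Rightarrow> ('p, 'i) form \<Rightarrow> symbol list list" where
  "atom_chunks Atm (Atom p) = [chunk_of_atom Atm p]"
| "atom_chunks Atm (Here i) = []"
| "atom_chunks Atm (Neg \<phi>) = atom_chunks Atm \<phi>"
| "atom_chunks Atm (Conj \<phi> \<psi>) = atom_chunks Atm \<phi> @ atom_chunks Atm \<psi>"
| "atom_chunks Atm (Box \<alpha> \<phi>) = atom_chunks Atm \<phi>"

lemma set_atom_chunks: "set (atom_chunks Atm \<phi>) = chunk_of_atom Atm ` atoms \<phi>"
  by (induction \<phi>) (simp_all add: image_Un)

lemma formulas_simps [simp]:
  "Atom p \<in> formulas Atm Agt \<longleftrightarrow> p \<in> Atm" "Here i \<in> formulas Atm Agt \<longleftrightarrow> i \<in> Agt"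
  "Neg \<phi> \<in> formulas Atm Agt \<longleftrightarrow> \<phi> \<in> formulas Atm Agt"
  "Conj \<phi> \<psi> \<in> formulas Atm Agt \<longleftrightarrow> \<phi> \<in> formulas Atm Agt \<and> \<psi> \<in> formulas Atm Agt"
  "Box \<alpha> \<phi> \<in> formulas Atm Agt \<longleftrightarrow> \<phi> \<in> formulas Atm Agt"
  by (auto simp: formulas_def)

lemma to_nat_on_less_card: "finite A \<Longrightarrow> x \<in> A \<Longrightarrow> to_nat_on A x < card A"
  using to_nat_on_finite[of A] by (auto simp: bij_betw_def)

text \<open>Tells which indices are names; these are the conditions that \<open>eval_step\<close>
  tests when a number is closed.\<close>

lemma to_nat_on_surj:
  assumes "countable A" "infinite A \<or> k < card A"
  shows "\<exists>x\<in>A. to_nat_on A x = k"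
proof (cases "finite A")
  case True
  with assms have "k \<in> to_nat_on A ` A" using to_nat_on_finite[of A] by (auto simp: bij_betw_def)
  then show ?thesis by auto
next
  case False
  with assms have "k \<in> to_nat_on A ` A" using to_nat_on_infinite[of A] by (auto simp: bij_betw_def)
  then show ?thesis by auto
qed

lemma eval_number:
  "foldr (eval_step i a m E) (chunk_of_nat n @ [End]) (True, False, [], st, as) =
     (True, True, chunk_of_nat n, st, as)"
proof -
  have "foldr (eval_step i a m E) (map Bit bs) (True, True, [], st, as) = (True, True, map Bit bs, st, as)" for bs
    by (induction bs) simp_all
  then show ?thesis by (simp add: chunk_of_nat_def)
qed

text \<open>Arbitrary \<open>st\<close> and \<open>as\<close> are needed for conjunctions, where the
  left conjunct is evaluated on top of the result of the right one.\<close>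

lemma eval_form:
  assumes "\<phi> \<in> formulas Atm Agt" "finite Agt"
  shows "foldr (eval_step (infinite Atm) (card Atm) (card Agt) E) (enc_form Atm Agt \<phi>) (True, False, [], st, as) =
    (True, False, [], table Atm Agt E \<phi> # st, atom_chunks Atm \<phi> @ as)"
  using assms(1)
proof (induction \<phi> arbitrary: st as)
  case (Atom p)
  then have "infinite Atm \<or> min (card Atm) (to_nat_on Atm p) < card Atm"
    using to_nat_on_less_card[of Atm p] by auto
  then show ?case
    using eval_number[of "infinite Atm" "card Atm" "card Agt" E "to_nat_on Atm p" st as]
    by (simp add: enc_chunk chunk_of_atom_def canon_chunk)
next
  case (Here i)
  then have "to_nat_on Agt i < card Agt"
    using to_nat_on_less_card assms(2) by simp
  then show ?case
    using eval_number[of "infinite Atm" "card Atm" "card Agt" E "to_nat_on Agt i" st as]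
    by (simp add: enc_chunk canon_chunk)
qed simp_all

text \<open>Read from the right, a word not yet rejected is a sequence of complete formulas,
  possibly preceded by a partly read number. A rejection is never revoked, so the induction
  hypothesis always applies.\<close>

lemma eval_sound:
  assumes "countable Atm" "finite Agt"
    and "foldr (eval_step (infinite Atm) (card Atm) (card Agt) E) f (True, False, [], [], []) =
      (True, num, bs, st, as)"
  shows "\<exists>\<phi>s. set \<phi>s \<subseteq> formulas Atm Agt \<and> st = map (table Atm Agt E) \<phi>s \<and>
    as = concat (map (atom_chunks Atm) \<phi>s) \<and>
    f = (if num then bs @ [End] else []) @ concat (map (enc_form Atm Agt) \<phi>s)"
  using assms(3)
proof (induction f arbitrary: num bs st as)
  case Nil
  then show ?case by (intro exI[of _ "[]"]) auto
next
  case (Cons c f)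
  let ?step = "eval_step (infinite Atm) (card Atm) (card Agt) E"
  obtain ok' num' bs' st' as' where s: "foldr ?step f (True, False, [], [], []) = (ok', num', bs', st', as')"
    by (metis prod_cases5)
  with Cons.prems have e: "?step c (ok', num', bs', st', as') = (True, num, bs, st, as)" by simp
  then have [simp]: "ok' = True" by (cases c) simp_all
  from Cons.IH s obtain \<phi>s where \<phi>s: "set \<phi>s \<subseteq> formulas Atm Agt" "st' = map (table Atm Agt E) \<phi>s"
    "as' = concat (map (atom_chunks Atm) \<phi>s)"
    "f = (if num' then bs' @ [End] else []) @ concat (map (enc_form Atm Agt) \<phi>s)" by auto
  show ?case
  proof (cases c)
    case (Bit b)
    with e \<phi>s show ?thesis by (intro exI[of _ \<phi>s]) auto
  next
    case End
    with e \<phi>s show ?thesis by (intro exI[of _ \<phi>s]) auto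
  next
    case SAtom
    with e have n: "num'" "canon bs'" "infinite Atm \<or> nval (card Atm) bs' < card Atm" by auto
    then have v: "bs' = chunk_of_nat (val bs')" by (intro canon_val)
    \<comment> \<open>Truncation at \<open>card Atm\<close> does not affect the comparison with
      \<open>card Atm\<close>. For infinite \<open>Atm\<close> the cardinality is 0 and every index
      is admissible.\<close>
    from n(3) have "infinite Atm \<or> val bs' < card Atm" by (auto simp: nval_val)
    with to_nat_on_surj[OF assms(1)] obtain p where "p \<in> Atm" "to_nat_on Atm p = val bs'" by blast
    with v SAtom e n \<phi>s show ?thesis
      by (intro exI[of _ "Atom p # \<phi>s"]) (auto simp: enc_chunk chunk_of_atom_def)
  next
    case SHere
    with e have n: "num'" "canon bs'" "nval (card Agt) bs' < card Agt" by auto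
    then have v: "bs' = chunk_of_nat (val bs')" by (intro canon_val)
    from n(3) have k: "val bs' < card Agt" "nval (card Agt) bs' = val bs'" by (auto simp: nval_val)
    with to_nat_on_surj[of Agt "val bs'"] assms(2) obtain i where "i \<in> Agt" "to_nat_on Agt i = val bs'"
      by (auto simp: countable_finite)
    with v SHere e n k \<phi>s show ?thesis
      by (intro exI[of _ "Here i # \<phi>s"]) (auto simp: enc_chunk)
  next
    case SNeg
    with e \<phi>s obtain \<phi> \<psi>s where "\<phi>s = \<phi> # \<psi>s" by (cases \<phi>s) auto
    with SNeg e \<phi>s show ?thesis by (intro exI[of _ "Neg \<phi> # \<psi>s"]) auto
  next
    case SConj
    with e \<phi>s obtain \<phi> \<psi> \<psi>s where "\<phi>s = \<phi> # \<psi> # \<psi>s"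
      by (cases \<phi>s; cases "tl \<phi>s") auto
    with SConj e \<phi>s show ?thesis by (intro exI[of _ "Conj \<phi> \<psi> # \<psi>s"]) auto
  next
    case (SBox \<alpha>)
    with e \<phi>s obtain \<phi> \<psi>s where "\<phi>s = \<phi> # \<psi>s" by (cases \<phi>s) auto
    with SBox e \<phi>s show ?thesis by (intro exI[of _ "Box \<alpha> \<phi> # \<psi>s"]) auto
  qed
qed


section \<open>Truth in a finite grid\<close>

lemma dir_rel_iff: "(z, z') \<in> dir_rel d \<longleftrightarrow> z' = shift d z"
  by (cases d; cases z; cases z') auto

lemma ahead_trans: "ahead d x y \<Longrightarrow> ahead d y z \<Longrightarrow> ahead d x z"
  by (cases d) auto

lemma ahead_shift: "ahead d z (shift d z)"
  by (cases d) auto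

lemma ahead_refl: "ahead d z z"
  by (cases d) auto

lemma funpow_shift:
  "(shift Up ^^ k) (x, y) = (x, y + int k)" "(shift Down ^^ k) (x, y) = (x, y - int k)"
  "(shift Rightw ^^ k) (x, y) = (x + int k, y)" "(shift Leftw ^^ k) (x, y) = (x - int k, y)"
  by (induction k) simp_all

lemma aheadD: "ahead d z z' \<Longrightarrow> \<exists>k. z' = (shift d ^^ k) z"
proof (cases z; cases z')
  fix x y x' y' assume z: "z = (x, y)" "z' = (x', y')" and a: "ahead d z z'"
  show ?thesis
  proof (cases d)
    case Up
    with z a show ?thesis by (intro exI[of _ "nat (y' - y)"]) (simp add: funpow_shift)
  next
    case Down
    with z a show ?thesis by (intro exI[of _ "nat (y - y')"]) (simp add: funpow_shift)
  next
    case Rightw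
    with z a show ?thesis by (intro exI[of _ "nat (x' - x)"]) (simp add: funpow_shift)
  next
    case Leftw
    with z a show ?thesis by (intro exI[of _ "nat (x - x')"]) (simp add: funpow_shift)
  qed
qed

lemma dir_rel_star_iff: "(z, z') \<in> (dir_rel d)\<^sup>* \<longleftrightarrow> ahead d z z'"
proof
  assume "(z, z') \<in> (dir_rel d)\<^sup>*"
  then show "ahead d z z'"
    by induction (auto simp: dir_rel_iff ahead_refl intro: ahead_trans[OF _ ahead_shift])
next
  assume "ahead d z z'"
  then obtain k where "z' = (shift d ^^ k) z" using aheadD by blast
  moreover have "(z, (shift d ^^ k) z) \<in> (dir_rel d)\<^sup>*"
    by (induction k) (auto simp: dir_rel_iff intro: rtrancl_into_rtrancl)
  ultimately show "(z, z') \<in> (dir_rel d)\<^sup>*" by simp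
qed

section \<open>Clipping points to the grid\<close>

definition clip_point :: "nat \<Rightarrow> point \<Rightarrow> point" where
  "clip_point K z = (clip K (fst z), clip K (snd z))"

lemma clip_in_box: "in_box K (clip_point K z)"
  by (auto simp: in_box_def clip_point_def clip_def)

lemma clip_id: "in_box K z \<Longrightarrow> clip_point K z = z"
  by (cases z) (auto simp: in_box_def clip_point_def clip_def)

text \<open>Strictness matters: a point outside the smaller box is moved at most to the border at
  distance \<open>K\<close>, which is still outside.\<close>

lemma in_box_clip: "n < K \<Longrightarrow> in_box n (clip_point K z) \<longleftrightarrow> in_box n z"
  by (cases z) (auto simp: in_box_def clip_point_def clip_def)

lemma in_box_mono: "in_box n z \<Longrightarrow> n \<le> K \<Longrightarrow> in_box K z"
  by (auto simp: in_box_def)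

text \<open>A step back from the border reveals one unit of what clipping has hidden, so agreement
  is only claimed for the next smaller radius. This is why a nested box costs one unit of
  radius.\<close>

lemma clip_shift: "clip_point K (shift d (clip_point (Suc K) z)) = clip_point K (shift d z)"
  by (cases d; cases z) (auto simp: clip_point_def clip_def)

lemma clip_ahead: "ahead d z z' \<Longrightarrow> ahead d (clip_point K z) (clip_point K z')"
  by (cases d; cases z; cases z') (auto simp: clip_point_def clip_def)

text \<open>The back condition of a bisimulation between points and their clipped images. The
  witness takes the farther of the two coordinates along the axis; if that is the one of
  \<open>z\<close>, clipping identifies it with the one of \<open>z'\<close>.\<close>

lemma ahead_clip:
  assumes "ahead d (clip_point K z) z'"
  shows "\<exists>z''. ahead d z z'' \<and> clip_point K z'' = clip_point K z'"
proof -
  obtain x y x' y' where z: "z = (x, y)" "z' = (x', y')" by (cases z; cases z')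
  show ?thesis
  proof (cases d)
    case Up
    with assms z show ?thesis
      by (intro exI[of _ "(x, max y y')"]) (auto simp: clip_point_def clip_def)
  next
    case Down
    with assms z show ?thesis
      by (intro exI[of _ "(x, min y y')"]) (auto simp: clip_point_def clip_def)
  next
    case Rightw
    with assms z show ?thesis
      by (intro exI[of _ "(max x x', y)"]) (auto simp: clip_point_def clip_def)
  next
    case Leftw
    with assms z show ?thesis
      by (intro exI[of _ "(min x x', y)"]) (auto simp: clip_point_def clip_def)
  qed
qed

primrec depth :: "('p, 'i) form \<Rightarrow> nat" where
  "depth (Atom p) = 0"
| "depth (Here i) = 0"
| "depth (Neg \<phi>) = depth \<phi>"
| "depth (Conj \<phi> \<psi>) = max (depth \<phi>) (depth \<psi>)"
| "depth (Box \<alpha> \<phi>) = Suc (depth \<phi>)"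

lemma depth_le_length: "depth \<phi> \<le> length (enc_form Atm Agt \<phi>)"
  by (induction \<phi>) auto

text \<open>
  Beyond distance \<open>n + depth \<phi>\<close> from the origin, the truth of \<open>\<phi>\<close> no longer changes along the axes.
\<close>

lemma sat_clip:
  assumes "bounded_model Agt n M" "\<phi> \<in> formulas Atm Agt" "n + depth \<phi> < K"
  shows "sat M (clip_point K z) \<phi> \<longleftrightarrow> sat M z \<phi>"
  using assms(2,3)
proof (induction \<phi> arbitrary: z K)
  case (Atom p)
  show ?case
  proof (cases "in_box n z")
    case True
    with Atom show ?thesis by (simp add: clip_id in_box_mono[of n z K])
  next
    case False
    with Atom have "\<not> in_box n (clip_point K z)" by (simp add: in_box_clip)
    with False assms(1) have "snd M z = {}" "snd M (clip_point K z) = {}"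
      unfolding bounded_model_def by blast+
    then show ?thesis by simp
  qed
next
  case (Here i)
  then have i: "in_box n (fst M i)" using assms(1) by (simp add: bounded_model_def)
  show ?case
  proof (cases "in_box n z")
    case True
    with Here show ?thesis by (simp add: clip_id in_box_mono[of n z K])
  next
    case False
    with Here have "\<not> in_box n (clip_point K z)" by (simp add: in_box_clip)
    with False i show ?thesis by auto
  qed
next
  case (Box \<alpha> \<phi>)
  show ?case
  proof (cases \<alpha>)
    case (Once d)
    \<comment> \<open>The induction hypothesis is used at radius \<open>K'\<close>, once for each of
      the two successors, whose images there coincide.\<close>
    obtain K' where K: "K = Suc K'" using Box.prems by (cases K) auto
    have "sat M (shift d (clip_point K z)) \<phi> \<longleftrightarrow> sat M (clip_point K' (shift d (clip_point K z))) \<phi>"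
      using Box K by simp
    also have "\<dots> \<longleftrightarrow> sat M (shift d z) \<phi>"
      using Box K by (simp add: clip_shift)
    finally show ?thesis by (simp add: Once dir_rel_iff)
  next
    case (Star d)
    have IH: "sat M (clip_point K z) \<phi> \<longleftrightarrow> sat M z \<phi>" for z
      using Box by simp
    show ?thesis
      unfolding Star sat.simps compass_rel.simps dir_rel_star_iff
      using clip_ahead[of d z _ K] ahead_clip[of d K z] IH by metis
  qed
qed simp_all

text \<open>The table lists only atoms of the whole formula \<open>\<Phi>\<close>, so the induction
  runs over formulas whose atoms occur in \<open>\<Phi>\<close>.\<close>

lemma set_table:
  assumes "countable Atm" "finite Agt" and M: "bounded_model Agt n M" "lists_valuation \<Phi> n M l"
    and "\<Phi> \<in> formulas Atm Agt" "n + depth \<Phi> < K"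
    and E: "E = (K, zip (grid n) (map (\<lambda>z. map (chunk_of_atom Atm) (l z)) (grid n)),
      map (\<lambda>k. fst M (from_nat_into Agt k)) [0..<card Agt])"
  shows "set (table Atm Agt E \<Phi>) = {z. in_box K z \<and> sat M z \<Phi>}"
proof -
  have V: "zip (grid n) (map h (grid n)) = map (\<lambda>z. (z, h z)) (grid n)" for h :: "point \<Rightarrow> symbol list list"
    by (simp add: zip_map2 zip_same_conv_map)
  have "set (table Atm Agt E \<phi>) = {z. in_box K z \<and> sat M z \<phi>}"
    if "\<phi> \<in> formulas Atm Agt" "atoms \<phi> \<subseteq> atoms \<Phi>" "n + depth \<phi> < K" for \<phi>
    using that
  proof (induction \<phi>)
    case (Atom p)
    have "chunk_of_atom Atm p \<in> chunk_of_atom Atm ` set (l z) \<longleftrightarrow> p \<in> snd M z" if "in_box n z" for z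
    proof -
      have l: "set (l z) = atoms \<Phi> \<inter> snd M z" using M(2) that unfolding lists_valuation_def by blast
      \<comment> \<open>Different atoms have different names, as the enumeration is injective on the
        countable set \<open>Atm\<close>.\<close>
      moreover have "q = p" if "q \<in> atoms \<Phi>" "chunk_of_atom Atm p = chunk_of_atom Atm q" for q
        using that assms(1,5) Atom.prems inj_on_to_nat_on[of Atm]
        by (auto simp: chunk_of_atom_def chunk_of_nat_inject formulas_def dest: inj_onD)
      ultimately show ?thesis using Atom.prems by auto
    qed
    moreover have "in_box n z" if "p \<in> snd M z" for z
      using that M(1) unfolding bounded_model_def by blast
    ultimately show ?case
      by (auto simp: E V atom_table_def set_grid)
  next
    case (Here i)
    then have "to_nat_on Agt i < card Agt" using assms(2) to_nat_on_less_card by simp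
    moreover have "from_nat_into Agt (to_nat_on Agt i) = i"
      using Here assms(2) by (simp add: countable_finite)
    ultimately show ?case
      by (auto simp: E here_table_def set_grid hd_drop_conv_nth)
  next
    case (Neg \<phi>)
    then show ?case by (auto simp: E neg_table_def set_grid)
  next
    case (Conj \<phi> \<psi>)
    then show ?case by (auto simp: E conj_table_def set_grid)
  next
    case (Box \<alpha> \<phi>)
    then have IH: "set (table Atm Agt E \<phi>) = {z. in_box K z \<and> sat M z \<phi>}" by simp
    have clip: "sat M (clip_point K z) \<phi> \<longleftrightarrow> sat M z \<phi>" for z
      using Box.prems by (intro sat_clip[OF M(1)]) auto
    have "(\<forall>z'. in_box K z' \<longrightarrow> reach K \<alpha> z z' \<longrightarrow> sat M z' \<phi>) \<longleftrightarrow> sat M z (Box \<alpha> \<phi>)" if "in_box K z" for z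
    proof (cases \<alpha>)
      case (Once d)
      then have "(\<forall>z'. in_box K z' \<longrightarrow> reach K \<alpha> z z' \<longrightarrow> sat M z' \<phi>) \<longleftrightarrow> sat M (clip_point K (shift d z)) \<phi>"
        using clip_in_box[of K "shift d z"] by (auto simp: clip_point_def)
      with Once clip show ?thesis by (simp add: dir_rel_iff)
    next
      \<comment> \<open>A point ahead of \<open>z\<close> but outside the grid is replaced by its
        clipped image, which is still ahead of \<open>z\<close> and agrees with it on
        \<open>\<phi>\<close>.\<close>
      case (Star d)
      then show ?thesis
        using clip clip_id[OF that] clip_ahead[of d z _ K] clip_in_box[of K]
        by (simp add: dir_rel_star_iff del: split_paired_All) metis
    qed
    moreover have "(\<forall>z'\<in>set (grid K). reach K \<alpha> z z' \<longrightarrow> z' \<in> set (table Atm Agt E \<phi>)) \<longleftrightarrow>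
        (\<forall>z'. in_box K z' \<longrightarrow> reach K \<alpha> z z' \<longrightarrow> sat M z' \<phi>)" for z
      unfolding IH Ball_def set_grid by blast
    moreover have "fst E = K" by (simp add: E)
    ultimately show ?case
      unfolding table.simps box_table_def by (simp add: set_grid cong: conj_cong del: split_paired_All sat.simps)
  qed
  with assms(5,6) show ?thesis by blast
qed


section \<open>Correctness of the decision procedure\<close>

lemma positions_concat:
  "positions m K (concat (map (\<lambda>k. [chunk_of_int (fst (P k)), chunk_of_int (snd (P k))]) [0..<m])) =
     map (\<lambda>k. clip_point K (P k)) [0..<m]"
proof -
  let ?c = "\<lambda>m. concat (map (\<lambda>k. [chunk_of_int (fst (P k)), chunk_of_int (snd (P k))]) [0..<m])"
  have len: "length (?c m) = m + m" for m by (induction m) simp_all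
  have "?c m ! (k + k) = chunk_of_int (fst (P k)) \<and> ?c m ! Suc (k + k) = chunk_of_int (snd (P k))"
    if "k < m" for k
    using that
  proof (induction m)
    case (Suc m)
    then show ?case by (cases "k = m") (auto simp: nth_append len)
  qed simp
  then show ?thesis
    by (auto simp: positions_def hd_drop_conv_nth len ival_chunk clip_point_def)
qed

lemma accepts_complete:
  assumes "countable Atm" "finite Agt" and \<phi>: "\<phi> \<in> formulas Atm Agt"
    and M: "bounded_model Agt n M" "lists_valuation \<phi> n M l" and sat: "sat M z \<phi>"
  shows "accepts (infinite Atm) (card Atm) (card Agt) (enc_instance Atm Agt \<phi> n M l z)"
proof -
  define P where "P k = fst M (from_nat_into Agt k)" for k
  define m where "m = card Agt"
  define cells where "cells = map (\<lambda>z. map (chunk_of_atom Atm) (l z)) (grid n)"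
  define ag where "ag = concat (map (\<lambda>k. [chunk_of_int (fst (P k)), chunk_of_int (snd (P k))]) [0..<m])"
  define t where "t = join [] cells"
  define e where "e = [chunk_of_int (fst z), chunk_of_int (snd z)]"
  define cs where "cs = chunk_of_nat n # ag @ t @ e"
  define w where "w = enc_instance Atm Agt \<phi> n M l z"
  define K where "K = length w"
  have w: "w = enc_form Atm Agt \<phi> @ join End cs"
    unfolding w_def enc_instance_def cs_def
    by (simp add: enc_chunk enc_agents_join enc_table_join enc_point_join e_def t_def cells_def ag_def P_def m_def)
  have End: "\<forall>c\<in>set cs. End \<notin> set c"
    by (auto simp: cs_def ag_def t_def cells_def e_def join_def End_notin_chunk)
  have cells_ne: "\<forall>cell\<in>set cells. [] \<notin> set cell"
    by (auto simp: cells_def chunk_of_atom_def)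
  have len: "length cells = (2 * n + 1) * (2 * n + 1)"
    by (simp add: cells_def length_grid)
  then have ne: "cells \<noteq> []" by auto
  \<comment> \<open>Every cell is closed by its own chunk, so the table alone makes the word longer
    than \<open>n\<close>; the formula accounts for its depth.\<close>
  have "length cells \<le> length (join End cs)"
    using length_join[of cells "[]"] length_join[of cs End] by (simp add: cs_def t_def)
  with len depth_le_length[of \<phi> Atm Agt] have K: "n + depth \<phi> < K"
    by (simp add: K_def w)
  have ival: "ival K (chunk_of_int (fst z)) = fst (clip_point K z)" "ival K (chunk_of_int (snd z)) = snd (clip_point K z)" for z
    by (simp_all add: ival_chunk clip_point_def)
  have box: "in_box n (P k)" if "k < m" for k
  proof -
    from that have "Agt \<noteq> {}" by (auto simp: m_def)
    then have "from_nat_into Agt k \<in> Agt" by (rule from_nat_into)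
    with M(1) show ?thesis by (simp add: bounded_model_def P_def)
  qed
  then have pos: "positions m K ag = map P [0..<m]"
    unfolding ag_def positions_concat using K by (auto simp: clip_id in_box_mono[of n _ K])
  define E where "E = (K, zip (grid n) cells, map P [0..<m])"
  have E: "E = (K, zip (grid n) (map (\<lambda>z. map (chunk_of_atom Atm) (l z)) (grid n)),
      map (\<lambda>k. fst M (from_nat_into Agt k)) [0..<card Agt])"
    by (simp add: E_def cells_def P_def m_def)
  have eval_word: "eval_word (infinite Atm) (card Atm) m E (enc_form Atm Agt \<phi>) =
      (True, False, [], [table Atm Agt E \<phi>], atom_chunks Atm \<phi>)"
    using eval_form[OF \<phi> assms(2), of E "[]" "[]"] by (simp add: eval_word_def m_def)
  \<comment> \<open>The machine sees the position only through truncated numerals, that is, clipped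
    to the grid; this preserves the truth of \<open>\<phi>\<close>.\<close>
  have "clip_point K z \<in> set (table Atm Agt E \<phi>)"
    using set_table[OF assms(1,2) M \<phi> K E] sat_clip[OF M(1) \<phi> K, of z] clip_in_box[of K z] sat by simp
  moreover have "c \<in> set (atom_chunks Atm \<phi>)" if "cell \<in> set cells" "c \<in> set cell" for cell c
    using that M(2) by (auto simp: cells_def set_atom_chunks lists_valuation_def set_grid simp del: split_paired_All)
  moreover have nval: "nval K (chunk_of_nat n) = n"
    using K by simp
  moreover have split: "split_at [] t = cells"
    by (simp add: t_def split_at_join cells_ne)
  moreover have cells_length: "length cells = length (grid n)"
    by (simp add: cells_def)
  moreover have "length ag = m + m"
    unfolding ag_def by (induction m) simp_all
  moreover have "\<forall>c\<in>set ag. int_chunk c"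
    by (auto simp: ag_def int_chunk_of_int)
  moreover have "t \<noteq> []" "hd (rev t) = []"
    using ne hd_rev_join[OF ne] by (cases cells; simp add: t_def)+
  ultimately have "accepts_parts (infinite Atm) (card Atm) m K (enc_form Atm Agt \<phi>) (chunk_of_nat n) ag t e"
    using box unfolding accepts_parts_def Let_def nval split pos E_def[symmetric] eval_word
    by (auto simp: canon_chunk e_def int_chunk_of_int ival set_grid cells_length)
  moreover have "(enc_form Atm Agt \<phi>, join End cs) \<in> set (splits w)"
    by (simp add: set_splits w)
  moreover have "(ag, t @ e) \<in> set (splits (tl cs))" "(t, e) \<in> set (splits (t @ e))"
    by (simp_all add: set_splits cs_def)
  moreover have "hd cs = chunk_of_nat n"
    by (simp add: cs_def)
  moreover have "join End cs \<noteq> []" "hd (rev (join End cs)) = End"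
    using hd_rev_join[of cs End] by (simp_all add: cs_def)
  ultimately have "accepts (infinite Atm) (card Atm) m w"
    unfolding accepts_def
    by (intro bexI[of _ "(enc_form Atm Agt \<phi>, join End cs)"] conjI bexI[of _ "(ag, t @ e)"] bexI[of _ "(t, e)"])
      (simp_all add: split_at_join[OF End] K_def[symmetric])
  then show ?thesis by (simp add: w_def m_def)
qed

text \<open>Parsing yields the formula, but the integers, the valuation and the table have to be
  reconstructed from the chunks, and all bounds must be shown for the true values although only
  truncated ones were tested.\<close>

lemma accepts_sound:
  assumes "countable Atm" "finite Agt" and acc: "accepts (infinite Atm) (card Atm) (card Agt) w"
  shows "w \<in> model_checking Atm Agt"
proof -
  define m where "m = card Agt"
  define K where "K = length w"
  from acc obtain f r ag t e where w: "w = f @ r" "r \<noteq> []" "hd (rev r) = End"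
    and cs: "tl (split_at End r) = ag @ t @ e"
    and parts: "accepts_parts (infinite Atm) (card Atm) m K f (hd (split_at End r)) ag t e"
    unfolding accepts_def m_def K_def by (auto simp: set_splits)
  define cn where "cn = hd (split_at End r)"
  from split_at[OF w(2,3)] cs have r: "r = join End (cn # ag @ t @ e)"
    by (metis cn_def list.collapse)
  define n where "n = val cn"
  define n' where "n' = nval K cn"
  define cells where "cells = split_at [] t"
  define ps where "ps = positions m K ag"
  define E where "E = (K, zip (grid n') cells, ps)"
  obtain ok num bs st as where S: "eval_word (infinite Atm) (card Atm) m E f = (ok, num, bs, st, as)"
    by (metis prod_cases5)
  have cn: "canon cn" and ag: "length ag = m + m" "\<forall>c\<in>set ag. int_chunk c" and t: "t \<noteq> []" "hd (rev t) = []"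
    and e: "length e = 2" "\<forall>c\<in>set e. int_chunk c"
    and len: "length cells = length (grid n')" and ps: "\<forall>z\<in>set ps. in_box n' z"
    and ok: "ok" "\<not> num" "length st = 1"
    and z: "(ival K (hd e), ival K (hd (tl e))) \<in> set (hd st)"
    and as: "\<forall>cell\<in>set cells. \<forall>c\<in>set cell. c \<in> set as"
    using parts S
    unfolding accepts_parts_def Let_def cn_def[symmetric] n'_def[symmetric] cells_def[symmetric]
      ps_def[symmetric] E_def[symmetric]
    by (simp_all add: set_grid)
  have cn_chunk: "cn = chunk_of_nat n" using canon_val[OF cn] by (simp add: n_def)
  have t_join: "t = join [] cells" using split_at[OF t] by (simp add: cells_def)
  have "length cells \<le> length r"
    using length_join[of cells "[]"] length_join[of "cn # ag @ t @ e" End] by (simp add: r t_join)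
  then have Kbound: "length f + length (grid n') \<le> K" by (simp add: K_def w len)
  then have "n' < K" by (simp add: length_grid)
  \<comment> \<open>The grid of radius \<open>n'\<close> has as many points as the table has cells,
    hence \<open>n'\<close> lies below the truncation point and is the true value.\<close>
  then have n': "n' = n" by (simp add: n'_def nval_val n_def min_def split: if_splits)
  have "\<exists>\<phi>s. set \<phi>s \<subseteq> formulas Atm Agt \<and> st = map (table Atm Agt E) \<phi>s \<and>
    as = concat (map (atom_chunks Atm) \<phi>s) \<and>
    f = (if num then bs @ [End] else []) @ concat (map (enc_form Atm Agt) \<phi>s)"
    using eval_sound[OF assms(1,2), of E f num bs st as] S ok by (simp add: eval_word_def m_def)
  then obtain \<phi>s where \<phi>s: "set \<phi>s \<subseteq> formulas Atm Agt" "st = map (table Atm Agt E) \<phi>s"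
    "as = concat (map (atom_chunks Atm) \<phi>s)" "f = concat (map (enc_form Atm Agt) \<phi>s)"
    using ok by auto
  with ok(3) obtain \<phi> where "\<phi>s = [\<phi>]" by (auto simp: length_Suc_conv)
  with \<phi>s have \<phi>: "\<phi> \<in> formulas Atm Agt" "st = [table Atm Agt E \<phi>]" "as = atom_chunks Atm \<phi>"
    "f = enc_form Atm Agt \<phi>" by simp_all
  obtain v where v: "\<And>c. int_chunk c \<Longrightarrow> c = chunk_of_int (v c)"
    using int_chunkD by metis
  define P where "P k = (v (ag ! (k + k)), v (ag ! Suc (k + k)))" for k
  define zp where "zp = (v (e ! 0), v (e ! 1))"
  have e_chunks: "e = [chunk_of_int (fst zp), chunk_of_int (snd zp)]"
    using e v by (auto simp: zp_def numeral_2_eq_2 length_Suc_conv)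
  have "concat (map (\<lambda>k. [xs ! (k + k), xs ! Suc (k + k)]) [0..<j]) = xs" if "length xs = j + j"
    for xs :: "symbol list list" and j
    using that
  proof (induction j arbitrary: xs)
    case (Suc j)
    obtain ys a b where xs: "xs = ys @ [a, b]" "length ys = j + j"
    proof -
      have "xs = take (j + j) xs @ [xs ! (j + j), xs ! Suc (j + j)]"
        using Suc.prems by (intro nth_equalityI) (auto simp: nth_append less_Suc_eq)
      moreover have "length (take (j + j) xs) = j + j" using Suc.prems by simp
      ultimately show ?thesis using that by blast
    qed
    have eq: "map (\<lambda>k. [xs ! (k + k), xs ! Suc (k + k)]) [0..<j] = map (\<lambda>k. [ys ! (k + k), ys ! Suc (k + k)]) [0..<j]"
      using xs by (auto simp: nth_append)
    have ab: "xs ! (j + j) = a" "xs ! Suc (j + j) = b"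
      using xs by (simp_all add: nth_append)
    have "concat (map (\<lambda>k. [xs ! (k + k), xs ! Suc (k + k)]) [0..<Suc j]) =
        concat (map (\<lambda>k. [xs ! (k + k), xs ! Suc (k + k)]) [0..<j]) @ [xs ! (j + j), xs ! Suc (j + j)]"
      by simp
    then show ?case
      unfolding eq ab Suc.IH[OF xs(2)] xs(1)[symmetric] .
  qed simp
  from this[OF ag(1)] have ag_chunks:
    "ag = concat (map (\<lambda>k. [chunk_of_int (fst (P k)), chunk_of_int (snd (P k))]) [0..<m])"
  proof -
    have "map (\<lambda>k. [ag ! (k + k), ag ! Suc (k + k)]) [0..<m] =
        map (\<lambda>k. [chunk_of_int (fst (P k)), chunk_of_int (snd (P k))]) [0..<m]"
      using ag v[of "ag ! (_ + _)"] v[of "ag ! Suc (_ + _)"] by (simp add: P_def)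
    with \<open>concat (map (\<lambda>k. [ag ! (k + k), ag ! Suc (k + k)]) [0..<m]) = ag\<close> show ?thesis by simp
  qed
  have ps_eq: "ps = map (\<lambda>k. clip_point K (P k)) [0..<m]"
    unfolding ps_def by (subst ag_chunks) (rule positions_concat)
  \<comment> \<open>The test saw clipped positions. Since \<open>n\<close> is smaller than
    \<open>K\<close>, a clipped position in the box comes from a position in the box.\<close>
  have box: "in_box n (P k)" if "k < m" for k
    using ps that in_box_clip[OF \<open>n' < K\<close>] by (auto simp: ps_eq n')
  then have ps_P: "ps = map P [0..<m]"
    using \<open>n' < K\<close> by (auto simp: ps_eq n' clip_id in_box_mono[of n _ K])
  define cell where "cell z = the (map_of (zip (grid n) cells) z)" for z
  have cells: "cells = map cell (grid n)"
  proof (rule nth_equalityI)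
    show "length cells = length (map cell (grid n))" using len by (simp add: n')
    show "cells ! j = map cell (grid n) ! j" if "j < length cells" for j
      using that len distinct_grid[of n] by (simp add: n' cell_def map_of_zip_nth)
  qed
  \<comment> \<open>Every chunk in a cell was found among the atoms read in the formula, so it names
    an atom of \<open>\<phi>\<close>; \<open>u\<close> chooses one.\<close>
  obtain u where u: "\<And>c. c \<in> set as \<Longrightarrow> u c \<in> atoms \<phi>" "\<And>c. c \<in> set as \<Longrightarrow> chunk_of_atom Atm (u c) = c"
  proof -
    have "\<forall>c\<in>set as. \<exists>p. p \<in> atoms \<phi> \<and> chunk_of_atom Atm p = c"
      by (auto simp: \<phi>(3) set_atom_chunks)
    from bchoice[OF this] that show ?thesis by blast
  qed
  define l where "l z = map u (cell z)" for z
  \<comment> \<open>Agent positions are recovered through the enumeration index, and the valuation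
    is made empty outside the box as boundedness requires.\<close>
  define M where "M = (\<lambda>i. P (to_nat_on Agt i), \<lambda>z. if in_box n z then set (l z) else {})"
  have cell_as: "c \<in> set as" if "in_box n z" "c \<in> set (cell z)" for z c
    using that as by (auto simp: cells set_grid simp del: split_paired_All)
  then have l_cell: "map (chunk_of_atom Atm) (l z) = cell z" if "in_box n z" for z
    unfolding l_def map_map using cell_as[OF that] u(2) by (intro map_idI) simp
  have l_atoms: "set (l z) \<subseteq> atoms \<phi>" if "in_box n z" for z
    unfolding l_def set_map using cell_as[OF that] u(1) by blast
  have M1: "bounded_model Agt n M"
    using box to_nat_on_less_card[OF assms(2)] unfolding bounded_model_def M_def m_def by auto
  have M2: "lists_valuation \<phi> n M l"
    using l_atoms unfolding lists_valuation_def M_def by auto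
  have M3: "spatial_model Atm M"
    using l_atoms \<phi>(1) unfolding spatial_model_def M_def formulas_def by auto
  have fstM: "fst M (from_nat_into Agt k) = P k" if "k < m" for k
    using that to_nat_on_surj[of Agt k] assms(2) by (auto simp: M_def m_def countable_finite)
  have cells_l: "cells = map (\<lambda>z. map (chunk_of_atom Atm) (l z)) (grid n)"
    by (simp add: cells l_cell set_grid)
  have E: "E = (K, zip (grid n) (map (\<lambda>z. map (chunk_of_atom Atm) (l z)) (grid n)),
      map (\<lambda>k. fst M (from_nat_into Agt k)) [0..<card Agt])"
    using fstM by (simp add: E_def n' ps_P cells_l[symmetric] m_def)
  have K: "n + depth \<phi> < K"
    using Kbound depth_le_length[of \<phi> Atm Agt] by (simp add: \<phi>(4) n' length_grid)
  have "clip_point K zp \<in> set (table Atm Agt E \<phi>)"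
    using z by (simp add: \<phi>(2) e_chunks ival_chunk clip_point_def)
  then have "sat M zp \<phi>"
    using set_table[OF assms(1,2) M1 M2 \<phi>(1) K E] sat_clip[OF M1 \<phi>(1) K] by simp
  moreover have "w = enc_instance Atm Agt \<phi> n M l zp"
  proof -
    have "enc_agents Agt (fst M) = join End ag"
      unfolding enc_agents_join ag_chunks m_def[symmetric]
      using fstM by (intro arg_cong[where f = "join End"] arg_cong[where f = concat] map_cong) simp_all
    then show ?thesis
      by (simp add: w(1) r \<phi>(4) enc_instance_def cn_chunk enc_chunk enc_table_join enc_point_join
          t_join cells_l[symmetric] e_chunks)
  qed
  ultimately show ?thesis
    unfolding model_checking_def using \<phi>(1) M1 M2 M3 by blast
qed

theorem theorem3:
  fixes Atm :: "'p set" and Agt :: "'i set"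
  assumes "countable Atm" and "finite Agt"
  shows "model_checking Atm Agt \<in> polynomial_time"
proof (rule polynomial_time_polyf)
  have "accepts (infinite Atm) (card Atm) (card Agt) w \<longleftrightarrow> w \<in> model_checking Atm Agt" for w
    using accepts_sound[OF assms] accepts_complete[OF assms] unfolding model_checking_def by blast
  then have "accepts (infinite Atm) (card Atm) (card Agt) = (\<lambda>w. w \<in> model_checking Atm Agt)"
    by blast
  with polyf_accepts show "polyf (\<lambda>w. w \<in> model_checking Atm Agt)"
    by metis
qed

end
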